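(* Let $s\in\mathbb N$ and let $\alpha,\beta\in\mathbb R$. Let $\mathcal D_{\alpha,\beta,s}(\mathbb R)$ be the vector space of functions $f\in L^2(\mathbb R)$ that can be expressed as some finite sum of $(\alpha,\beta)$-differences of order $2s$. Then the following conditions (i)–(iii) are equivalent for a function $f\in L^2(\mathbb R)$. (i) $\displaystyle\int_{-\infty}^{\infty}\frac{|\widehat f(x)|^2}{(x-\alpha)^{2s}(x-\beta)^{2s}}\,dx<\infty.$ (ii) $f\in\mathcal D_{\alpha,\beta,s}(\mathbb R)$. (iii) There are $u_1,u_2,\ldots,u_{4s+1}\in\mathbb R$ and $f_1,f_2,\ldots,f_{4s+1}\in L^2(\mathbb R)$ such that $$f=\sum_{j=1}^{4s+1}\left[\left(e^{iu_j\left(\frac{\alpha-\beta}{2}\right)}+e^{-iu_j\left(\frac{\alpha-\beta}{2}\right)}\right)\delta_0-\left(e^{iu_j\left(\frac{\alpha+\beta}{2}\right)}\delta_{u_j}+e^{-iu_j\left(\frac{\alpha+\beta}{2}\right)}\delta_{-u_j}\right)\right]^s\ast f_j.\qquad(\ast)$$ When the preceding conditions hold for a given function $f\in L^2(\mathbb R)$, for almost all $(u_1,u_2,\ldots,u_{4s+1})\in\mathbb R^{4s+1}$ there are $f_1,f_2,\ldots,f_{4s+1}\in L^2(\mathbb R)$ such that $(\ast)$ holds. Also, $\mathcal D_{\alpha,\beta,s}(\mathbb R)$ is a Hilbert space with the inner product $\langle\,\cdot\,,\,\cdot\,\rangle_{\alpha,\beta,s}$ given by $$\langle f,g\rangle_{\alpha,\beta,s}=\int_{-\infty}^{\infty}\left(1+\frac{1}{(x-\alpha)^{2s}(x-\beta)^{2s}}\right)\widehat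 f(x)\,\overline{\widehat g(x)}\,dx,\quad\text{for } f,g\in\mathcal D_{\alpha,\beta,s}(\mathbb R).$$ The operator $(D^2-i(\alpha+\beta)D-\alpha\beta I)^s$ is a linear, bounded and invertible operator that maps $W^{2s}(\mathbb R)$ onto $\mathcal D_{\alpha,\beta,s}(\mathbb R)$.
   Context: $L^2(\mathbb R)$ is the space of complex-valued square-integrable functions. $\widehat f$ denotes the Fourier transform of $f\in L^2(\mathbb R)$, namely the extension to $L^2(\mathbb R)$ of the transform $\widehat f(x)=\int_{-\infty}^{\infty}e^{-ixu}f(u)\,du$. $\delta_x$ is the Dirac measure at $x\in\mathbb R$, $\ast$ denotes convolution (of bounded Borel measures on $\mathbb R$, and of such measures with $L^2(\mathbb R)$ functions), and the $s$-th power $[\,\cdot\,]^s$ of a measure is its $s$-fold convolution power. For $\alpha,\beta\in\mathbb R$ and $s\in\mathbb N=\{1,2,\ldots\}$, an $(\alpha,\beta)$-difference of order $2s$ (also called a generalised $(\alpha,\beta)$-difference of order $2s$) is a function $f\in L^2(\mathbb R)$ such that for some $g\in L^2(\mathbb R)$ and some $u\in\mathbb R$, $$f=\left[\left(e^{iu\left(\frac{\alpha-\beta}{2}\right)}+e^{-iu\left(\frac{\alpha-\beta}{2}\right)}\right)\delta_0-\left(e^{iu\left(\frac{\alpha+\beta}{2}\right)}\delta_u+e^{-iu\left(\frac{\alpha+\beta}{2}\right)}\delta_{-u}\right)\right]^s\ast g.$$ $D$ denotes differentiation in the sense of Schwartz distributions and $I$ the identity operator. For $k\in\mathbb N$, $W^{k}(\mathbb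 R)$ is the Sobolev space of all $f\in L^2(\mathbb R)$ with $D^{k}f\in L^2(\mathbb R)$; it is a Hilbert space with inner product $\langle f,g\rangle_{\mathbb R,k}=\int_{-\infty}^{\infty}(1+|x|^{2k})\widehat f(x)\overline{\widehat g(x)}\,dx$. Boundedness and invertibility of the operator refer to this norm on $W^{2s}(\mathbb R)$ (with $k=2s$) and the norm from $\langle\cdot,\cdot\rangle_{\alpha,\beta,s}$ on $\mathcal D_{\alpha,\beta,s}(\mathbb R)$. *)

theory Defs
  imports "HOL-Analysis.Analysis"
begin

text \<open>
  Elements of \<open>L\<^sup>2(\<real>)\<close> are represented by Borel measurable functions, so equality in
  \<open>L\<^sup>2(\<real>)\<close> is \<^term>\<open>ae_eq\<close>.
\<close>

definition L2 :: "(real \<Rightarrow> complex) set" where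
  "L2 = {f \<in> borel_measurable lborel. integrable lborel (\<lambda>x. (norm (f x))\<^sup>2)}"

definition ae_eq :: "(real \<Rightarrow> complex) \<Rightarrow> (real \<Rightarrow> complex) \<Rightarrow> bool" where
  "ae_eq f g \<longleftrightarrow> (AE x in lborel. f x = g x)"

definition L2_tendsto :: "(nat \<Rightarrow> real \<Rightarrow> complex) \<Rightarrow> (real \<Rightarrow> complex) \<Rightarrow> bool" where
  "L2_tendsto h f \<longleftrightarrow>
     (\<lambda>n. \<integral>\<^sup>+ x. ennreal ((norm (h n x - f x))\<^sup>2) \<partial>lborel) \<longlonglongrightarrow> 0"


section \<open>Fourier transform\<close>

definition fourier_L1 :: "(real \<Rightarrow> complex) \<Rightarrow> real \<Rightarrow> complex" where
  "fourier_L1 f x = (LINT u|lborel. cis (- (x * u)) * f u)"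

text \<open>
  Extension by continuity from \<open>L\<^sup>1 \<inter> L\<^sup>2\<close> to \<open>L\<^sup>2\<close>. The function selected is determined up to
  equality almost everywhere, since \<open>L\<^sup>1 \<inter> L\<^sup>2\<close> is dense in \<open>L\<^sup>2\<close>; that there is one at all is
  part of Plancherel's theorem.
\<close>

definition fourier :: "(real \<Rightarrow> complex) \<Rightarrow> real \<Rightarrow> complex" where
  "fourier f = (SOME g. g \<in> L2 \<and>
     (\<forall>h. (\<forall>n. h n \<in> L2 \<and> integrable lborel (h n)) \<and> L2_tendsto h f
            \<longrightarrow> L2_tendsto (\<lambda>n. fourier_L1 (h n)) g))"


section \<open>Complex Borel measures and convolution\<close>

text \<open>
  A bounded complex Borel measure is represented by its set function; only the values on Borel
  sets are relevant. Integration uses the Jordan decompositions of the real and imaginary part,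
  with the positive part of a signed measure given by its upper variation. (\<^const>\<open>ennreal\<close>
  sends negative numbers to \<open>0\<close>, which does not affect the supremum, as \<open>B = {}\<close> is admitted.)
\<close>

type_synonym cmeasure = "real set \<Rightarrow> complex"

definition upper_variation :: "(real set \<Rightarrow> real) \<Rightarrow> real measure" where
  "upper_variation \<nu> =
     measure_of UNIV (sets borel) (\<lambda>A. SUP B \<in> {B \<in> sets borel. B \<subseteq> A}. ennreal (\<nu> B))"

definition cm_integral :: "cmeasure \<Rightarrow> (real \<Rightarrow> complex) \<Rightarrow> complex" where
  "cm_integral \<mu> f =
     ((LINT x|upper_variation (\<lambda>B. Re (\<mu> B)). f x) - (LINT x|upper_variation (\<lambda>B. - Re (\<mu> B)). f x))
     + \<i> * ((LINT x|upper_variation (\<lambda>B. Im (\<mu> B)). f x) - (LINT x|upper_variation (\<lambda>B. - Im (\<mu> B)). f x))"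

definition dirac :: "real \<Rightarrow> cmeasure" where
  "dirac a A = indicator A a"

text \<open>\<open>(\<mu> \<^emph> \<nu>)(A) = \<integral> \<mu>(A - y) d\<nu>(y)\<close>\<close>

definition cm_conv :: "cmeasure \<Rightarrow> cmeasure \<Rightarrow> cmeasure" where
  "cm_conv \<mu> \<nu> A = cm_integral \<nu> (\<lambda>y. \<mu> {x. x + y \<in> A})"

primrec cm_power :: "cmeasure \<Rightarrow> nat \<Rightarrow> cmeasure" where
  "cm_power \<mu> 0 = dirac 0"
| "cm_power \<mu> (Suc n) = cm_conv \<mu> (cm_power \<mu> n)"

definition cm_conv_fun :: "cmeasure \<Rightarrow> (real \<Rightarrow> complex) \<Rightarrow> real \<Rightarrow> complex" where
  "cm_conv_fun \<mu> g x = cm_integral \<mu> (\<lambda>y. g (x - y))"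


section \<open>Generalised differences\<close>

definition difference_measure :: "real \<Rightarrow> real \<Rightarrow> real \<Rightarrow> cmeasure" where
  "difference_measure \<alpha> \<beta> u A =
     (cis (u * ((\<alpha> - \<beta>) / 2)) + cis (- (u * ((\<alpha> - \<beta>) / 2)))) * dirac 0 A
     - (cis (u * ((\<alpha> + \<beta>) / 2)) * dirac u A + cis (- (u * ((\<alpha> + \<beta>) / 2))) * dirac (- u) A)"

definition is_difference :: "real \<Rightarrow> real \<Rightarrow> nat \<Rightarrow> (real \<Rightarrow> complex) \<Rightarrow> bool" where
  "is_difference \<alpha> \<beta> s f \<longleftrightarrow> f \<in> L2 \<and>
     (\<exists>g\<in>L2. \<exists>u. ae_eq f (cm_conv_fun (cm_power (difference_measure \<alpha> \<beta> u) s) g))"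

definition diff_space :: "real \<Rightarrow> real \<Rightarrow> nat \<Rightarrow> (real \<Rightarrow> complex) set" where
  "diff_space \<alpha> \<beta> s = {f \<in> L2. \<exists>(n::nat) h. (\<forall>j<n. is_difference \<alpha> \<beta> s (h j)) \<and>
     ae_eq f (\<lambda>x. \<Sum>j<n. h j x)}"


section \<open>Inner products and operators\<close>

definition weighted_inner ::
  "(real \<Rightarrow> real) \<Rightarrow> (real \<Rightarrow> complex) \<Rightarrow> (real \<Rightarrow> complex) \<Rightarrow> complex" where
  "weighted_inner w f g = (LINT x|lborel. of_real (w x) * fourier f x * cnj (fourier g x))"

text \<open>At the points \<open>\<alpha>\<close> and \<open>\<beta>\<close> this weight has the value \<open>1\<close>, as \<open>1 / 0 = 0\<close>; they form a null set.\<close>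

definition diff_weight :: "real \<Rightarrow> real \<Rightarrow> nat \<Rightarrow> real \<Rightarrow> real" where
  "diff_weight \<alpha> \<beta> s x = 1 + 1 / ((x - \<alpha>) ^ (2 * s) * (x - \<beta>) ^ (2 * s))"

abbreviation diff_inner ::
  "real \<Rightarrow> real \<Rightarrow> nat \<Rightarrow> (real \<Rightarrow> complex) \<Rightarrow> (real \<Rightarrow> complex) \<Rightarrow> complex" where
  "diff_inner \<alpha> \<beta> s \<equiv> weighted_inner (diff_weight \<alpha> \<beta> s)"

abbreviation sobolev_inner :: "nat \<Rightarrow> (real \<Rightarrow> complex) \<Rightarrow> (real \<Rightarrow> complex) \<Rightarrow> complex" where
  "sobolev_inner k \<equiv> weighted_inner (\<lambda>x. 1 + \<bar>x\<bar> ^ (2 * k))"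

definition ip_norm ::
  "((real \<Rightarrow> complex) \<Rightarrow> (real \<Rightarrow> complex) \<Rightarrow> complex) \<Rightarrow> (real \<Rightarrow> complex) \<Rightarrow> real" where
  "ip_norm ip f = sqrt (Re (ip f f))"

definition L2_subspace :: "(real \<Rightarrow> complex) set \<Rightarrow> bool" where
  "L2_subspace V \<longleftrightarrow> V \<subseteq> L2 \<and> (\<lambda>x. 0) \<in> V \<and>
     (\<forall>f\<in>V. \<forall>g\<in>V. (\<lambda>x. f x + g x) \<in> V) \<and>
     (\<forall>f\<in>V. \<forall>c. (\<lambda>x. c * f x) \<in> V)"

text \<open>Hilbert space structure on the quotient of \<open>V\<close> by \<^term>\<open>ae_eq\<close>.\<close>

definition hilbert_space ::
  "(real \<Rightarrow> complex) set \<Rightarrow> ((real \<Rightarrow> complex) \<Rightarrow> (real \<Rightarrow> complex) \<Rightarrow> complex) \<Rightarrow> bool" where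
  "hilbert_space V ip \<longleftrightarrow> L2_subspace V \<and>
     (\<forall>f\<in>V. \<forall>f'\<in>V. \<forall>g\<in>V. ae_eq f f' \<longrightarrow> ip f g = ip f' g) \<and>
     (\<forall>f\<in>V. \<forall>f'\<in>V. \<forall>g\<in>V. ip (\<lambda>x. f x + f' x) g = ip f g + ip f' g) \<and>
     (\<forall>f\<in>V. \<forall>g\<in>V. \<forall>c. ip (\<lambda>x. c * f x) g = c * ip f g) \<and>
     (\<forall>f\<in>V. \<forall>g\<in>V. ip g f = cnj (ip f g)) \<and>
     (\<forall>f\<in>V. 0 \<le> Re (ip f f)) \<and>
     (\<forall>f\<in>V. ip f f = 0 \<longrightarrow> ae_eq f (\<lambda>x. 0)) \<and>
     (\<forall>h. (\<forall>n::nat. h n \<in> V) \<and>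
          (\<forall>e>0. \<exists>N. \<forall>m\<ge>N. \<forall>n\<ge>N. ip_norm ip (\<lambda>x. h m x - h n x) < e)
        \<longrightarrow> (\<exists>f\<in>V. (\<lambda>n. ip_norm ip (\<lambda>x. h n x - f x)) \<longlonglongrightarrow> 0))"

text \<open>
  The following notions likewise refer to the maps induced on the quotients by \<^term>\<open>ae_eq\<close>.
\<close>

definition linear_operator ::
  "(real \<Rightarrow> complex) set \<Rightarrow> (real \<Rightarrow> complex) set \<Rightarrow>
   ((real \<Rightarrow> complex) \<Rightarrow> (real \<Rightarrow> complex)) \<Rightarrow> bool" where
  "linear_operator V W T \<longleftrightarrow> L2_subspace V \<and> L2_subspace W \<and> (\<forall>f\<in>V. T f \<in> W) \<and>
     (\<forall>f\<in>V. \<forall>g\<in>V. ae_eq f g \<longrightarrow> ae_eq (T f) (T g)) \<and>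
     (\<forall>f\<in>V. \<forall>g\<in>V. ae_eq (T (\<lambda>x. f x + g x)) (\<lambda>x. T f x + T g x)) \<and>
     (\<forall>f\<in>V. \<forall>c. ae_eq (T (\<lambda>x. c * f x)) (\<lambda>x. c * T f x))"

definition bounded_operator ::
  "(real \<Rightarrow> complex) set \<Rightarrow> ((real \<Rightarrow> complex) \<Rightarrow> (real \<Rightarrow> complex) \<Rightarrow> complex) \<Rightarrow>
   (real \<Rightarrow> complex) set \<Rightarrow> ((real \<Rightarrow> complex) \<Rightarrow> (real \<Rightarrow> complex) \<Rightarrow> complex) \<Rightarrow>
   ((real \<Rightarrow> complex) \<Rightarrow> (real \<Rightarrow> complex)) \<Rightarrow> bool" where
  "bounded_operator V ipV W ipW T \<longleftrightarrow> linear_operator V W T \<and>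
     (\<exists>C. \<forall>f\<in>V. ip_norm ipW (T f) \<le> C * ip_norm ipV f)"

definition onto_operator ::
  "(real \<Rightarrow> complex) set \<Rightarrow> (real \<Rightarrow> complex) set \<Rightarrow>
   ((real \<Rightarrow> complex) \<Rightarrow> (real \<Rightarrow> complex)) \<Rightarrow> bool" where
  "onto_operator V W T \<longleftrightarrow> (\<forall>h\<in>W. \<exists>f\<in>V. ae_eq (T f) h)"

definition invertible_operator ::
  "(real \<Rightarrow> complex) set \<Rightarrow> ((real \<Rightarrow> complex) \<Rightarrow> (real \<Rightarrow> complex) \<Rightarrow> complex) \<Rightarrow>
   (real \<Rightarrow> complex) set \<Rightarrow> ((real \<Rightarrow> complex) \<Rightarrow> (real \<Rightarrow> complex) \<Rightarrow> complex) \<Rightarrow>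
   ((real \<Rightarrow> complex) \<Rightarrow> (real \<Rightarrow> complex)) \<Rightarrow> bool" where
  "invertible_operator V ipV W ipW T \<longleftrightarrow>
     (\<exists>S. bounded_operator W ipW V ipV S \<and>
        (\<forall>f\<in>V. ae_eq (S (T f)) f) \<and> (\<forall>h\<in>W. ae_eq (T (S h)) h))"


section \<open>Distributions and Sobolev spaces\<close>

definition fun_deriv :: "(real \<Rightarrow> complex) \<Rightarrow> real \<Rightarrow> complex" where
  "fun_deriv \<phi> x = vector_derivative \<phi> (at x)"

definition test_function :: "(real \<Rightarrow> complex) \<Rightarrow> bool" where
  "test_function \<phi> \<longleftrightarrow>
     (\<forall>n x. (fun_deriv ^^ n) \<phi> differentiable at x) \<and> compact (closure {x. \<phi> x \<noteq> 0})"

text \<open>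
  Distributions are functionals on the test functions, values on other functions being
  irrelevant. Their continuity plays no role for what is defined here.
\<close>

type_synonym distribution = "(real \<Rightarrow> complex) \<Rightarrow> complex"

definition regular_distribution :: "(real \<Rightarrow> complex) \<Rightarrow> distribution" where
  "regular_distribution f \<phi> = (LINT x|lborel. f x * \<phi> x)"

definition distr_deriv :: "distribution \<Rightarrow> distribution" where
  "distr_deriv T \<phi> = - T (fun_deriv \<phi>)"

definition is_L2_function :: "distribution \<Rightarrow> (real \<Rightarrow> complex) \<Rightarrow> bool" where
  "is_L2_function T h \<longleftrightarrow> h \<in> L2 \<and> (\<forall>\<phi>. test_function \<phi> \<longrightarrow> T \<phi> = regular_distribution h \<phi>)"

definition sobolev :: "nat \<Rightarrow> (real \<Rightarrow> complex) set" where
  "sobolev k = {f \<in> L2. \<exists>h. is_L2_function ((distr_deriv ^^ k) (regular_distribution f)) h}"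

definition quadratic_distr_op :: "real \<Rightarrow> real \<Rightarrow> distribution \<Rightarrow> distribution" where
  "quadratic_distr_op \<alpha> \<beta> T \<phi> =
     distr_deriv (distr_deriv T) \<phi> - \<i> * of_real (\<alpha> + \<beta>) * distr_deriv T \<phi> - of_real (\<alpha> * \<beta>) * T \<phi>"

text \<open>
  The distribution \<open>(D\<^sup>2 - i(\<alpha> + \<beta>)D - \<alpha>\<beta>I)\<^sup>s f\<close> as an \<open>L\<^sup>2\<close> function, which is determined up to
  \<^term>\<open>ae_eq\<close> provided there is one.
\<close>

definition diff_op_distr :: "real \<Rightarrow> real \<Rightarrow> nat \<Rightarrow> (real \<Rightarrow> complex) \<Rightarrow> distribution" where
  "diff_op_distr \<alpha> \<beta> s f = (quadratic_distr_op \<alpha> \<beta> ^^ s) (regular_distribution f)"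

definition diff_op :: "real \<Rightarrow> real \<Rightarrow> nat \<Rightarrow> (real \<Rightarrow> complex) \<Rightarrow> (real \<Rightarrow> complex)" where
  "diff_op \<alpha> \<beta> s f = (SOME h. is_L2_function (diff_op_distr \<alpha> \<beta> s f) h)"

end

theory Submission
  imports Defs "HOL-Probability.Probability"
begin

text \<open>
  On the Fourier side the difference of order \<open>2s\<close> with step \<open>u\<close> is multiplication by the \<open>s\<close>-th power of
  \<open>4 sin (u (x - \<alpha>) / 2) sin (u (x - \<beta>) / 2)\<close>, which is at most \<open>u\<^sup>2 \<bar>x - \<alpha>\<bar> \<bar>x - \<beta>\<bar>\<close> in absolute value;
  hence differences have finite weighted norm. Conversely, \<open>f\<close> is a sum of differences with steps
  \<open>u\<^sub>1, \<dots>, u\<^sub>m\<close> as soon as \<open>\<bar>fourier f\<bar>\<^sup>2\<close> is integrable against the inverse of the sum of the squared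
  symbols. That inverse is at most the product of the \<open>m\<close>-th roots of the inverses of the summands, so by
  Tonelli its integral over a box of steps factorises; each factor is an integral of
  \<open>\<bar>sin (u a) sin (u b)\<bar>\<close> to the power \<open>- 2s / m\<close>, which for \<open>m = 4s + 1\<close> converges by comparison with
  exponents \<open>4s / m < 1\<close>. The statements on the inner product and on the operator then reduce to facts
  on multiplication operators between weighted \<open>L\<^sup>2\<close> spaces. Plancherel's theorem is obtained from the
  multiplication formula, with Gaussian weights as convergence factors.
\<close>

section \<open>Square integrable functions\<close>

text \<open>One step is not enough: the symbol for a fixed u vanishes at infinitely many x besides
  \<alpha> and \<beta>, where \<open>fourier f\<close> need not be small. Generic further steps
  remove these spurious zeros. The number \<open>4 * s + 1\<close> is dictated by u = 0. There both
  sines vanish, so the squared symbol has a zero of order 4s in u for every x other than \<alpha>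
  and \<beta>, and the m-th root of its inverse is locally integrable in u only if m > 4s.
  Separating the two sines by XY \<le> X^2 + Y^2 raises the exponent of each from 2s/m to 4s/m,
  hence does not worsen this threshold. The real obstacle is uniformity in x: the m-th power of the
  integral over u must be O(1 + 1/weight), near \<alpha> and \<beta> as well as at infinity. This is
  why each sine is normalised by its frequency before the separation, and why it matters that the
  two frequencies differ by a constant. As \<open>fourier\<close> is obtained by choice, identities
  on the Fourier side hold almost everywhere only; statements on functions are recovered through
  \<open>fourier_inject\<close> and \<open>fourier_surj\<close>.\<close>

lemma ae_eq_refl [simp]: "ae_eq f f"
  by (simp add: ae_eq_def)

lemma ae_eq_sym: "ae_eq f g \<Longrightarrow> ae_eq g f"
  by (auto simp: ae_eq_def elim!: eventually_mono)

lemma ae_eq_trans: 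
  assumes "ae_eq f g" "ae_eq g h"
  shows "ae_eq f h"
  using assms unfolding ae_eq_def by eventually_elim auto

text \<open>Valued in \<open>ennreal\<close> so that an estimate can be written before square
  integrability is known; finiteness then yields membership in \<open>L2\<close>.\<close>

definition l2sq :: "(real \<Rightarrow> complex) \<Rightarrow> ennreal" where
  "l2sq f = (\<integral>\<^sup>+ x. ennreal ((norm (f x))\<^sup>2) \<partial>lborel)"

lemma L2_iff: "f \<in> L2 \<longleftrightarrow> f \<in> borel_measurable lborel \<and> l2sq f < \<infinity>"
  by (auto simp: L2_def l2sq_def integrable_iff_bounded)

lemma L2_measurable [measurable_dest]: "f \<in> L2 \<Longrightarrow> f \<in> borel_measurable lborel"
  by (simp add: L2_def)

lemma L2_borel [measurable_dest]: "f \<in> L2 \<Longrightarrow> f \<in> borel_measurable borel"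
  by (simp add: L2_def)

lemma L2_integrable_square: "f \<in> L2 \<Longrightarrow> integrable lborel (\<lambda>x. (norm (f x))\<^sup>2)"
  by (simp add: L2_def)

lemma l2sq_eq_integral:
  assumes "f \<in> L2"
  shows "l2sq f = ennreal (LINT x|lborel. (norm (f x))\<^sup>2)"
  unfolding l2sq_def by (intro nn_integral_eq_integral L2_integrable_square assms) auto

lemma L2_tendsto_iff: "L2_tendsto h f \<longleftrightarrow> (\<lambda>n. l2sq (\<lambda>x. h n x - f x)) \<longlonglongrightarrow> 0"
  by (simp add: L2_tendsto_def l2sq_def)

lemma norm_add_square_le: "(norm (a + b))\<^sup>2 \<le> 2 * (norm a)\<^sup>2 + 2 * (norm (b::'a::real_normed_vector))\<^sup>2"
proof -
  have "(norm (a + b))\<^sup>2 \<le> (norm a + norm b)\<^sup>2"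
    by (intro power_mono norm_triangle_ineq) auto
  also have "\<dots> \<le> 2 * (norm a)\<^sup>2 + 2 * (norm b)\<^sup>2"
    using zero_le_power2[of "norm a - norm b"] by (simp add: power2_eq_square algebra_simps)
  finally show ?thesis .
qed

text \<open>The factor 2 stands in for the triangle inequality of the norm: working with squares
  avoids roots in \<open>ennreal\<close>, and constants are harmless for convergence.\<close>

lemma l2sq_add_le:
  assumes [measurable]: "f \<in> borel_measurable borel" "g \<in> borel_measurable borel"
  shows "l2sq (\<lambda>x. f x + g x) \<le> 2 * l2sq f + 2 * l2sq g"
proof -
  have "l2sq (\<lambda>x. f x + g x) \<le> (\<integral>\<^sup>+ x. 2 * ennreal ((norm (f x))\<^sup>2) + 2 * ennreal ((norm (g x))\<^sup>2) \<partial>lborel)"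
    unfolding l2sq_def
  proof (intro nn_integral_mono)
    fix x
    have "ennreal ((norm (f x + g x))\<^sup>2) \<le> ennreal (2 * (norm (f x))\<^sup>2 + 2 * (norm (g x))\<^sup>2)"
      by (intro ennreal_leI norm_add_square_le)
    also have "\<dots> = 2 * ennreal ((norm (f x))\<^sup>2) + 2 * ennreal ((norm (g x))\<^sup>2)"
      by (simp add: ennreal_plus ennreal_mult')
    finally show "ennreal ((norm (f x + g x))\<^sup>2) \<le> 2 * ennreal ((norm (f x))\<^sup>2) + 2 * ennreal ((norm (g x))\<^sup>2)" .
  qed
  also have "\<dots> = 2 * l2sq f + 2 * l2sq g"
    unfolding l2sq_def by (simp add: nn_integral_add nn_integral_cmult)
  finally show ?thesis .
qed

lemma l2sq_cmult: 
  assumes [measurable]: "f \<in> borel_measurable borel"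
  shows "l2sq (\<lambda>x. c * f x) = ennreal ((norm c)\<^sup>2) * l2sq f"
  unfolding l2sq_def by (simp add: norm_mult power_mult_distrib ennreal_mult' nn_integral_cmult)

lemma l2sq_minus_commute: "l2sq (\<lambda>x. f x - g x) = l2sq (\<lambda>x. g x - f x)"
  by (simp add: l2sq_def norm_minus_commute)

lemma l2sq_mono_AE: "AE x in lborel. norm (f x) \<le> norm (g x) \<Longrightarrow> l2sq f \<le> l2sq g"
  unfolding l2sq_def by (intro nn_integral_mono_AE) (auto intro!: ennreal_leI power_mono elim!: eventually_mono)

lemma l2sq_cong_AE: "AE x in lborel. norm (f x) = norm (g x) \<Longrightarrow> l2sq f = l2sq g"
  unfolding l2sq_def by (intro nn_integral_cong_AE) (auto elim!: eventually_mono)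

lemma l2sq_triangle:
  assumes [measurable]: "f \<in> borel_measurable borel" "g \<in> borel_measurable borel" "h \<in> borel_measurable borel"
  shows "l2sq (\<lambda>x. f x - h x) \<le> 2 * l2sq (\<lambda>x. f x - g x) + 2 * l2sq (\<lambda>x. g x - h x)"
  using l2sq_add_le[of "\<lambda>x. f x - g x" "\<lambda>x. g x - h x"] by simp

lemma l2sq_eq_0_iff:
  assumes [measurable]: "f \<in> borel_measurable borel"
  shows "l2sq f = 0 \<longleftrightarrow> ae_eq f (\<lambda>x. 0)"
  unfolding l2sq_def ae_eq_def by (subst nn_integral_0_iff_AE) auto

lemma L2_zero [simp]: "(\<lambda>x. 0) \<in> L2"
  by (simp add: L2_def)

lemma L2_add [intro]:
  assumes "f \<in> L2" "g \<in> L2" shows "(\<lambda>x. f x + g x) \<in> L2"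
proof -
  have [measurable]: "f \<in> borel_measurable borel" "g \<in> borel_measurable borel"
    using assms by (auto dest: L2_borel)
  have "l2sq (\<lambda>x. f x + g x) \<le> 2 * l2sq f + 2 * l2sq g"
    by (intro l2sq_add_le) auto
  also have "\<dots> < \<infinity>"
    using assms by (auto simp: L2_iff ennreal_mult_less_top)
  finally show ?thesis by (simp add: L2_iff)
qed

lemma L2_cmult [intro]:
  assumes "f \<in> L2" shows "(\<lambda>x. c * f x) \<in> L2"
proof -
  have [measurable]: "f \<in> borel_measurable borel"
    using assms by (auto dest: L2_borel)
  show ?thesis
    using assms by (auto simp: L2_iff l2sq_cmult ennreal_mult_less_top)
qed

lemma L2_diff [intro]: "f \<in> L2 \<Longrightarrow> g \<in> L2 \<Longrightarrow> (\<lambda>x. f x - g x) \<in> L2"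
  using L2_add[of f "\<lambda>x. (-1) * g x"] L2_cmult[of g "-1"] by simp

lemma L2_sum [intro]: "(\<And>i. i \<in> I \<Longrightarrow> f i \<in> L2) \<Longrightarrow> (\<lambda>x. \<Sum>i\<in>I. f i x) \<in> L2"
  by (induction I rule: infinite_finite_induct) auto

lemma L2_bound:
  assumes "g \<in> L2" "f \<in> borel_measurable borel" "AE x in lborel. norm (f x) \<le> norm (g x)"
  shows "f \<in> L2"
  using assms l2sq_mono_AE[OF assms(3)] by (auto simp: L2_iff)

lemma L2_cong_AE:
  assumes "g \<in> L2" "f \<in> borel_measurable borel" "ae_eq f g"
  shows "f \<in> L2"
  using assms by (intro L2_bound[OF assms(1,2)]) (auto simp: ae_eq_def elim!: eventually_mono)

lemma borel_measurable_cnj [measurable (raw)]: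
  "f \<in> borel_measurable M \<Longrightarrow> (\<lambda>x. cnj (f x)) \<in> borel_measurable M"
  by (rule measurable_compose[of f M borel cnj borel])
     (auto intro!: borel_measurable_continuous_onI continuous_intros)

lemma L2_cnj [intro]: "f \<in> L2 \<Longrightarrow> (\<lambda>x. cnj (f x)) \<in> L2"
  by (simp add: L2_def borel_measurable_cnj)

lemma l2sq_affine:
  assumes [measurable]: "f \<in> borel_measurable borel" and "c \<noteq> 0"
  shows "l2sq f = ennreal \<bar>c\<bar> * l2sq (\<lambda>x. f (t + c * x))"
  unfolding l2sq_def by (subst nn_integral_real_affine[OF _ \<open>c \<noteq> 0\<close>, of _ t]) auto

lemma L2_affine:
  assumes "f \<in> L2" "c \<noteq> 0"
  shows "(\<lambda>x. f (t + c * x)) \<in> L2"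
proof -
  have [measurable]: "f \<in> borel_measurable borel"
    using assms by (auto dest: L2_borel)
  show ?thesis
    using assms l2sq_affine[of f c t] by (auto simp: L2_iff ennreal_mult_eq_top_iff less_top[symmetric])
qed

lemma L2_shift [intro]: "f \<in> L2 \<Longrightarrow> (\<lambda>x. f (x - a)) \<in> L2"
  using L2_affine[of f 1 "-a"] by simp

lemma L2_uminus [intro]: "f \<in> L2 \<Longrightarrow> (\<lambda>x. f (- x)) \<in> L2"
  using L2_affine[of f "-1" 0] by simp

lemma L2_mult_integrable [intro]:
  assumes "f \<in> L2" "g \<in> L2"
  shows "integrable lborel (\<lambda>x. f x * g x)"
proof (rule Bochner_Integration.integrable_bound)
  show "integrable lborel (\<lambda>x. (norm (f x))\<^sup>2 + (norm (g x))\<^sup>2)"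
    using assms by (intro Bochner_Integration.integrable_add L2_integrable_square)
  show "(\<lambda>x. f x * g x) \<in> borel_measurable lborel"
    using assms by (auto intro!: borel_measurable_times dest: L2_measurable)
  show "AE x in lborel. norm (f x * g x) \<le> norm ((norm (f x))\<^sup>2 + (norm (g x))\<^sup>2)"
  proof (rule AE_I2)
    fix x
    have "0 \<le> (norm (f x) - norm (g x))\<^sup>2" "0 \<le> norm (f x) * norm (g x)" by simp_all
    then have "norm (f x) * norm (g x) \<le> (norm (f x))\<^sup>2 + (norm (g x))\<^sup>2"
      unfolding power2_diff mult.assoc by linarith
    then show "norm (f x * g x) \<le> norm ((norm (f x))\<^sup>2 + (norm (g x))\<^sup>2)"
      by (simp add: norm_mult)
  qed
qed

lemma L2_Cauchy_Schwarz:
  assumes "f \<in> L2" "g \<in> L2"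
  shows "(norm (LINT x|lborel. f x * g x))\<^sup>2 \<le>
    (LINT x|lborel. (norm (f x))\<^sup>2) * (LINT x|lborel. (norm (g x))\<^sup>2)"
proof -
  let ?A = "LINT x|lborel. (norm (f x))\<^sup>2" and ?B = "LINT x|lborel. (norm (g x))\<^sup>2"
  let ?I = "LINT x|lborel. norm (f x) * norm (g x)"
  have int: "integrable lborel (\<lambda>x. norm (f x) * norm (g x))"
    using integrable_norm[OF L2_mult_integrable[OF assms]] by (simp add: norm_mult)
  note sq = L2_integrable_square[OF assms(1)] L2_integrable_square[OF assms(2)]
  \<comment> \<open>With these coefficients the expansion collapses to
    \<open>?B * (?A * ?B - ?I\<^sup>2)\<close>, so that only \<open>?B = 0\<close> has to be treated
    apart.\<close>
  have "0 \<le> (LINT x|lborel. (?B * norm (f x) - ?I * norm (g x))\<^sup>2)"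
    by simp
  also have "\<dots> = (LINT x|lborel. ?B\<^sup>2 * (norm (f x))\<^sup>2 - 2 * ?B * ?I * (norm (f x) * norm (g x)) + ?I\<^sup>2 * (norm (g x))\<^sup>2)"
    by (simp add: power2_diff power_mult_distrib algebra_simps)
  also have "\<dots> = ?B\<^sup>2 * ?A - 2 * ?B * ?I * ?I + ?I\<^sup>2 * ?B"
    using int sq by (simp add: Bochner_Integration.integral_add Bochner_Integration.integral_diff)
  also have "\<dots> = ?B * (?A * ?B - ?I\<^sup>2)"
    by (simp add: power2_eq_square algebra_simps)
  finally have *: "0 \<le> ?B * (?A * ?B - ?I\<^sup>2)" .
  have "?I\<^sup>2 \<le> ?A * ?B"
  proof (cases "?B = 0")
    case True
    have "AE x in lborel. (norm (g x))\<^sup>2 = 0"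
      using True sq(2) by (subst (asm) integral_nonneg_eq_0_iff_AE) auto
    then have "AE x in lborel. norm (f x) * norm (g x) = 0"
      by (rule eventually_mono) simp
    then have "?I = 0"
      by (rule integral_eq_zero_AE)
    then show ?thesis using True by simp
  next
    case False
    then have "?B > 0" by (simp add: less_le integral_nonneg)
    with * show ?thesis by (simp add: zero_le_mult_iff)
  qed
  moreover have "norm (LINT x|lborel. f x * g x) \<le> ?I"
    using integral_norm_bound[of lborel "\<lambda>x. f x * g x"] by (simp add: norm_mult)
  then have "(norm (LINT x|lborel. f x * g x))\<^sup>2 \<le> ?I\<^sup>2"
    by (intro power_mono) auto
  ultimately show ?thesis by linarith
qed

lemma L2_tendsto_unique:
  assumes "L2_tendsto h f" "L2_tendsto h g"
    and [measurable]: "\<And>n. h n \<in> borel_measurable borel" "f \<in> borel_measurable borel" "g \<in> borel_measurable borel"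
  shows "ae_eq f g"
proof -
  have "(\<lambda>n. 2 * l2sq (\<lambda>x. h n x - f x) + 2 * l2sq (\<lambda>x. h n x - g x)) \<longlonglongrightarrow> 2 * 0 + 2 * 0"
    using assms(1,2) by (intro tendsto_intros ennreal_tendsto_cmult) (auto simp: L2_tendsto_iff)
  moreover have "l2sq (\<lambda>x. f x - g x) \<le> 2 * l2sq (\<lambda>x. h n x - f x) + 2 * l2sq (\<lambda>x. h n x - g x)" for n
    using l2sq_triangle[of f "h n" g] by (simp add: l2sq_minus_commute)
  ultimately have "l2sq (\<lambda>x. f x - g x) \<le> 0"
    by (intro Lim_bounded2) auto
  then have "ae_eq (\<lambda>x. f x - g x) (\<lambda>x. 0)"
    by (subst l2sq_eq_0_iff[symmetric]) auto
  then show ?thesis by (simp add: ae_eq_def)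
qed

lemma L2_tendsto_integral:
  assumes "L2_tendsto h f" "\<And>n. h n \<in> L2" "f \<in> L2" "g \<in> L2"
  shows "(\<lambda>n. LINT x|lborel. h n x * g x) \<longlonglongrightarrow> (LINT x|lborel. f x * g x)"
proof -
  let ?d = "\<lambda>n. LINT x|lborel. (norm (h n x - f x))\<^sup>2"
  let ?B = "LINT x|lborel. (norm (g x))\<^sup>2"
  have "(\<lambda>n. ennreal (?d n)) \<longlonglongrightarrow> ennreal 0"
    using assms(1) l2sq_eq_integral[OF L2_diff[OF assms(2,3)]] by (simp add: L2_tendsto_iff)
  then have "?d \<longlonglongrightarrow> 0"
    by (subst (asm) tendsto_ennreal_iff) (auto intro!: always_eventually integral_nonneg)
  then have "(\<lambda>n. sqrt (?d n * ?B)) \<longlonglongrightarrow> sqrt (0 * ?B)"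
    by (intro tendsto_intros)
  then have lim: "(\<lambda>n. sqrt (?d n * ?B)) \<longlonglongrightarrow> 0"
    by simp
  have bound: "norm ((LINT x|lborel. h n x * g x) - (LINT x|lborel. f x * g x)) \<le> sqrt (?d n * ?B)" for n
  proof -
    have "(LINT x|lborel. h n x * g x) - (LINT x|lborel. f x * g x) = (LINT x|lborel. (h n x - f x) * g x)"
      using assms by (subst Bochner_Integration.integral_diff[symmetric]) (auto simp: algebra_simps)
    then show ?thesis
      using L2_Cauchy_Schwarz[OF L2_diff[OF assms(2,3)] assms(4), of n]
      by (auto intro!: real_le_rsqrt)
  qed
  show ?thesis
    by (rule LIM_zero_cancel, rule Lim_null_comparison[OF always_eventually lim]) (use bound in blast)
qed

text \<open>Riesz-Fischer. A subsequence with squared gaps below \<open>(1/4) ^ k\<close> converges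
  almost everywhere, and Fatou's lemma along it bounds the distance of every late \<open>h n\<close>
  from the pointwise limit.\<close>

lemma L2_complete:
  assumes h: "\<And>n. h n \<in> L2"
    and cauchy: "\<And>e. e > 0 \<Longrightarrow> \<exists>N. \<forall>m\<ge>N. \<forall>n\<ge>N. l2sq (\<lambda>x. h m x - h n x) < ennreal e"
  shows "\<exists>f\<in>L2. L2_tendsto h f"
proof -
  have [measurable]: "h n \<in> borel_measurable borel" for n
    using h by (auto dest: L2_borel)
  have "\<forall>k. \<exists>N. \<forall>m\<ge>N. \<forall>n\<ge>N. l2sq (\<lambda>x. h m x - h n x) < ennreal ((1/4)^k)"
    by (intro allI cauchy) auto
  then obtain N where N: "\<And>k m n. m \<ge> N k \<Longrightarrow> n \<ge> N k \<Longrightarrow> l2sq (\<lambda>x. h m x - h n x) < ennreal ((1/4)^k)"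
    by metis
  \<comment> \<open>Partial sums dominate \<open>N k\<close> both at index \<open>k\<close> and at
    index \<open>Suc k\<close>, so consecutive terms of the subsequence are controlled without
    monotonicity of \<open>N\<close>.\<close>
  define r where "r k = k + (\<Sum>i\<le>k. N i)" for k
  have rN: "N k \<le> r k" for k
    unfolding r_def by (intro trans_le_add2 member_le_sum) auto
  have rS: "N k \<le> r (Suc k)" for k
    using rN[of k] unfolding r_def by simp
  have rk: "k \<le> r k" for k
    by (simp add: r_def)
  \<comment> \<open>The squares of the gaps are summed with weights \<open>2 ^ k\<close>: the series
    still converges, and the weights pay for the later passage from squares to first powers.\<close>
  define d where "d k = (\<lambda>x. h (r (Suc k)) x - h (r k) x)" for k
  have [measurable]: "d k \<in> borel_measurable borel" for k
    unfolding d_def by measurable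
  have "(\<integral>\<^sup>+ x. (\<Sum>k. ennreal (2 ^ k * (norm (d k x))\<^sup>2)) \<partial>lborel) = (\<Sum>k. \<integral>\<^sup>+ x. ennreal (2 ^ k * (norm (d k x))\<^sup>2) \<partial>lborel)"
    by (intro nn_integral_suminf) auto
  also have "\<dots> = (\<Sum>k. 2 ^ k * l2sq (d k))"
    by (simp add: ennreal_mult' nn_integral_cmult l2sq_def flip: ennreal_power)
  also have "\<dots> \<le> (\<Sum>k. ennreal ((1/2)^k))"
  proof (intro suminf_le)
    fix k
    have "2 ^ k * l2sq (d k) \<le> 2 ^ k * ennreal ((1/4)^k)"
      using N[OF rS[of k] rN[of k]] by (intro mult_left_mono) (auto simp: d_def)
    also have "\<dots> = ennreal (2 ^ k * (1/4)^k)"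
      by (simp add: ennreal_mult' flip: ennreal_power)
    also have "(2::real) ^ k * (1/4)^k = (1/2)^k"
      by (simp flip: power_mult_distrib)
    finally show "2 ^ k * l2sq (d k) \<le> ennreal ((1/2)^k)" .
  qed auto
  also have "\<dots> < \<infinity>"
    using summable_geometric[of "1/2::real"] by (subst suminf_ennreal2) auto
  finally have "AE x in lborel. (\<Sum>k. ennreal (2 ^ k * (norm (d k x))\<^sup>2)) \<noteq> \<infinity>"
    by (intro nn_integral_noteq_infinite) auto
  then have conv: "AE x in lborel. convergent (\<lambda>k. h (r k) x)"
  proof eventually_elim
    fix x assume "(\<Sum>k. ennreal (2 ^ k * (norm (d k x))\<^sup>2)) \<noteq> \<infinity>"
    then have s: "summable (\<lambda>k. 2 ^ k * (norm (d k x))\<^sup>2)"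
      by (intro summable_suminf_not_top) auto
    have "summable (\<lambda>k. norm (d k x))"
    proof (rule summable_comparison_test')
      show "summable (\<lambda>k. 2 ^ k * (norm (d k x))\<^sup>2 + (1/2) ^ k)"
        using s by (intro summable_add summable_geometric) auto
      fix k :: nat
      let ?a = "norm (d k x)" and ?p = "2 ^ k :: real"
      have p: "?p > 0" by simp
      \<comment> \<open>Arithmetic-geometric mean: \<open>?a\<close> is bounded by
        \<open>?p * ?a\<^sup>2 + 1 / ?p\<close>, and both terms are summable over
        \<open>k\<close>.\<close>
      have "0 \<le> (?p * ?a - 1)\<^sup>2" by simp
      then have "2 * (?p * ?a) \<le> ?p * (?p * ?a\<^sup>2 + 1 / ?p)"
        by (simp add: power2_eq_square algebra_simps)
      then have "2 * ?a \<le> ?p * ?a\<^sup>2 + 1 / ?p"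
        using p by (metis mult.left_commute mult_le_cancel_left_pos)
      then have "?a \<le> ?p * ?a\<^sup>2 + 1 / ?p"
        using norm_ge_zero[of "d k x"] by linarith
      then show "norm (norm (d k x)) \<le> 2 ^ k * (norm (d k x))\<^sup>2 + (1/2) ^ k"
        by (simp add: power_one_over)
    qed
    then have "summable (\<lambda>k. d k x)" by (rule summable_norm_cancel)
    then have "convergent (\<lambda>n. \<Sum>k<n. d k x)" by (simp add: summable_iff_convergent)
    then have "convergent (\<lambda>n. (\<Sum>k<n. d k x) + h (r 0) x)" by (intro convergent_add convergent_const)
    also have "(\<lambda>n. (\<Sum>k<n. d k x) + h (r 0) x) = (\<lambda>k. h (r k) x)"
      unfolding d_def by (subst sum_lessThan_telescope) simp
    finally show "convergent (\<lambda>k. h (r k) x)" .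
  qed
  define f where "f x = lim (\<lambda>k. h (r k) x)" for x
  have [measurable]: "f \<in> borel_measurable borel"
    unfolding f_def by measurable
  have lim: "AE x in lborel. (\<lambda>k. h (r k) x) \<longlonglongrightarrow> f x"
    using conv by (auto simp: f_def convergent_LIMSEQ_iff elim!: eventually_mono)
  have bound: "\<exists>N. \<forall>n\<ge>N. l2sq (\<lambda>x. h n x - f x) \<le> ennreal e" if e: "e > 0" for e :: real
  proof -
    obtain N where N: "\<And>m n. m \<ge> N \<Longrightarrow> n \<ge> N \<Longrightarrow> l2sq (\<lambda>x. h m x - h n x) < ennreal e"
      using cauchy[OF e] by blast
    have "l2sq (\<lambda>x. h n x - f x) \<le> ennreal e" if n: "n \<ge> N" for n
    proof -
      have "l2sq (\<lambda>x. h n x - f x) = (\<integral>\<^sup>+ x. liminf (\<lambda>k. ennreal ((norm (h n x - h (r k) x))\<^sup>2)) \<partial>lborel)"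
        unfolding l2sq_def
      proof (intro nn_integral_cong_AE, use lim in eventually_elim)
        fix x assume "(\<lambda>k. h (r k) x) \<longlonglongrightarrow> f x"
        then have "(\<lambda>k. ennreal ((norm (h n x - h (r k) x))\<^sup>2)) \<longlonglongrightarrow> ennreal ((norm (h n x - f x))\<^sup>2)"
          by (intro tendsto_intros)
        then show "ennreal ((norm (h n x - f x))\<^sup>2) = liminf (\<lambda>k. ennreal ((norm (h n x - h (r k) x))\<^sup>2))"
          by (intro lim_imp_Liminf[symmetric]) auto
      qed
      also have "\<dots> \<le> liminf (\<lambda>k. l2sq (\<lambda>x. h n x - h (r k) x))"
        unfolding l2sq_def by (intro nn_integral_liminf) auto
      also have "\<dots> \<le> liminf (\<lambda>k. ennreal e)"
      proof (intro Liminf_mono eventually_sequentiallyI[of N])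
        fix k assume "N \<le> k"
        then show "l2sq (\<lambda>x. h n x - h (r k) x) \<le> ennreal e"
          using N[OF n, of "r k"] rk[of k] by auto
      qed
      also have "\<dots> = ennreal e" by (simp add: Liminf_const)
      finally show ?thesis .
    qed
    then show ?thesis by blast
  qed
  have "\<exists>n. l2sq (\<lambda>x. h n x - f x) \<le> ennreal 1"
    using bound[of 1] by auto
  then obtain n where "l2sq (\<lambda>x. h n x - f x) \<le> ennreal 1" by blast
  then have "(\<lambda>x. h n x - f x) \<in> L2"
    by (auto simp: L2_iff intro: le_less_trans)
  then have "(\<lambda>x. h n x - (h n x - f x)) \<in> L2"
    by (rule L2_diff[OF h])
  then have "f \<in> L2" by simp
  moreover have "L2_tendsto h f"
    unfolding L2_tendsto_iff
  proof (rule order_tendstoI)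
    fix a :: ennreal assume "0 < a"
    then obtain b where b: "0 < b" "b < a" using dense by blast
    then obtain e where e: "e > 0" "ennreal e < a"
      by (cases b) auto
    then obtain N where "\<forall>n\<ge>N. l2sq (\<lambda>x. h n x - f x) \<le> ennreal e" using bound by blast
    then show "\<forall>\<^sub>F n in sequentially. l2sq (\<lambda>x. h n x - f x) < a"
      using e by (intro eventually_sequentiallyI[of N]) (auto intro: le_less_trans)
  qed auto
  ultimately show ?thesis by blast
qed

section \<open>The Gaussian-regularised Fourier transform\<close>

lemma borel_measurable_cis [measurable (raw)]:
  "f \<in> borel_measurable M \<Longrightarrow> (\<lambda>x. cis (f x)) \<in> borel_measurable M"
  by (rule measurable_compose[of f M borel cis borel])
     (auto intro!: borel_measurable_continuous_onI continuous_intros)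

lemma borel_measurable_fourier_L1 [measurable]:
  assumes [measurable]: "f \<in> borel_measurable borel"
  shows "fourier_L1 f \<in> borel_measurable borel"
proof -
  have "(\<lambda>x. LINT u|lborel. cis (- (x * u)) * f u) \<in> borel_measurable borel"
    by (rule lborel.borel_measurable_lebesgue_integral) measurable
  then show ?thesis by (simp add: fourier_L1_def[abs_def])
qed

lemma integrable_cis_mult [intro]:
  fixes f :: "real \<Rightarrow> complex"
  assumes "integrable lborel f"
  shows "integrable lborel (\<lambda>u. cis (- (x * u)) * f u)"
proof (rule Bochner_Integration.integrable_bound[OF assms])
  have [measurable]: "f \<in> borel_measurable borel" using assms by auto
  show "(\<lambda>u. cis (- (x * u)) * f u) \<in> borel_measurable lborel" by measurable
qed (simp add: norm_mult)

lemma norm_fourier_L1_le: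
  assumes "integrable lborel f"
  shows "norm (fourier_L1 f x) \<le> (LINT u|lborel. norm (f u))"
  using integral_norm_bound[of lborel "\<lambda>u. cis (- (x * u)) * f u"]
  by (simp add: fourier_L1_def norm_mult)

lemma integrable_bounded_mult:
  fixes f :: "real \<Rightarrow> complex"
  assumes "integrable lborel f" and [measurable]: "k \<in> borel_measurable borel" and "\<And>x. norm (k x) \<le> C"
  shows "integrable lborel (\<lambda>x. k x * f x)"
proof (rule Bochner_Integration.integrable_bound)
  show "integrable lborel (\<lambda>x. C * norm (f x))" using assms(1) by auto
  have [measurable]: "f \<in> borel_measurable borel" using assms(1) by auto
  show "(\<lambda>x. k x * f x) \<in> borel_measurable lborel" by measurable
  show "AE x in lborel. norm (k x * f x) \<le> norm (C * norm (f x))"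
    using assms(3) order_trans[OF norm_ge_zero assms(3)]
    by (auto simp: norm_mult abs_mult intro!: mult_right_mono)
qed

lemma fourier_L1_mult_formula:
  assumes f: "integrable lborel f" and g: "integrable lborel g"
  shows "(LINT x|lborel. fourier_L1 f x * g x) = (LINT x|lborel. f x * fourier_L1 g x)"
proof -
  have [measurable]: "f \<in> borel_measurable borel" "g \<in> borel_measurable borel" using f g by auto
  let ?h = "\<lambda>x u. cis (- (x * u)) * f u * g x"
  have "integrable (lborel \<Otimes>\<^sub>M lborel) (case_prod ?h)"
  proof (rule lborel_pair.Fubini_integrable)
    have "integrable lborel (\<lambda>x. (LINT u|lborel. norm (f u)) * norm (g x))"
      using g by auto
    then show "integrable lborel (\<lambda>x. LINT u|lborel. norm (case_prod ?h (x, u)))"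
      by (simp add: norm_mult)
    show "AE x in lborel. integrable lborel (\<lambda>u. case_prod ?h (x, u))"
      using integrable_cis_mult[OF f] by auto
  qed measurable
  then have 1: "(LINT u|lborel. LINT x|lborel. ?h x u) = (LINT x|lborel. LINT u|lborel. ?h x u)"
    by (rule lborel_pair.Fubini_integral)
  have 2: "(LINT x|lborel. ?h x u) = f u * fourier_L1 g u" for u
  proof -
    have "(LINT x|lborel. ?h x u) = (LINT x|lborel. f u * (cis (- (u * x)) * g x))"
      by (simp add: mult_ac)
    then show ?thesis by (simp add: fourier_L1_def)
  qed
  have 3: "(LINT u|lborel. ?h x u) = fourier_L1 f x * g x" for x
    by (simp add: fourier_L1_def)
  show ?thesis using 1 unfolding 2 3 by simp
qed

section \<open>Gaussian weights and their transforms\<close>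

definition gauss_weight :: "real \<Rightarrow> real \<Rightarrow> complex" where
  "gauss_weight c x = of_real (exp (- (x / c)\<^sup>2 / 2))"

text \<open>The transform of \<open>gauss_weight c\<close>: an approximate identity of total mass
  \<open>2 * pi\<close> as \<open>c\<close> grows.\<close>

definition gauss_kernel :: "real \<Rightarrow> real \<Rightarrow> real" where
  "gauss_kernel c t = 2 * pi * c * std_normal_density (c * t)"

lemma gauss_weight_measurable [measurable]: "gauss_weight c \<in> borel_measurable borel"
  unfolding gauss_weight_def by measurable

lemma gauss_kernel_measurable [measurable]: "gauss_kernel c \<in> borel_measurable borel"
  unfolding gauss_kernel_def by measurable

lemma norm_gauss_weight_le: "norm (gauss_weight c x) \<le> 1"
  by (simp add: gauss_weight_def)

lemma gauss_kernel_nonneg: "c > 0 \<Longrightarrow> gauss_kernel c t \<ge> 0"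
  by (simp add: gauss_kernel_def)

lemma gauss_weight_std_normal:
  assumes "c > 0"
  shows "gauss_weight c x = of_real (sqrt (2 * pi)) * of_real (std_normal_density (0 + (1 / c) * x))"
proof -
  have "exp (- (x / c)\<^sup>2 / 2) = sqrt (2 * pi) * std_normal_density (0 + (1 / c) * x)"
    by (simp add: std_normal_density_def)
  then show ?thesis unfolding gauss_weight_def by (simp only: of_real_mult)
qed

lemma integrable_std_normal_affine:
  assumes "c \<noteq> 0"
  shows "integrable lborel (\<lambda>x. std_normal_density (t + c * x))"
  using lborel_integrable_real_affine[of std_normal_density c t] assms
  by (simp add: integrable_normal_density)

lemma integrable_gauss_weight: 
  assumes "c > 0"
  shows "integrable lborel (gauss_weight c)"
  using integrable_std_normal_affine[of "1 / c" 0] assms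
  by (subst gauss_weight_std_normal[OF assms, abs_def]) (auto intro!: integrable_mult_right integrable_of_real)

lemma integral_gauss_kernel:
  assumes "c > 0"
  shows "(\<integral>\<^sup>+ x. ennreal (gauss_kernel c (t + x)) \<partial>lborel) = ennreal (2 * pi)"
    "(\<integral>\<^sup>+ x. ennreal (gauss_kernel c (t - x)) \<partial>lborel) = ennreal (2 * pi)"
proof -
  have 1: "(\<integral>\<^sup>+ x. ennreal (std_normal_density x) \<partial>lborel) = 1"
    using nn_integral_eq_integral[OF integrable_normal_density[of 1 0]] 
    by simp
  have *: "(\<integral>\<^sup>+ x. ennreal (gauss_kernel c (t + e * x)) \<partial>lborel) = ennreal (2 * pi)" if "\<bar>e\<bar> = 1" for e
  proof -
    have "(\<integral>\<^sup>+ x. ennreal (gauss_kernel c (t + e * x)) \<partial>lborel) =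
      ennreal (2 * pi) * (ennreal \<bar>c * e\<bar> * (\<integral>\<^sup>+ x. ennreal (std_normal_density (c * t + (c * e) * x)) \<partial>lborel))"
      using assms that
      by (simp add: gauss_kernel_def ennreal_mult' nn_integral_cmult algebra_simps abs_mult)
    also have "(ennreal \<bar>c * e\<bar> * (\<integral>\<^sup>+ x. ennreal (std_normal_density (c * t + (c * e) * x)) \<partial>lborel)) = 1"
      using 1 assms that by (subst nn_integral_real_affine[of _ "c * e" "c * t", symmetric]) auto
    finally show ?thesis by simp
  qed
  show "(\<integral>\<^sup>+ x. ennreal (gauss_kernel c (t + x)) \<partial>lborel) = ennreal (2 * pi)"
    "(\<integral>\<^sup>+ x. ennreal (gauss_kernel c (t - x)) \<partial>lborel) = ennreal (2 * pi)"
    using *[of 1] *[of "-1"] by auto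
qed

text \<open>After rescaling, the value is read off the characteristic function of the standard
  normal distribution, taken at the negative argument because \<open>fourier_L1\<close> has the
  opposite sign in the exponent.\<close>

lemma fourier_L1_gauss_weight:
  assumes "c > 0"
  shows "fourier_L1 (gauss_weight c) t = of_real (gauss_kernel c t)"
proof -
  have base: "(LINT x|lborel. cis (- (s * x)) * of_real (std_normal_density x)) = of_real (exp (- (s\<^sup>2) / 2))" for s
  proof -
    have "char std_normal_distribution (- s) = (LINT x|lborel. std_normal_density x *\<^sub>R iexp (- s * x))"
      unfolding char_def by (subst integral_density) auto
    also have "\<dots> = (LINT x|lborel. cis (- (s * x)) * of_real (std_normal_density x))"
      by (intro Bochner_Integration.integral_cong) (auto simp: cis_conv_exp scaleR_conv_of_real mult_ac)
    finally show ?thesis by (simp add: char_std_normal_distribution)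
  qed
  have "fourier_L1 (gauss_weight c) t = of_real (sqrt (2 * pi)) *
      (LINT x|lborel. cis (- (t * x)) * of_real (std_normal_density (0 + (1 / c) * x)))"
    unfolding fourier_L1_def gauss_weight_std_normal[OF assms]
    by (subst integral_mult_right_zero[symmetric]) (simp only: mult.left_commute)
  also have "(LINT x|lborel. cis (- (t * x)) * of_real (std_normal_density (0 + (1 / c) * x)))
    = \<bar>c\<bar> *\<^sub>R (LINT x|lborel. cis (- (t * (0 + c * x))) * of_real (std_normal_density (0 + (1 / c) * (0 + c * x))))"
    using assms by (intro lborel_integral_real_affine) auto
  also have "\<dots> = of_real c * (LINT x|lborel. cis (- ((c * t) * x)) * of_real (std_normal_density x))"
    using assms by (simp add: scaleR_conv_of_real mult_ac)
  also have "\<dots> = of_real c * of_real (exp (- ((c * t)\<^sup>2) / 2))"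
    by (simp only: base)
  also have "of_real (sqrt (2 * pi)) * (of_real c * of_real (exp (- ((c * t)\<^sup>2) / 2))) = (of_real (gauss_kernel c t) :: complex)"
  proof -
    have "sqrt (2 * pi) * (c * exp (- ((c * t)\<^sup>2) / 2)) = gauss_kernel c t"
      unfolding gauss_kernel_def std_normal_density_def
      using real_sqrt_mult_self[of "2 * pi"] by (simp add: field_simps)
    then show ?thesis by (metis of_real_mult)
  qed
  finally show ?thesis .
qed

text \<open>The multiplication formula is used twice, for \<open>f\<close> against the weighted
  transform of \<open>g\<close> and for \<open>g\<close> against the modulated Gaussian. The weight
  is needed because \<open>fourier_L1 g\<close> alone is bounded but need not be integrable. The
  kernel sees \<open>u + t\<close>, not a difference, since nothing is conjugated.\<close>

lemma fourier_L1_gauss_formula: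
  assumes f: "integrable lborel f" and g: "integrable lborel g" and c: "c > 0"
  shows "(LINT x|lborel. fourier_L1 f x * fourier_L1 g x * gauss_weight c x) =
    (LINT u|lborel. f u * (LINT t|lborel. g t * of_real (gauss_kernel c (u + t))))"
proof -
  have [measurable]: "f \<in> borel_measurable borel" "g \<in> borel_measurable borel" using f g by auto
  let ?k = "\<lambda>x. fourier_L1 g x * gauss_weight c x"
  have k: "integrable lborel ?k"
    by (rule integrable_bounded_mult[OF integrable_gauss_weight[OF c] _ norm_fourier_L1_le[OF g]]) measurable
  have "fourier_L1 ?k u = (LINT t|lborel. g t * of_real (gauss_kernel c (u + t)))" for u
  proof -
    let ?m = "\<lambda>x. cis (- (u * x)) * gauss_weight c x"
    have m: "integrable lborel ?m"
      by (intro integrable_cis_mult integrable_gauss_weight c)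
    have m': "fourier_L1 ?m t = of_real (gauss_kernel c (u + t))" for t
    proof -
      have "fourier_L1 ?m t = fourier_L1 (gauss_weight c) (u + t)"
        unfolding fourier_L1_def mult.assoc[symmetric] cis_mult
        by (intro Bochner_Integration.integral_cong) (auto simp: algebra_simps)
      then show ?thesis using fourier_L1_gauss_weight[OF c] by simp
    qed
    have "fourier_L1 ?k u = (LINT x|lborel. fourier_L1 g x * ?m x)"
      by (simp add: fourier_L1_def[of ?k] mult_ac)
    also have "\<dots> = (LINT t|lborel. g t * fourier_L1 ?m t)"
      by (rule fourier_L1_mult_formula[OF g m])
    finally show ?thesis by (simp only: m')
  qed
  then have "(LINT u|lborel. f u * (LINT t|lborel. g t * of_real (gauss_kernel c (u + t)))) =
    (LINT u|lborel. f u * fourier_L1 ?k u)" by simp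
  also have "\<dots> = (LINT x|lborel. fourier_L1 f x * ?k x)"
    by (rule fourier_L1_mult_formula[OF f k, symmetric])
  finally show ?thesis by (simp add: mult.assoc)
qed

text \<open>Without integrability the Bochner integral has the default value 0, so the bound is
  unconditional.\<close>

lemma norm_integral_le_nn_integral:
  fixes f :: "'a \<Rightarrow> 'b::{banach, second_countable_topology}"
  shows "ennreal (norm (LINT x|M. f x)) \<le> (\<integral>\<^sup>+ x. ennreal (norm (f x)) \<partial>M)"
  by (cases "integrable M f") (auto intro: integral_norm_bound_ennreal simp: not_integrable_integral_eq)

lemma lborel_integral_uminus:
  fixes f :: "real \<Rightarrow> complex"
  shows "(LINT x|lborel. f (- x)) = (LINT x|lborel. f x)"
  using lborel_integral_real_affine[of "-1" f 0] by simp

lemma fourier_L1_cnj_uminus: "fourier_L1 (\<lambda>t. cnj (f (- t))) x = cnj (fourier_L1 f x)"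
proof -
  have "fourier_L1 (\<lambda>t. cnj (f (- t))) x = (LINT t|lborel. cnj (cis (- (x * (- t))) * f (- t)))"
    unfolding fourier_L1_def by (intro Bochner_Integration.integral_cong) (auto simp: cis_cnj)
  also have "\<dots> = (LINT t|lborel. cnj (cis (- (x * t)) * f t))"
    by (rule lborel_integral_uminus)
  also have "\<dots> = cnj (fourier_L1 f x)"
    unfolding fourier_L1_def by (rule Bochner_Integration.integral_cnj)
  finally show ?thesis .
qed

lemma gauss_weight_tendsto: "(\<lambda>n. gauss_weight (real (Suc n)) x) \<longlonglongrightarrow> 1"
proof -
  have "(\<lambda>n. exp (- (x * inverse (real (Suc n)))\<^sup>2 / 2)) \<longlonglongrightarrow> exp (- (x * 0)\<^sup>2 / 2)"
    by (intro tendsto_intros LIMSEQ_inverse_real_of_nat) auto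
  then have "(\<lambda>n. complex_of_real (exp (- (x * inverse (real (Suc n)))\<^sup>2 / 2))) \<longlonglongrightarrow> of_real 1"
    by (intro tendsto_of_real) simp
  then show ?thesis unfolding gauss_weight_def divide_inverse[of x] by simp
qed

text \<open>One half of Plancherel. Against the reflected conjugate of \<open>f\<close>, the product
  of transforms is the squared modulus of \<open>fourier_L1 f\<close>, and the Gaussian formula
  turns its weighted integral into a double integral of \<open>f\<close> against a kernel of mass
  \<open>2 * pi\<close>.\<close>

lemma l2sq_fourier_L1_le:
  assumes f: "integrable lborel f"
  shows "l2sq (fourier_L1 f) \<le> ennreal (2 * pi) * l2sq f"
proof -
  have [measurable]: "f \<in> borel_measurable borel" using f by auto
  let ?g = "\<lambda>t. cnj (f (- t))"
  have g: "integrable lborel ?g"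
    using lborel_integrable_real_affine[OF f, of "-1" 0] by simp
  have bound: "(\<integral>\<^sup>+ x. ennreal ((norm (fourier_L1 f x))\<^sup>2 * norm (gauss_weight c x)) \<partial>lborel) \<le> ennreal (2 * pi) * l2sq f"
    if c: "c > 0" for c
  proof -
    have int: "integrable lborel (\<lambda>x. fourier_L1 f x * fourier_L1 ?g x * gauss_weight c x)"
      by (rule integrable_bounded_mult[OF integrable_gauss_weight[OF c], where C="(LINT u|lborel. norm (f u)) * (LINT u|lborel. norm (?g u))"])
        (auto simp: norm_mult intro!: mult_mono norm_fourier_L1_le f integral_nonneg norm_fourier_L1_le[OF g, simplified])
    have eq: "fourier_L1 f x * fourier_L1 ?g x * gauss_weight c x = of_real ((norm (fourier_L1 f x))\<^sup>2 * norm (gauss_weight c x))" for x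
      by (simp add: fourier_L1_cnj_uminus complex_norm_square[symmetric] gauss_weight_def flip: of_real_power)
    have int': "integrable lborel (\<lambda>x. (norm (fourier_L1 f x))\<^sup>2 * norm (gauss_weight c x))"
      using int unfolding eq by (rule complex_of_real_integrable_eq[THEN iffD1])
    have "(\<integral>\<^sup>+ x. ennreal ((norm (fourier_L1 f x))\<^sup>2 * norm (gauss_weight c x)) \<partial>lborel)
      = ennreal (LINT x|lborel. (norm (fourier_L1 f x))\<^sup>2 * norm (gauss_weight c x))"
      by (rule nn_integral_eq_integral[OF int']) auto
    also have "\<dots> = ennreal (norm (LINT x|lborel. fourier_L1 f x * fourier_L1 ?g x * gauss_weight c x))"
      unfolding eq integral_complex_of_real norm_of_real by (simp add: integral_nonneg)
    also have "\<dots> = ennreal (norm (LINT u|lborel. f u * (LINT t|lborel. ?g t * of_real (gauss_kernel c (u + t)))))"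
      by (simp only: fourier_L1_gauss_formula[OF f g c])
    also have "\<dots> \<le> (\<integral>\<^sup>+ u. ennreal (norm (f u * (LINT t|lborel. ?g t * of_real (gauss_kernel c (u + t))))) \<partial>lborel)"
      by (rule norm_integral_le_nn_integral)
    also have "\<dots> \<le> (\<integral>\<^sup>+ u. (\<integral>\<^sup>+ t. ennreal (1/2) * (ennreal ((norm (f u))\<^sup>2) * ennreal (gauss_kernel c (u + t)))
        + ennreal (1/2) * (ennreal ((norm (?g t))\<^sup>2) * ennreal (gauss_kernel c (u + t))) \<partial>lborel) \<partial>lborel)"
    proof (rule nn_integral_mono)
      fix u
      have "ennreal (norm (f u * (LINT t|lborel. ?g t * of_real (gauss_kernel c (u + t)))))
        = ennreal (norm (f u)) * ennreal (norm (LINT t|lborel. ?g t * of_real (gauss_kernel c (u + t))))"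
        by (simp add: norm_mult ennreal_mult')
      also have "\<dots> \<le> ennreal (norm (f u)) * (\<integral>\<^sup>+ t. ennreal (norm (?g t * of_real (gauss_kernel c (u + t)))) \<partial>lborel)"
        by (intro mult_left_mono norm_integral_le_nn_integral) auto
      also have "\<dots> = (\<integral>\<^sup>+ t. ennreal (norm (f u)) * ennreal (norm (?g t * of_real (gauss_kernel c (u + t)))) \<partial>lborel)"
        by (rule nn_integral_cmult[symmetric]) measurable
      also have "\<dots> \<le> (\<integral>\<^sup>+ t. ennreal (1/2) * (ennreal ((norm (f u))\<^sup>2) * ennreal (gauss_kernel c (u + t)))
        + ennreal (1/2) * (ennreal ((norm (?g t))\<^sup>2) * ennreal (gauss_kernel c (u + t))) \<partial>lborel)"
      proof (rule nn_integral_mono)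
        fix t
        let ?K = "gauss_kernel c (u + t)" and ?a = "norm (f u)" and ?b = "norm (?g t)"
        have K: "?K \<ge> 0" by (rule gauss_kernel_nonneg[OF c])
        \<comment> \<open>Schur's test in its simplest form: after this splitting each term has one
          variable occurring in the kernel alone, and integrating over it gives
          \<open>2 * pi\<close>.\<close>
        have "?a * ?b \<le> 1/2 * ?a\<^sup>2 + 1/2 * ?b\<^sup>2"
          using zero_le_power2[of "?a - ?b"] unfolding power2_diff by linarith
        then have "?a * ?b * ?K \<le> (1/2 * ?a\<^sup>2 + 1/2 * ?b\<^sup>2) * ?K"
          using K by (intro mult_right_mono)
        then have "ennreal (?a * (?b * ?K)) \<le> ennreal (1/2 * (?a\<^sup>2 * ?K) + 1/2 * (?b\<^sup>2 * ?K))"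
          by (intro ennreal_leI) (simp only: ring_distribs mult.assoc)
        also have "\<dots> = ennreal (1/2) * (ennreal (?a\<^sup>2) * ennreal ?K) + ennreal (1/2) * (ennreal (?b\<^sup>2) * ennreal ?K)"
          using K ennreal_mult'[of "1/2" "?a\<^sup>2 * ?K"] ennreal_mult'[of "?a\<^sup>2" ?K]
            ennreal_mult'[of "1/2" "?b\<^sup>2 * ?K"] ennreal_mult'[of "?b\<^sup>2" ?K]
          by (subst ennreal_plus) simp_all
        finally show "ennreal (norm (f u)) * ennreal (norm (?g t * of_real ?K)) \<le>
          ennreal (1/2) * (ennreal (?a\<^sup>2) * ennreal ?K) + ennreal (1/2) * (ennreal (?b\<^sup>2) * ennreal ?K)"
          using K by (simp add: norm_mult ennreal_mult)
      qed
      finally show "ennreal (norm (f u * (LINT t|lborel. ?g t * of_real (gauss_kernel c (u + t))))) \<le>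
        (\<integral>\<^sup>+ t. ennreal (1/2) * (ennreal ((norm (f u))\<^sup>2) * ennreal (gauss_kernel c (u + t)))
        + ennreal (1/2) * (ennreal ((norm (?g t))\<^sup>2) * ennreal (gauss_kernel c (u + t))) \<partial>lborel)" .
    qed
    also have "\<dots> = (\<integral>\<^sup>+ u. (\<integral>\<^sup>+ t. ennreal (1/2) * (ennreal ((norm (f u))\<^sup>2) * ennreal (gauss_kernel c (u + t))) \<partial>lborel) \<partial>lborel)
       + (\<integral>\<^sup>+ u. (\<integral>\<^sup>+ t. ennreal (1/2) * (ennreal ((norm (?g t))\<^sup>2) * ennreal (gauss_kernel c (u + t))) \<partial>lborel) \<partial>lborel)"
      by (subst nn_integral_add[symmetric]) (auto intro!: nn_integral_cong nn_integral_add)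
    also have "(\<integral>\<^sup>+ u. (\<integral>\<^sup>+ t. ennreal (1/2) * (ennreal ((norm (f u))\<^sup>2) * ennreal (gauss_kernel c (u + t))) \<partial>lborel) \<partial>lborel)
      = (\<integral>\<^sup>+ u. ennreal (1/2) * (ennreal ((norm (f u))\<^sup>2) * ennreal (2 * pi)) \<partial>lborel)"
      by (intro nn_integral_cong, subst nn_integral_cmult, simp, subst nn_integral_cmult, simp, subst integral_gauss_kernel(1)[OF c], rule refl)
    also have "\<dots> = ennreal (1/2) * (l2sq f * ennreal (2 * pi))"
      unfolding l2sq_def by (subst nn_integral_cmult, simp, subst nn_integral_multc, simp, rule refl)
    also have "(\<integral>\<^sup>+ u. (\<integral>\<^sup>+ t. ennreal (1/2) * (ennreal ((norm (?g t))\<^sup>2) * ennreal (gauss_kernel c (u + t))) \<partial>lborel) \<partial>lborel)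
      = (\<integral>\<^sup>+ t. (\<integral>\<^sup>+ u. ennreal (1/2) * (ennreal ((norm (?g t))\<^sup>2) * ennreal (gauss_kernel c (t + u))) \<partial>lborel) \<partial>lborel)"
      by (subst lborel_pair.Fubini'[symmetric]) (simp_all add: add.commute)
    also have "\<dots> = (\<integral>\<^sup>+ t. ennreal (1/2) * (ennreal ((norm (?g t))\<^sup>2) * ennreal (2 * pi)) \<partial>lborel)"
      by (intro nn_integral_cong, subst nn_integral_cmult, simp, subst nn_integral_cmult, simp, subst integral_gauss_kernel(1)[OF c], rule refl)
    also have "\<dots> = ennreal (1/2) * (l2sq ?g * ennreal (2 * pi))"
      unfolding l2sq_def by (subst nn_integral_cmult, simp, subst nn_integral_multc, simp, rule refl)
    also have "l2sq ?g = l2sq f"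
      using l2sq_affine[of f "-1" 0] by (simp add: l2sq_def)
    also have "ennreal (1/2) * (l2sq f * ennreal (2 * pi)) + ennreal (1/2) * (l2sq f * ennreal (2 * pi))
      = (ennreal (1/2) + ennreal (1/2)) * (ennreal (2 * pi) * l2sq f)"
      unfolding distrib_right by (simp only: mult.commute[of "l2sq f"])
    also have "ennreal (1/2) + ennreal (1/2) = 1"
      by (subst ennreal_plus[symmetric]) auto
    also have "1 * (ennreal (2 * pi) * l2sq f) = ennreal (2 * pi) * l2sq f" by simp
    finally show ?thesis .
  qed
  \<comment> \<open>Fatou's lemma for weights tending to 1; the bound does not depend on
    \<open>c\<close>.\<close>
  have "l2sq (fourier_L1 f) = (\<integral>\<^sup>+ x. liminf (\<lambda>n. ennreal ((norm (fourier_L1 f x))\<^sup>2 * norm (gauss_weight (real (Suc n)) x))) \<partial>lborel)"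
    unfolding l2sq_def
  proof (intro nn_integral_cong lim_imp_Liminf[symmetric])
    fix x
    have "(\<lambda>n. (norm (fourier_L1 f x))\<^sup>2 * norm (gauss_weight (real (Suc n)) x)) \<longlonglongrightarrow> (norm (fourier_L1 f x))\<^sup>2 * norm (1::complex)"
      by (intro tendsto_intros gauss_weight_tendsto)
    then show "(\<lambda>n. ennreal ((norm (fourier_L1 f x))\<^sup>2 * norm (gauss_weight (real (Suc n)) x))) \<longlonglongrightarrow> ennreal ((norm (fourier_L1 f x))\<^sup>2)"
      by (intro tendsto_ennrealI) simp
  qed auto
  also have "\<dots> \<le> liminf (\<lambda>n. \<integral>\<^sup>+ x. ennreal ((norm (fourier_L1 f x))\<^sup>2 * norm (gauss_weight (real (Suc n)) x)) \<partial>lborel)"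
    by (rule nn_integral_liminf) measurable
  also have "\<dots> \<le> liminf (\<lambda>n. ennreal (2 * pi) * l2sq f)"
    by (intro Liminf_mono always_eventually allI bound) auto
  also have "\<dots> = ennreal (2 * pi) * l2sq f" by (simp add: Liminf_const)
  finally show ?thesis .
qed

section \<open>The Fourier transform on \<open>L\<^sup>2(\<real>)\<close>\<close>

lemma l2sq_fourier_L1_diff_le:
  assumes "f \<in> L2" "integrable lborel f" "g \<in> L2" "integrable lborel g"
  shows "l2sq (\<lambda>x. fourier_L1 f x - fourier_L1 g x) \<le> ennreal (2 * pi) * l2sq (\<lambda>x. f x - g x)"
proof -
  have "(\<lambda>x. fourier_L1 f x - fourier_L1 g x) = fourier_L1 (\<lambda>x. f x - g x)"
    unfolding fourier_L1_def using assms
    by (subst Bochner_Integration.integral_diff[symmetric]) (auto simp: right_diff_distrib)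
  then show ?thesis
    using l2sq_fourier_L1_le[of "\<lambda>x. f x - g x"] assms by auto
qed

lemma L2_fourier_L1:
  assumes "f \<in> L2" "integrable lborel f"
  shows "fourier_L1 f \<in> L2"
proof -
  have [measurable]: "f \<in> borel_measurable borel" using assms by auto
  have "l2sq (fourier_L1 f) \<le> ennreal (2 * pi) * l2sq f"
    by (rule l2sq_fourier_L1_le[OF assms(2)])
  also have "\<dots> < \<infinity>" using assms by (auto simp: L2_iff ennreal_mult_less_top)
  finally show ?thesis by (simp add: L2_iff)
qed

text \<open>Integrable as well as square integrable, because the interval has finite measure; so
  every \<open>f\<close> in \<open>L2\<close> has an approximating sequence of the kind quantified
  over in \<open>fourier\<close>.\<close>

definition truncate :: "(real \<Rightarrow> complex) \<Rightarrow> nat \<Rightarrow> real \<Rightarrow> complex" where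
  "truncate f n x = indicator {- real n..real n} x * f x"

lemma L2_indicator [intro]:
  assumes "A \<in> sets borel" "emeasure lborel A < \<infinity>"
  shows "indicator A \<in> L2"
proof -
  have "ennreal ((cmod (indicator A x))\<^sup>2) = indicator A x" for x
    by (simp add: indicator_def)
  then show ?thesis using assms by (simp add: L2_iff l2sq_def)
qed

lemma L2_indicator_Icc [intro]: "indicator {a..b::real} \<in> L2"
  by (intro L2_indicator) (auto simp: emeasure_lborel_Icc_eq)

lemma integrable_indicator_Icc [intro]: "integrable lborel (indicator {a..b::real} :: real \<Rightarrow> complex)"
proof -
  have "integrable lborel (\<lambda>x. indicator {a..b} x * indicator {a..b} x :: complex)"
    by (intro L2_mult_integrable) auto
  also have "(\<lambda>x. indicator {a..b} x * indicator {a..b} x :: complex) = indicator {a..b}"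
    by (auto simp: indicator_def fun_eq_iff)
  finally show ?thesis .
qed

lemma L2_indicator_mult [intro]:
  assumes "f \<in> L2" "A \<in> sets borel"
  shows "(\<lambda>x. indicator A x * f x) \<in> L2"
proof (rule L2_bound[OF assms(1)])
  have [measurable]: "f \<in> borel_measurable borel" using assms by (auto dest: L2_borel)
  note assms(2)[measurable]
  show "(\<lambda>x. indicator A x * f x) \<in> borel_measurable borel" by measurable
qed (auto simp: indicator_def)

lemma L2_truncate [intro]: "f \<in> L2 \<Longrightarrow> truncate f n \<in> L2"
  unfolding truncate_def[abs_def] by (intro L2_indicator_mult) auto

lemma integrable_truncate [intro]: "f \<in> L2 \<Longrightarrow> integrable lborel (truncate f n)"
  unfolding truncate_def[abs_def] by (intro L2_mult_integrable) auto

lemma L2_tendsto_truncate: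
  assumes "f \<in> L2"
  shows "L2_tendsto (truncate f) f"
proof -
  have [measurable]: "f \<in> borel_measurable borel" using assms by (auto dest: L2_borel)
  have [measurable]: "truncate f n \<in> borel_measurable borel" for n
    unfolding truncate_def[abs_def] by measurable
  have "(\<lambda>n. \<integral>\<^sup>+ x. ennreal ((norm (truncate f n x - f x))\<^sup>2) \<partial>lborel) \<longlonglongrightarrow> (\<integral>\<^sup>+ (x::real). 0 \<partial>lborel)"
  proof (rule nn_integral_dominated_convergence[where w="\<lambda>x. ennreal ((norm (f x))\<^sup>2)" and u'="\<lambda>_. 0"])
    show "(\<integral>\<^sup>+ x. ennreal ((norm (f x))\<^sup>2) \<partial>lborel) < \<infinity>"
      using assms by (simp add: L2_iff l2sq_def)
    show "AE x in lborel. ennreal ((norm (truncate f n x - f x))\<^sup>2) \<le> ennreal ((norm (f x))\<^sup>2)" for n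
      by (auto simp: truncate_def indicator_def)
    show "AE x in lborel. (\<lambda>n. ennreal ((norm (truncate f n x - f x))\<^sup>2)) \<longlonglongrightarrow> 0"
    proof (rule AE_I2)
      fix x
      have "truncate f n x = f x" if "n \<ge> nat \<lceil>\<bar>x\<bar>\<rceil>" for n
        using that by (auto simp: truncate_def indicator_def)
      then show "(\<lambda>n. ennreal ((norm (truncate f n x - f x))\<^sup>2)) \<longlonglongrightarrow> 0"
        by (intro tendsto_eventually eventually_sequentiallyI[of "nat \<lceil>\<bar>x\<bar>\<rceil>"]) simp
    qed
  qed measurable
  then show ?thesis by (simp add: L2_tendsto_def)
qed

text \<open>The limit of the transforms is independent of the approximating sequence, since
  \<open>fourier_L1\<close> is Lipschitz for the L2 distance. This is what lets a single candidate
  meet the universally quantified condition in \<open>fourier\<close>.\<close>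

lemma L2_tendsto_fourier_L1:
  assumes f: "f \<in> L2" 
    and h: "\<And>n. h n \<in> L2" "\<And>n. integrable lborel (h n)" "L2_tendsto h f"
    and h': "\<And>n. h' n \<in> L2" "\<And>n. integrable lborel (h' n)" "L2_tendsto h' f"
    and G: "G \<in> borel_measurable borel" "L2_tendsto (\<lambda>n. fourier_L1 (h n)) G"
  shows "L2_tendsto (\<lambda>n. fourier_L1 (h' n)) G"
proof -
  have [measurable]: "f \<in> borel_measurable borel" "\<And>n. h n \<in> borel_measurable borel" "\<And>n. h' n \<in> borel_measurable borel"
    "G \<in> borel_measurable borel"
    using f h h' G by (auto dest: L2_borel)
  let ?a = "\<lambda>n. l2sq (\<lambda>x. h n x - f x)" and ?b = "\<lambda>n. l2sq (\<lambda>x. h' n x - f x)"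
    and ?c = "\<lambda>n. l2sq (\<lambda>x. fourier_L1 (h n) x - G x)"
  have le: "l2sq (\<lambda>x. fourier_L1 (h' n) x - G x) \<le> 2 * (ennreal (2 * pi) * (2 * ?b n + 2 * ?a n)) + 2 * ?c n" for n
  proof -
    have "l2sq (\<lambda>x. fourier_L1 (h' n) x - G x) \<le> 2 * l2sq (\<lambda>x. fourier_L1 (h' n) x - fourier_L1 (h n) x) + 2 * ?c n"
      by (rule l2sq_triangle) measurable
    also have "l2sq (\<lambda>x. fourier_L1 (h' n) x - fourier_L1 (h n) x) \<le> ennreal (2 * pi) * l2sq (\<lambda>x. h' n x - h n x)"
      by (intro l2sq_fourier_L1_diff_le h h')
    also have "l2sq (\<lambda>x. h' n x - h n x) \<le> 2 * ?b n + 2 * ?a n"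
      using l2sq_triangle[of "h' n" f "h n"] by (simp add: l2sq_minus_commute[of f])
    finally show ?thesis by (simp add: mult_left_mono add_right_mono)
  qed
  have "(\<lambda>n. 2 * (ennreal (2 * pi) * (2 * ?b n + 2 * ?a n)) + 2 * ?c n) \<longlonglongrightarrow> 2 * (ennreal (2 * pi) * (2 * 0 + 2 * 0)) + 2 * 0"
    using h(3) h'(3) G(2) unfolding L2_tendsto_iff by (intro tendsto_add ennreal_tendsto_cmult) auto
  then show ?thesis
    unfolding L2_tendsto_iff
    by (intro tendsto_sandwich[OF always_eventually always_eventually tendsto_const, rule_format, OF _ le]) auto
qed

text \<open>Existence for the choice in \<open>fourier\<close>: the transforms of the truncations
  form a Cauchy sequence, and \<open>L2_tendsto_fourier_L1\<close> carries its limit over to all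
  other sequences.\<close>

lemma fourier_spec:
  assumes f: "f \<in> L2"
  shows "fourier f \<in> L2"
    and "(\<And>n. h n \<in> L2) \<Longrightarrow> (\<And>n. integrable lborel (h n)) \<Longrightarrow> L2_tendsto h f
      \<Longrightarrow> L2_tendsto (\<lambda>n. fourier_L1 (h n)) (fourier f)"
proof -
  let ?h = "truncate f"
  have [measurable]: "f \<in> borel_measurable borel" "\<And>n. truncate f n \<in> borel_measurable borel"
    using f L2_truncate[OF f] by (auto dest: L2_borel)
  have lim: "(\<lambda>n. l2sq (\<lambda>x. ?h n x - f x)) \<longlonglongrightarrow> 0"
    using L2_tendsto_truncate[OF f] by (simp add: L2_tendsto_iff)
  have "\<exists>G\<in>L2. L2_tendsto (\<lambda>n. fourier_L1 (?h n)) G"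
  proof (rule L2_complete)
    show "fourier_L1 (?h n) \<in> L2" for n
      using f by (intro L2_fourier_L1) auto
    \<comment> \<open>The tolerance \<open>e / (16 * pi)\<close> becomes \<open>e / 2\<close>
      through the accumulated factor \<open>8 * pi\<close>.\<close>
    fix e :: real assume e: "e > 0"
    have "\<forall>\<^sub>F n in sequentially. l2sq (\<lambda>x. ?h n x - f x) < ennreal (e / (16 * pi))"
      using e by (intro order_tendstoD(2)[OF lim]) auto
    then obtain N where N: "\<And>n. n \<ge> N \<Longrightarrow> l2sq (\<lambda>x. ?h n x - f x) < ennreal (e / (16 * pi))"
      by (auto simp: eventually_sequentially)
    have "l2sq (\<lambda>x. fourier_L1 (?h m) x - fourier_L1 (?h n) x) < ennreal e" if mn: "m \<ge> N" "n \<ge> N" for m n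
    proof -
      have "l2sq (\<lambda>x. fourier_L1 (?h m) x - fourier_L1 (?h n) x) \<le> ennreal (2 * pi) * l2sq (\<lambda>x. ?h m x - ?h n x)"
        using f by (intro l2sq_fourier_L1_diff_le) auto
      also have "\<dots> \<le> ennreal (2 * pi) * (2 * l2sq (\<lambda>x. ?h m x - f x) + 2 * l2sq (\<lambda>x. ?h n x - f x))"
        using l2sq_triangle[of "?h m" f "?h n"] by (intro mult_left_mono) (auto simp: l2sq_minus_commute[of f])
      also have "\<dots> \<le> ennreal (2 * pi) * (2 * ennreal (e / (16 * pi)) + 2 * ennreal (e / (16 * pi)))"
        using N[OF mn(1)] N[OF mn(2)] by (intro mult_left_mono add_mono) auto
      also have "2 * ennreal (e / (16 * pi)) = ennreal (2 * (e / (16 * pi)))"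
        using e by (subst ennreal_mult) auto
      also have "ennreal (2 * (e / (16 * pi))) + ennreal (2 * (e / (16 * pi))) = ennreal (2 * (e / (16 * pi)) + 2 * (e / (16 * pi)))"
        using e by (intro ennreal_plus[symmetric]) auto
      also have "ennreal (2 * pi) * \<dots> = ennreal (2 * pi * (2 * (e / (16 * pi)) + 2 * (e / (16 * pi))))"
        using e by (intro ennreal_mult[symmetric]) auto
      also have "\<dots> < ennreal e"
        using e by (intro ennreal_lessI) (auto simp: field_simps)
      finally show ?thesis .
    qed
    then show "\<exists>N. \<forall>m\<ge>N. \<forall>n\<ge>N. l2sq (\<lambda>x. fourier_L1 (?h m) x - fourier_L1 (?h n) x) < ennreal e" by blast
  qed
  then obtain G where G: "G \<in> L2" "L2_tendsto (\<lambda>n. fourier_L1 (?h n)) G" by blast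
  have "\<exists>g. g \<in> L2 \<and> (\<forall>h. (\<forall>n. h n \<in> L2 \<and> integrable lborel (h n)) \<and> L2_tendsto h f
            \<longrightarrow> L2_tendsto (\<lambda>n. fourier_L1 (h n)) g)"
  proof (intro exI[of _ G] conjI allI impI G(1))
    fix h assume h: "(\<forall>n. h n \<in> L2 \<and> integrable lborel (h n)) \<and> L2_tendsto h f"
    show "L2_tendsto (\<lambda>n. fourier_L1 (h n)) G"
      by (rule L2_tendsto_fourier_L1[OF f _ _ L2_tendsto_truncate[OF f] _ _ _ _ G(2)])
         (use h f G(1) in \<open>auto dest: L2_borel\<close>)
  qed
  from someI_ex[OF this, folded fourier_def]
  show "fourier f \<in> L2" and "(\<And>n. h n \<in> L2) \<Longrightarrow> (\<And>n. integrable lborel (h n)) \<Longrightarrow> L2_tendsto h f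
      \<Longrightarrow> L2_tendsto (\<lambda>n. fourier_L1 (h n)) (fourier f)"
    by blast+
qed

lemmas L2_fourier [intro] = fourier_spec(1)

lemma fourier_borel [measurable (raw)]: "f \<in> L2 \<Longrightarrow> fourier f \<in> borel_measurable borel"
  by (rule L2_borel, rule L2_fourier)

text \<open>One convenient approximating sequence determines the transform; the algebraic rules for
  \<open>fourier\<close> are all checked in this way.\<close>

lemma fourier_eqI:
  assumes f: "f \<in> L2" and G: "G \<in> borel_measurable borel"
    and h: "\<And>n. h n \<in> L2" "\<And>n. integrable lborel (h n)" "L2_tendsto h f" "L2_tendsto (\<lambda>n. fourier_L1 (h n)) G"
  shows "ae_eq (fourier f) G"
proof -
  have [measurable]: "\<And>n. h n \<in> borel_measurable borel" using h by (auto dest: L2_borel)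
  show ?thesis
    by (rule L2_tendsto_unique[OF fourier_spec(2)[OF f h(1-3)] h(4)]) (use f G in \<open>auto dest: L2_borel\<close>)
qed

lemma fourier_truncate: 
  assumes "f \<in> L2"
  shows "L2_tendsto (\<lambda>n. fourier_L1 (truncate f n)) (fourier f)"
  using assms by (intro fourier_spec(2) L2_tendsto_truncate) auto

lemma fourier_eq_fourier_L1:
  assumes "f \<in> L2" "integrable lborel f"
  shows "ae_eq (fourier f) (fourier_L1 f)"
proof -
  have [measurable]: "f \<in> borel_measurable borel" using assms by auto
  show ?thesis
    by (rule fourier_eqI[where h="\<lambda>_. f"]) (use assms in \<open>auto simp: L2_tendsto_def\<close>)
qed

lemma fourier_cong:
  assumes f: "f \<in> L2" and g: "g \<in> L2" and eq: "ae_eq f g"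
  shows "ae_eq (fourier f) (fourier g)"
proof (rule fourier_eqI[where h="truncate g"])
  show "L2_tendsto (truncate g) f"
    using L2_tendsto_truncate[OF g] unfolding L2_tendsto_iff
    by (rule Lim_transform_eventually)
       (use eq in \<open>auto simp: ae_eq_def intro!: always_eventually l2sq_cong_AE elim!: eventually_mono\<close>)
qed (use f g fourier_truncate[OF g] in auto)

lemma fourier_add:
  assumes f: "f \<in> L2" and g: "g \<in> L2"
  shows "ae_eq (fourier (\<lambda>x. f x + g x)) (\<lambda>x. fourier f x + fourier g x)"
proof (rule fourier_eqI[where h="\<lambda>n x. truncate f n x + truncate g n x"])
  have *: "L2_tendsto (\<lambda>n x. a n x + b n x) (\<lambda>x. A x + B x)"
    if "L2_tendsto a A" "L2_tendsto b B" "\<And>n. a n \<in> L2" "\<And>n. b n \<in> L2" "A \<in> L2" "B \<in> L2" for a b A B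
  proof -
    have [measurable]: "\<And>n. a n \<in> borel_measurable borel" "\<And>n. b n \<in> borel_measurable borel"
      "A \<in> borel_measurable borel" "B \<in> borel_measurable borel"
      using that by (auto dest: L2_borel)
    have le: "l2sq (\<lambda>x. (a n x + b n x) - (A x + B x)) \<le> 2 * l2sq (\<lambda>x. a n x - A x) + 2 * l2sq (\<lambda>x. b n x - B x)" for n
      using l2sq_add_le[of "\<lambda>x. a n x - A x" "\<lambda>x. b n x - B x"] by (simp add: algebra_simps)
    have "(\<lambda>n. 2 * l2sq (\<lambda>x. a n x - A x) + 2 * l2sq (\<lambda>x. b n x - B x)) \<longlonglongrightarrow> 2 * 0 + 2 * 0"
      using that unfolding L2_tendsto_iff by (intro tendsto_add ennreal_tendsto_cmult) auto
    then show ?thesis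
      unfolding L2_tendsto_iff
      by (intro tendsto_sandwich[OF always_eventually always_eventually tendsto_const, rule_format, OF _ le]) auto
  qed
  show "L2_tendsto (\<lambda>n x. truncate f n x + truncate g n x) (\<lambda>x. f x + g x)"
    by (rule *) (use f g in \<open>auto intro: L2_tendsto_truncate\<close>)
  have "(\<lambda>n. fourier_L1 (\<lambda>x. truncate f n x + truncate g n x)) = (\<lambda>n x. fourier_L1 (truncate f n) x + fourier_L1 (truncate g n) x)"
    unfolding fourier_L1_def using f g
    by (subst Bochner_Integration.integral_add[symmetric]) (auto simp: distrib_left)
  moreover have "L2_tendsto (\<lambda>n x. fourier_L1 (truncate f n) x + fourier_L1 (truncate g n) x) (\<lambda>x. fourier f x + fourier g x)"
    by (rule *) (use f g in \<open>auto intro: fourier_truncate L2_fourier_L1\<close>)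
  ultimately show "L2_tendsto (\<lambda>n. fourier_L1 (\<lambda>x. truncate f n x + truncate g n x)) (\<lambda>x. fourier f x + fourier g x)"
    by simp
qed (use f g in auto)

lemma fourier_cmult:
  assumes f: "f \<in> L2"
  shows "ae_eq (fourier (\<lambda>x. c * f x)) (\<lambda>x. c * fourier f x)"
proof (rule fourier_eqI[where h="\<lambda>n x. c * truncate f n x"])
  have *: "L2_tendsto (\<lambda>n x. c * a n x) (\<lambda>x. c * A x)"
    if "L2_tendsto a A" "\<And>n. a n \<in> L2" "A \<in> L2" for a A
  proof -
    have [measurable]: "\<And>n. a n \<in> borel_measurable borel" "A \<in> borel_measurable borel"
      using that by (auto dest: L2_borel)
    have eq: "l2sq (\<lambda>x. c * a n x - c * A x) = ennreal ((norm c)\<^sup>2) * l2sq (\<lambda>x. a n x - A x)" for n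
      using l2sq_cmult[of "\<lambda>x. a n x - A x" c] by (simp add: algebra_simps)
    have "(\<lambda>n. ennreal ((norm c)\<^sup>2) * l2sq (\<lambda>x. a n x - A x)) \<longlonglongrightarrow> ennreal ((norm c)\<^sup>2) * 0"
      using that unfolding L2_tendsto_iff by (intro ennreal_tendsto_cmult) auto
    then show ?thesis unfolding L2_tendsto_iff eq by simp
  qed
  show "L2_tendsto (\<lambda>n x. c * truncate f n x) (\<lambda>x. c * f x)"
    by (rule *) (use f in \<open>auto intro: L2_tendsto_truncate\<close>)
  have "(\<lambda>n. fourier_L1 (\<lambda>x. c * truncate f n x)) = (\<lambda>n x. c * fourier_L1 (truncate f n) x)"
    unfolding fourier_L1_def by (simp add: mult.left_commute[of _ c])
  moreover have "L2_tendsto (\<lambda>n x. c * fourier_L1 (truncate f n) x) (\<lambda>x. c * fourier f x)"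
    by (rule *) (use f in \<open>auto intro: fourier_truncate L2_fourier_L1\<close>)
  ultimately show "L2_tendsto (\<lambda>n. fourier_L1 (\<lambda>x. c * truncate f n x)) (\<lambda>x. c * fourier f x)"
    by simp
qed (use f in auto)

lemma fourier_sum:
  assumes "\<And>i. i \<in> I \<Longrightarrow> f i \<in> L2"
  shows "ae_eq (fourier (\<lambda>x. \<Sum>i\<in>I. f i x)) (\<lambda>x. \<Sum>i\<in>I. fourier (f i) x)"
  using assms
proof (induction I rule: infinite_finite_induct)
  case (insert i I)
  have "ae_eq (fourier (\<lambda>x. f i x + (\<Sum>i\<in>I. f i x))) (\<lambda>x. fourier (f i) x + fourier (\<lambda>x. \<Sum>i\<in>I. f i x) x)"
    using insert.prems by (intro fourier_add) auto
  moreover have "ae_eq (\<lambda>x. fourier (f i) x + fourier (\<lambda>x. \<Sum>i\<in>I. f i x) x) (\<lambda>x. fourier (f i) x + (\<Sum>i\<in>I. fourier (f i) x))"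
    using insert.IH insert.prems by (auto simp: ae_eq_def elim!: eventually_mono)
  ultimately show ?case
    using insert.hyps by (simp add: ae_eq_trans)
\<comment> \<open>Empty and infinite index sets both give the zero function, whose transform
  vanishes almost everywhere by homogeneity with factor 0.\<close>
qed (use fourier_cmult[of "\<lambda>_. 0" 0] in auto)

lemma fourier_shift:
  assumes f: "f \<in> L2"
  shows "ae_eq (fourier (\<lambda>x. f (x - a))) (\<lambda>x. cis (- (a * x)) * fourier f x)"
proof (rule fourier_eqI[where h="\<lambda>n x. truncate f n (x - a)"])
  have [measurable]: "f \<in> borel_measurable borel" "\<And>n. truncate f n \<in> borel_measurable borel"
    "fourier f \<in> borel_measurable borel"
    using f L2_truncate[OF f] by (auto dest: L2_borel)
  show "(\<lambda>x. cis (- (a * x)) * fourier f x) \<in> borel_measurable borel" by measurable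
  have "l2sq (\<lambda>x. truncate f n (x - a) - f (x - a)) = l2sq (\<lambda>x. truncate f n x - f x)" for n
    using l2sq_affine[of "\<lambda>x. truncate f n x - f x" 1 "-a"] by simp
  then show "L2_tendsto (\<lambda>n x. truncate f n (x - a)) (\<lambda>x. f (x - a))"
    using L2_tendsto_truncate[OF f] by (simp add: L2_tendsto_iff)
  have "fourier_L1 (\<lambda>x. truncate f n (x - a)) x = cis (- (a * x)) * fourier_L1 (truncate f n) x" for n x
  proof -
    have "fourier_L1 (\<lambda>x. truncate f n (x - a)) x = (LINT u|lborel. cis (- (x * (a + u))) * truncate f n (a + u - a))"
      unfolding fourier_L1_def by (subst lborel_integral_real_affine[of 1 _ a]) auto
    also have "\<dots> = (LINT u|lborel. cis (- (a * x)) * (cis (- (x * u)) * truncate f n u))"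
      unfolding mult.assoc[symmetric] cis_mult
      by (intro Bochner_Integration.integral_cong) (auto simp: algebra_simps)
    finally show ?thesis by (simp add: fourier_L1_def)
  qed
  moreover have "l2sq (\<lambda>x. cis (- (a * x)) * fourier_L1 (truncate f n) x - cis (- (a * x)) * fourier f x)
    = l2sq (\<lambda>x. fourier_L1 (truncate f n) x - fourier f x)" for n
    by (intro l2sq_cong_AE) (simp add: norm_mult flip: right_diff_distrib)
  ultimately show "L2_tendsto (\<lambda>n. fourier_L1 (\<lambda>x. truncate f n (x - a))) (\<lambda>x. cis (- (a * x)) * fourier f x)"
    using fourier_truncate[OF f] by (simp add: L2_tendsto_iff)
  show "integrable lborel (\<lambda>x. truncate f n (x - a))" for n
    using lborel_integrable_real_affine[OF integrable_truncate[OF f, of n], of "1" "-a"] by simp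
qed (use f in auto)

lemma fourier_uminus:
  assumes f: "f \<in> L2"
  shows "ae_eq (fourier (\<lambda>x. f (- x))) (\<lambda>x. fourier f (- x))"
proof (rule fourier_eqI[where h="\<lambda>n x. truncate f n (- x)"])
  have [measurable]: "f \<in> borel_measurable borel" "\<And>n. truncate f n \<in> borel_measurable borel"
    "fourier f \<in> borel_measurable borel"
    using f L2_truncate[OF f] by (auto dest: L2_borel)
  show "(\<lambda>x. fourier f (- x)) \<in> borel_measurable borel" by measurable
  have "l2sq (\<lambda>x. truncate f n (- x) - f (- x)) = l2sq (\<lambda>x. truncate f n x - f x)" for n
    using l2sq_affine[of "\<lambda>x. truncate f n x - f x" "-1" 0] by simp
  then show "L2_tendsto (\<lambda>n x. truncate f n (- x)) (\<lambda>x. f (- x))"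
    using L2_tendsto_truncate[OF f] by (simp add: L2_tendsto_iff)
  have "fourier_L1 (\<lambda>x. truncate f n (- x)) x = fourier_L1 (truncate f n) (- x)" for n x
    using lborel_integral_uminus[of "\<lambda>u. cis (x * u) * truncate f n u"]
    by (simp add: fourier_L1_def)
  moreover have "l2sq (\<lambda>x. fourier_L1 (truncate f n) (- x) - fourier f (- x))
    = l2sq (\<lambda>x. fourier_L1 (truncate f n) x - fourier f x)" for n
    using l2sq_affine[of "\<lambda>x. fourier_L1 (truncate f n) x - fourier f x" "-1" 0] by simp
  ultimately show "L2_tendsto (\<lambda>n. fourier_L1 (\<lambda>x. truncate f n (- x))) (\<lambda>x. fourier f (- x))"
    using fourier_truncate[OF f] by (simp add: L2_tendsto_iff)
  show "integrable lborel (\<lambda>x. truncate f n (- x))" for n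
    using lborel_integrable_real_affine[OF integrable_truncate[OF f, of n], of "-1" "0"] by simp
qed (use f in auto)

text \<open>Converts the bilinear Parseval formula into a sesquilinear one: pairing with the
  reflected conjugate produces squared moduli.\<close>

lemma fourier_cnj_uminus:
  assumes f: "f \<in> L2"
  shows "ae_eq (fourier (\<lambda>x. cnj (f (- x)))) (\<lambda>x. cnj (fourier f x))"
proof (rule fourier_eqI[where h="\<lambda>n x. cnj (truncate f n (- x))"])
  have [measurable]: "f \<in> borel_measurable borel" "\<And>n. truncate f n \<in> borel_measurable borel"
    "fourier f \<in> borel_measurable borel"
    using f L2_truncate[OF f] by (auto dest: L2_borel)
  show "(\<lambda>x. cnj (fourier f x)) \<in> borel_measurable borel" by measurable
  have "l2sq (\<lambda>x. cnj (truncate f n (- x)) - cnj (f (- x))) = l2sq (\<lambda>x. truncate f n (- x) - f (- x))" for n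
    unfolding l2sq_def complex_cnj_diff[symmetric] complex_mod_cnj ..
  also have "l2sq (\<lambda>x. truncate f n (- x) - f (- x)) = l2sq (\<lambda>x. truncate f n x - f x)" for n
    using l2sq_affine[of "\<lambda>x. truncate f n x - f x" "-1" 0] by simp
  finally show "L2_tendsto (\<lambda>n x. cnj (truncate f n (- x))) (\<lambda>x. cnj (f (- x)))"
    using L2_tendsto_truncate[OF f] by (simp add: L2_tendsto_iff)
  have "l2sq (\<lambda>x. cnj (fourier_L1 (truncate f n) x) - cnj (fourier f x)) = l2sq (\<lambda>x. fourier_L1 (truncate f n) x - fourier f x)" for n
    unfolding l2sq_def complex_cnj_diff[symmetric] complex_mod_cnj ..
  then show "L2_tendsto (\<lambda>n. fourier_L1 (\<lambda>x. cnj (truncate f n (- x)))) (\<lambda>x. cnj (fourier f x))"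
    using fourier_truncate[OF f] by (simp add: L2_tendsto_iff fourier_L1_cnj_uminus)
  show "integrable lborel (\<lambda>x. cnj (truncate f n (- x)))" for n
    using lborel_integrable_real_affine[OF integrable_truncate[OF f, of n], of "-1" "0"] by simp
qed (use f in \<open>auto intro!: L2_cnj[OF L2_uminus[OF L2_truncate]] L2_cnj[OF L2_uminus]\<close>)

lemma L2_tendsto_integral':
  assumes "L2_tendsto h f" "\<And>n. h n \<in> L2" "f \<in> L2" "g \<in> L2"
  shows "(\<lambda>n. LINT x|lborel. g x * h n x) \<longlonglongrightarrow> (LINT x|lborel. g x * f x)"
  using L2_tendsto_integral[OF assms] by (simp add: mult.commute)

lemma integral_mult_cong_ae:
  assumes "ae_eq f f'" "ae_eq g g'" "f \<in> L2" "f' \<in> L2" "g \<in> L2" "g' \<in> L2"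
  shows "(LINT x|lborel. f x * g x) = (LINT x|lborel. f' x * g' x)"
proof (rule integral_cong_AE)
  show "AE x in lborel. f x * g x = f' x * g' x"
    using assms(1,2) unfolding ae_eq_def by eventually_elim simp
qed (use assms in \<open>auto intro!: borel_measurable_times dest: L2_borel\<close>)

text \<open>Two successive limits, first in the truncation of \<open>g\<close> and then in that of
  \<open>f\<close>; each pairing has a single varying factor, so L2 convergence of that factor
  suffices.\<close>

lemma fourier_mult_formula:
  assumes f: "f \<in> L2" and g: "g \<in> L2"
  shows "(LINT x|lborel. fourier f x * g x) = (LINT x|lborel. f x * fourier g x)"
proof -
  have *: "(LINT x|lborel. fourier_L1 (truncate f m) x * truncate g n x) = (LINT x|lborel. truncate f m x * fourier_L1 (truncate g n) x)" for m n
    using f g by (intro fourier_L1_mult_formula) auto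
  have 1: "(LINT x|lborel. fourier_L1 (truncate f m) x * g x) = (LINT x|lborel. truncate f m x * fourier g x)" for m
  proof (rule LIMSEQ_unique)
    show "(\<lambda>n. LINT x|lborel. fourier_L1 (truncate f m) x * truncate g n x) \<longlonglongrightarrow> (LINT x|lborel. fourier_L1 (truncate f m) x * g x)"
      using f g by (intro L2_tendsto_integral' L2_tendsto_truncate) (auto intro: L2_fourier_L1)
    show "(\<lambda>n. LINT x|lborel. fourier_L1 (truncate f m) x * truncate g n x) \<longlonglongrightarrow> (LINT x|lborel. truncate f m x * fourier g x)"
      unfolding * using f g by (intro L2_tendsto_integral' fourier_truncate) (auto intro: L2_fourier_L1)
  qed
  show ?thesis
  proof (rule LIMSEQ_unique)
    show "(\<lambda>m. LINT x|lborel. fourier_L1 (truncate f m) x * g x) \<longlonglongrightarrow> (LINT x|lborel. fourier f x * g x)"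
      using f g by (intro L2_tendsto_integral fourier_truncate) (auto intro: L2_fourier_L1)
    show "(\<lambda>m. LINT x|lborel. fourier_L1 (truncate f m) x * g x) \<longlonglongrightarrow> (LINT x|lborel. f x * fourier g x)"
      unfolding 1 using f g by (intro L2_tendsto_integral L2_tendsto_truncate) auto
  qed
qed

section \<open>Plancherel's theorem\<close>

lemma AE_zero_if_set_integrals_zero:
  fixes h :: "'a \<Rightarrow> real"
  assumes h: "integrable M h" and zero: "\<And>A. A \<in> sets M \<Longrightarrow> (LINT x:A|M. h x) = 0"
  shows "AE x in M. h x = 0"
proof -
  have *: "AE x in M. k x \<le> 0"
    if k: "integrable M k" and k0: "\<And>A. A \<in> sets M \<Longrightarrow> (LINT x:A|M. k x) = 0" for k :: "'a \<Rightarrow> real"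
  proof -
    let ?A = "{x \<in> space M. 0 < k x}"
    have A: "?A \<in> sets M" using k by measurable
    have "integrable M (\<lambda>x. indicator ?A x * k x)"
      using integrable_mult_indicator[OF A k] by simp
    moreover have "(LINT x|M. indicator ?A x * k x) = 0"
      using k0[OF A] by (simp add: set_lebesgue_integral_def)
    ultimately have "AE x in M. indicator ?A x * k x = 0"
      by (subst (asm) integral_nonneg_eq_0_iff_AE) (auto simp: indicator_def)
    then show ?thesis
      using AE_space[of M] by eventually_elim (auto simp: indicator_def not_less)
  qed
  have "AE x in M. h x \<le> 0" by (rule *[OF h zero])
  moreover have "AE x in M. - h x \<le> 0"
    using zero by (intro *) (auto simp: h set_lebesgue_integral_def)
  ultimately show ?thesis by eventually_elim auto
qed

text \<open>Dynkin's theorem for the half-lines, an intersection-stable generator of the Borel sets.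
  The integral over the whole line enters in the step to complements.\<close>

lemma AE_zero_if_integrals_atMost_zero:
  fixes h :: "real \<Rightarrow> real"
  assumes h: "integrable lborel h" and zero: "\<And>a. (LINT x:{..a}|lborel. h x) = 0"
    and UNIV: "(LINT x|lborel. h x) = 0"
  shows "AE x in lborel. h x = 0"
proof (rule AE_zero_if_set_integrals_zero[OF h])
  have Int_stable_atMost: "Int_stable (range (\<lambda>a::real. {..a}))" by (auto simp: Int_stable_def)
  have subset_Pow_UNIV: "range (\<lambda>a::real. {..a}) \<subseteq> Pow UNIV" by simp
  fix A :: "real set" assume "A \<in> sets lborel"
  then have "A \<in> sigma_sets UNIV (range (\<lambda>a. {..a}))"
    by (simp add: borel_eq_atMost)
  with Int_stable_atMost subset_Pow_UNIV show "(LINT x:A|lborel. h x) = 0"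
  proof (induction rule: sigma_sets_induct_disjoint)
    case (basic A) then show ?case using zero by auto
  next
    case empty show ?case by (simp add: set_lebesgue_integral_def)
  next
    case (compl A)
    then have A: "A \<in> sets borel" by (simp add: borel_eq_atMost)
    have int: "integrable lborel (\<lambda>x. indicator A x * h x)"
      using integrable_mult_indicator[of A lborel h] A h by simp
    have "(LINT x:UNIV - A|lborel. h x) = (LINT x|lborel. h x - indicator A x * h x)"
      unfolding set_lebesgue_integral_def by (intro Bochner_Integration.integral_cong) (auto simp: indicator_def)
    also have "\<dots> = 0"
      using int h UNIV compl by (subst Bochner_Integration.integral_diff) (auto simp: set_lebesgue_integral_def)
    finally show ?case .
  next
    case (union A)
    then have A: "A i \<in> sets lborel" for i by (auto simp: borel_eq_atMost)
    have "set_integrable lborel (\<Union>i. A i) h"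
      using A h unfolding set_integrable_def by (intro integrable_mult_indicator) auto
    then show ?case
      using union A by (subst lebesgue_integral_countable_add) (auto simp: disjoint_family_on_def)
  qed
qed

text \<open>Truncation supplies the integrability that the measure-theoretic criterion asks for and
  that \<open>f\<close> itself may lack.\<close>

lemma ae_zero_if_integrals_Icc_zero:
  assumes f: "f \<in> L2" and zero: "\<And>a b. a \<le> b \<Longrightarrow> (LINT x|lborel. f x * indicator {a..b} x) = 0"
  shows "ae_eq f (\<lambda>x. 0)"
proof -
  have "AE x in lborel. Re (truncate f n x) = 0 \<and> Im (truncate f n x) = 0" for n
  proof -
    let ?t = "truncate f n"
    have t: "integrable lborel ?t" using f by auto
    have eq: "(LINT x:A|lborel. Re (?t x)) = Re (LINT x|lborel. ?t x * indicator A x)"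
      "(LINT x:A|lborel. Im (?t x)) = Im (LINT x|lborel. ?t x * indicator A x)" if A: "A \<in> sets borel" for A
    proof -
      have int: "integrable lborel (\<lambda>x. ?t x * indicator A x)"
      proof -
        have "integrable lborel (\<lambda>x. indicator A x *\<^sub>R ?t x)"
          using A t by (intro integrable_mult_indicator) auto
        also have "(\<lambda>x. indicator A x *\<^sub>R ?t x) = (\<lambda>x. ?t x * indicator A x)"
          by (auto simp: indicator_def)
        finally show ?thesis .
      qed
      show "(LINT x:A|lborel. Re (?t x)) = Re (LINT x|lborel. ?t x * indicator A x)"
        "(LINT x:A|lborel. Im (?t x)) = Im (LINT x|lborel. ?t x * indicator A x)"
        unfolding set_lebesgue_integral_def 
        by (subst integral_Re[OF int, symmetric] integral_Im[OF int, symmetric];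
            intro Bochner_Integration.integral_cong; auto simp: indicator_def)+
    qed
    \<comment> \<open>A half-line meets the support interval of \<open>?t\<close> in a compact
      interval or not at all.\<close>
    have z: "(LINT x|lborel. ?t x * indicator {..a} x) = 0" for a
    proof (cases "- real n \<le> min a n")
      case True
      have "(LINT x|lborel. ?t x * indicator {..a} x) = (LINT x|lborel. f x * indicator {- real n..min a n} x)"
        by (intro Bochner_Integration.integral_cong) (auto simp: truncate_def indicator_def)
      then show ?thesis using zero[OF True] by simp
    next
      case False
      then have "?t x * indicator {..a} x = 0" for x by (auto simp: truncate_def indicator_def)
      then have "(LINT x|lborel. ?t x * indicator {..a} x) = (LINT (x::real)|lborel. 0)"
        by (simp only:)
      then show ?thesis by simp
    qed
    have zU: "(LINT x|lborel. ?t x) = 0"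
      using zero[of "- real n" "real n"] by (simp add: truncate_def mult.commute)
    have "AE x in lborel. Re (?t x) = 0"
      using t z zU integral_Re[OF t] by (intro AE_zero_if_integrals_atMost_zero) (auto simp: eq)
    moreover have "AE x in lborel. Im (?t x) = 0"
      using t z zU integral_Im[OF t] by (intro AE_zero_if_integrals_atMost_zero) (auto simp: eq)
    ultimately show ?thesis by eventually_elim auto
  qed
  then have "AE x in lborel. \<forall>n. truncate f n x = 0"
    by (subst AE_all_countable) (auto simp: complex_eq_iff)
  then show ?thesis
    unfolding ae_eq_def
  proof eventually_elim
    fix x assume "\<forall>n. truncate f n x = 0"
    moreover have "truncate f (nat \<lceil>\<bar>x\<bar>\<rceil>) x = f x"
      by (auto simp: truncate_def indicator_def) linarith+
    ultimately show "f x = 0" by metis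
  qed
qed

text \<open>Substituting t = - u + z / c moves all dependence on \<open>c\<close> into the
  indicator, so that the normal density serves as a fixed majorant for dominated
  convergence.\<close>

lemma gauss_kernel_indicator:
  assumes "c > 0"
  shows "(LINT t|lborel. indicator {a..b} t * of_real (gauss_kernel c (u + t))) =
    of_real (2 * pi) * (LINT z|lborel. indicator {a..b} (- u + (1 / c) * z) * (of_real (std_normal_density z) :: complex))"
proof -
  have "(LINT t|lborel. indicator {a..b} t * complex_of_real (gauss_kernel c (u + t))) =
    \<bar>1 / c\<bar> *\<^sub>R (LINT z|lborel. indicator {a..b} (- u + (1 / c) * z) * complex_of_real (gauss_kernel c (u + (- u + (1 / c) * z))))"
    using assms by (intro lborel_integral_real_affine) auto
  also have "\<dots> = (LINT z|lborel. of_real (1 / c) * (indicator {a..b} (- u + (1 / c) * z) * complex_of_real (gauss_kernel c (u + (- u + (1 / c) * z)))))"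
    using assms by (subst integral_mult_right_zero) (simp add: scaleR_conv_of_real)
  also have "\<dots> = (LINT z|lborel. of_real (2 * pi) * (indicator {a..b} (- u + (1 / c) * z) * of_real (std_normal_density z)))"
    using assms by (intro Bochner_Integration.integral_cong) (auto simp: gauss_kernel_def)
  finally show ?thesis by simp
qed

lemma integrable_std_normal: "integrable lborel (std_normal_density)"
  by (simp add: integrable_normal_density)

lemma integral_std_normal: "(LINT z|lborel. std_normal_density z) = 1"
  using integral_normal_density[of 1 0] by simp

text \<open>Away from the endpoints the indicator is eventually constant for each \<open>z\<close>.
  At an endpoint its limit would depend on the sign of \<open>z\<close>; in the application these
  points form a null set.\<close>

lemma gauss_kernel_indicator_tendsto:
  assumes "- u \<noteq> a" "- u \<noteq> b"
  shows "(\<lambda>n. LINT t|lborel. indicator {a..b} t * complex_of_real (gauss_kernel (real (Suc n)) (u + t)))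
    \<longlonglongrightarrow> of_real (2 * pi) * indicator {a..b} (- u)"
proof -
  let ?s = "\<lambda>n z. indicator {a..b} (- u + (1 / real (Suc n)) * z) * complex_of_real (std_normal_density z)"
  have "(\<lambda>n. LINT z|lborel. ?s n z) \<longlonglongrightarrow> (LINT z|lborel. indicator {a..b} (- u) * complex_of_real (std_normal_density z))"
  proof (rule integral_dominated_convergence[where w=std_normal_density])
    show "integrable lborel std_normal_density" by (rule integrable_std_normal)
    show "AE z in lborel. norm (?s n z) \<le> std_normal_density z" for n
      by (auto simp: indicator_def)
    show "AE z in lborel. (\<lambda>n. ?s n z) \<longlonglongrightarrow> indicator {a..b} (- u) * complex_of_real (std_normal_density z)"
    proof (rule AE_I2)
      fix z :: real
      have "(\<lambda>n. - u + inverse (real (Suc n)) * z) \<longlonglongrightarrow> - u + 0 * z"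
        by (intro tendsto_intros LIMSEQ_inverse_real_of_nat)
      then have lim: "(\<lambda>n. - u + (1 / real (Suc n)) * z) \<longlonglongrightarrow> - u"
        by (simp add: inverse_eq_divide)
      have "\<forall>\<^sub>F n in sequentially. (- u + (1 / real (Suc n)) * z \<in> {a..b}) = (- u \<in> {a..b})"
      proof (cases "- u \<in> {a..b}")
        case True
        then have "- u \<in> {a<..<b}" using assms by auto
        then have "\<forall>\<^sub>F n in sequentially. - u + (1 / real (Suc n)) * z \<in> {a<..<b}"
          by (intro topological_tendstoD[OF lim]) auto
        then show ?thesis using True by (auto elim!: eventually_mono)
      next
        case False
        then have "\<forall>\<^sub>F n in sequentially. - u + (1 / real (Suc n)) * z \<in> - {a..b}"
          by (intro topological_tendstoD[OF lim]) auto
        then show ?thesis using False by (auto elim!: eventually_mono)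
      qed
      then have "\<forall>\<^sub>F n in sequentially. ?s n z = indicator {a..b} (- u) * complex_of_real (std_normal_density z)"
        by eventually_elim (auto simp: indicator_def)
      then show "(\<lambda>n. ?s n z) \<longlonglongrightarrow> indicator {a..b} (- u) * complex_of_real (std_normal_density z)"
        by (rule tendsto_eventually)
    qed
  qed measurable
  then have "(\<lambda>n. of_real (2 * pi) * (LINT z|lborel. ?s n z)) \<longlonglongrightarrow> of_real (2 * pi) * (indicator {a..b} (- u) * complex_of_real (LINT z|lborel. std_normal_density z))"
    by (intro tendsto_mult tendsto_const) simp
  then show ?thesis
    unfolding integral_std_normal by (subst gauss_kernel_indicator) auto
qed

lemma norm_gauss_kernel_indicator_le:
  assumes "c > 0"
  shows "norm (LINT t|lborel. indicator {a..b} t * complex_of_real (gauss_kernel c (u + t))) \<le> 2 * pi"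
proof -
  let ?f = "\<lambda>z. indicator {a..b} (- u + (1 / c) * z) * complex_of_real (std_normal_density z)"
  have "integrable lborel ?f"
    by (rule Bochner_Integration.integrable_bound[OF integrable_std_normal]) (auto simp: indicator_def)
  then have "norm (LINT z|lborel. ?f z) \<le> (LINT z|lborel. std_normal_density z)"
    by (intro order_trans[OF integral_norm_bound integral_mono] integrable_norm integrable_std_normal)
       (auto simp: indicator_def)
  then show ?thesis
    unfolding gauss_kernel_indicator[OF assms] integral_std_normal norm_mult
    by (simp add: mult_left_le)
qed

text \<open>The Gaussian formula evaluated in the limit on both sides: on the left the product of
  transforms is integrable and dominates, on the right \<open>norm (f u) * (2 * pi)\<close> does.
  The reflection of \<open>f\<close> reflects the sum \<open>u + t\<close> in the kernel.\<close>

lemma fourier_L1_Parseval_indicator: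
  assumes f: "f \<in> L2" "integrable lborel f"
  shows "(LINT x|lborel. fourier_L1 f x * fourier_L1 (indicator {a..b}) x) =
    of_real (2 * pi) * (LINT t|lborel. f (- t) * indicator {a..b} t)"
proof (rule LIMSEQ_unique)
  let ?g = "indicator {a..b} :: real \<Rightarrow> complex"
  have g: "?g \<in> L2" "integrable lborel ?g" by auto
  have [measurable]: "f \<in> borel_measurable borel" using f by auto
  let ?P = "\<lambda>x. fourier_L1 f x * fourier_L1 ?g x"
  let ?c = "\<lambda>n. real (Suc n)"
  have P: "integrable lborel ?P"
    using f g by (intro L2_mult_integrable L2_fourier_L1) auto
  show "(\<lambda>n. LINT x|lborel. ?P x * gauss_weight (?c n) x) \<longlonglongrightarrow> (LINT x|lborel. ?P x)"
  proof (rule integral_dominated_convergence[where w="\<lambda>x. norm (?P x)"])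
    show "AE x in lborel. norm (?P x * gauss_weight (?c n) x) \<le> norm (?P x)" for n
      by (simp add: norm_mult mult_left_le norm_gauss_weight_le)
    have "(\<lambda>n. ?P x * gauss_weight (?c n) x) \<longlonglongrightarrow> ?P x * 1" for x
      by (intro tendsto_intros gauss_weight_tendsto)
    then show "AE x in lborel. (\<lambda>n. ?P x * gauss_weight (?c n) x) \<longlonglongrightarrow> ?P x" by simp
  qed (use P in \<open>auto intro: integrable_norm\<close>)
  let ?J = "\<lambda>n u. LINT t|lborel. ?g t * complex_of_real (gauss_kernel (?c n) (u + t))"
  have "(\<lambda>n. LINT u|lborel. f u * ?J n u) \<longlonglongrightarrow> (LINT u|lborel. f u * (of_real (2 * pi) * ?g (- u)))"
  proof (rule integral_dominated_convergence[where w="\<lambda>u. norm (f u) * (2 * pi)"])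
    show "integrable lborel (\<lambda>u. norm (f u) * (2 * pi))" using f by auto
    show "AE u in lborel. norm (f u * ?J n u) \<le> norm (f u) * (2 * pi)" for n
      unfolding norm_mult by (intro AE_I2 mult_left_mono norm_gauss_kernel_indicator_le) auto
    show "AE u in lborel. (\<lambda>n. f u * ?J n u) \<longlonglongrightarrow> f u * (of_real (2 * pi) * ?g (- u))"
    proof -
      have "AE u in lborel. u \<noteq> - a" "AE u in lborel. u \<noteq> - b"
        by (intro AE_lborel_singleton)+
      then show ?thesis
        by eventually_elim (intro tendsto_mult tendsto_const gauss_kernel_indicator_tendsto; simp)
    qed
  qed measurable
  also have "(\<lambda>n. LINT u|lborel. f u * ?J n u) = (\<lambda>n. LINT x|lborel. ?P x * gauss_weight (?c n) x)"
    using fourier_L1_gauss_formula[OF f(2) g(2)] by simp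
  also have "(LINT u|lborel. f u * (of_real (2 * pi) * ?g (- u))) = (LINT t|lborel. f (- t) * (of_real (2 * pi) * ?g t))"
    using lborel_integral_uminus[of "\<lambda>u. f u * (of_real (2 * pi) * ?g (- u))"] by simp
  also have "\<dots> = of_real (2 * pi) * (LINT t|lborel. f (- t) * ?g t)"
    unfolding mult.left_commute[of "f _"] by simp
  finally show "(\<lambda>n. LINT x|lborel. ?P x * gauss_weight (?c n) x) \<longlonglongrightarrow>
    of_real (2 * pi) * (LINT t|lborel. f (- t) * ?g t)" .
qed

lemma fourier_Parseval_indicator:
  assumes f: "f \<in> L2"
  shows "(LINT x|lborel. fourier f x * fourier (indicator {a..b}) x) =
    of_real (2 * pi) * (LINT t|lborel. f (- t) * indicator {a..b} t)"
proof (rule LIMSEQ_unique)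
  let ?g = "indicator {a..b} :: real \<Rightarrow> complex"
  have g: "?g \<in> L2" "integrable lborel ?g" by auto
  have [measurable]: "f \<in> borel_measurable borel" "\<And>n. truncate f n \<in> borel_measurable borel"
    using f L2_truncate[OF f] by (auto dest: L2_borel)
  have eq: "(LINT x|lborel. h x * fourier ?g x) = (LINT x|lborel. h x * fourier_L1 ?g x)" if "h \<in> L2" for h
    using that g by (intro integral_mult_cong_ae fourier_eq_fourier_L1) (auto simp: ae_eq_def intro: L2_fourier_L1)
  show "(\<lambda>n. LINT x|lborel. fourier_L1 (truncate f n) x * fourier ?g x) \<longlonglongrightarrow> (LINT x|lborel. fourier f x * fourier ?g x)"
    using f g by (intro L2_tendsto_integral fourier_truncate) (auto intro: L2_fourier_L1)
  have "l2sq (\<lambda>x. truncate f n (- x) - f (- x)) = l2sq (\<lambda>x. truncate f n x - f x)" for n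
    using l2sq_affine[of "\<lambda>x. truncate f n x - f x" "-1" 0] by simp
  then have "L2_tendsto (\<lambda>n x. truncate f n (- x)) (\<lambda>x. f (- x))"
    using L2_tendsto_truncate[OF f] by (simp add: L2_tendsto_iff)
  then have "(\<lambda>n. LINT x|lborel. truncate f n (- x) * ?g x) \<longlonglongrightarrow> (LINT x|lborel. f (- x) * ?g x)"
    using f by (intro L2_tendsto_integral) auto
  then have "(\<lambda>n. of_real (2 * pi) * (LINT x|lborel. truncate f n (- x) * ?g x)) \<longlonglongrightarrow> of_real (2 * pi) * (LINT x|lborel. f (- x) * ?g x)"
    by (intro tendsto_mult tendsto_const)
  also have "(\<lambda>n. of_real (2 * pi) * (LINT x|lborel. truncate f n (- x) * ?g x)) = (\<lambda>n. LINT x|lborel. fourier_L1 (truncate f n) x * fourier ?g x)"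
    using fourier_L1_Parseval_indicator[OF L2_truncate[OF f] integrable_truncate[OF f]]
      eq[OF L2_fourier_L1[OF L2_truncate[OF f] integrable_truncate[OF f]]] by simp
  finally show "(\<lambda>n. LINT x|lborel. fourier_L1 (truncate f n) x * fourier ?g x) \<longlonglongrightarrow> of_real (2 * pi) * (LINT x|lborel. f (- x) * ?g x)" .
qed

text \<open>Fourier inversion. Tested against the indicator of an interval, the double transform is
  turned by the multiplication formula into the Parseval pairing already computed, and intervals
  separate L2 functions.\<close>

lemma fourier_fourier:
  assumes f: "f \<in> L2"
  shows "ae_eq (fourier (fourier f)) (\<lambda>x. of_real (2 * pi) * f (- x))"
proof -
  let ?r = "\<lambda>x. of_real (2 * pi) * f (- x)"
  have r: "?r \<in> L2" using f by auto
  have FF: "fourier (fourier f) \<in> L2" using f by auto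
  have "ae_eq (\<lambda>x. fourier (fourier f) x - ?r x) (\<lambda>x. 0)"
  proof (rule ae_zero_if_integrals_Icc_zero)
    show "(\<lambda>x. fourier (fourier f) x - ?r x) \<in> L2" using FF r by (rule L2_diff)
    fix a b :: real
    let ?g = "indicator {a..b} :: real \<Rightarrow> complex"
    have g: "?g \<in> L2" by auto
    have "(LINT x|lborel. (fourier (fourier f) x - ?r x) * ?g x) =
      (LINT x|lborel. fourier (fourier f) x * ?g x) - (LINT x|lborel. ?r x * ?g x)"
      unfolding left_diff_distrib using FF r g
      by (intro Bochner_Integration.integral_diff L2_mult_integrable)
    also have "(LINT x|lborel. fourier (fourier f) x * ?g x) = (LINT x|lborel. fourier f x * fourier ?g x)"
      using f g by (intro fourier_mult_formula) auto
    also have "\<dots> = (LINT x|lborel. ?r x * ?g x)"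
      using fourier_Parseval_indicator[OF f] by (simp add: mult.assoc)
    finally show "(LINT x|lborel. (fourier (fourier f) x - ?r x) * ?g x) = 0" by simp
  qed
  then show ?thesis by (simp add: ae_eq_def)
qed

lemma fourier_Parseval:
  assumes f: "f \<in> L2" and g: "g \<in> L2"
  shows "(LINT x|lborel. fourier f x * fourier g x) = of_real (2 * pi) * (LINT t|lborel. f (- t) * g t)"
proof -
  have "(LINT x|lborel. fourier f x * fourier g x) = (LINT x|lborel. fourier (fourier f) x * g x)"
    using f g by (intro fourier_mult_formula[symmetric]) auto
  also have "\<dots> = (LINT x|lborel. (of_real (2 * pi) * f (- x)) * g x)"
    using f g by (intro integral_mult_cong_ae fourier_fourier) auto
  finally show ?thesis by (simp add: mult.assoc)
qed

lemma l2sq_fourier: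
  assumes f: "f \<in> L2"
  shows "l2sq (fourier f) = ennreal (2 * pi) * l2sq f"
proof -
  let ?g = "\<lambda>x. cnj (f (- x))"
  have g: "?g \<in> L2" using f by auto
  have "of_real (LINT x|lborel. (norm (fourier f x))\<^sup>2) = (LINT x|lborel. fourier f x * cnj (fourier f x))"
    unfolding complex_norm_square[symmetric] by (simp flip: of_real_power)
  also have "\<dots> = (LINT x|lborel. fourier f x * fourier ?g x)"
    using f g by (intro integral_mult_cong_ae ae_eq_sym[OF fourier_cnj_uminus]) auto
  also have "\<dots> = of_real (2 * pi) * (LINT t|lborel. f (- t) * cnj (f (- t)))"
    by (rule fourier_Parseval[OF f g])
  also have "(LINT t|lborel. f (- t) * cnj (f (- t))) = (LINT t|lborel. f t * cnj (f t))"
    by (rule lborel_integral_uminus)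
  also have "\<dots> = of_real (LINT x|lborel. (norm (f x))\<^sup>2)"
    unfolding complex_norm_square[symmetric] by (simp flip: of_real_power)
  finally have "(LINT x|lborel. (norm (fourier f x))\<^sup>2) = 2 * pi * (LINT x|lborel. (norm (f x))\<^sup>2)"
    by (metis of_real_eq_iff of_real_mult)
  then show ?thesis
    using f by (simp add: l2sq_eq_integral L2_fourier ennreal_mult)
qed

lemma fourier_inject:
  assumes f: "f \<in> L2" and g: "g \<in> L2" and eq: "ae_eq (fourier f) (fourier g)"
  shows "ae_eq f g"
proof -
  have d: "(\<lambda>x. f x + (-1) * g x) \<in> L2" using f g by (intro L2_add L2_cmult)
  have "ae_eq (fourier (\<lambda>x. f x + (-1) * g x)) (\<lambda>x. fourier f x + fourier (\<lambda>x. (-1) * g x) x)"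
    using f g by (intro fourier_add L2_cmult)
  then have "ae_eq (fourier (\<lambda>x. f x + (-1) * g x)) (\<lambda>x. 0)"
    using fourier_cmult[OF g, of "-1"] eq unfolding ae_eq_def by eventually_elim simp
  then have "l2sq (fourier (\<lambda>x. f x + (-1) * g x)) = 0"
    using d by (subst l2sq_eq_0_iff) (auto dest: L2_borel)
  then have "l2sq (\<lambda>x. f x + (-1) * g x) = 0"
    using l2sq_fourier[OF d] by simp
  then have "ae_eq (\<lambda>x. f x + (-1) * g x) (\<lambda>x. 0)"
    using d by (subst (asm) l2sq_eq_0_iff) (auto dest: L2_borel)
  then show ?thesis unfolding ae_eq_def by (rule eventually_mono) simp
qed

lemma fourier_surj:
  assumes G: "G \<in> L2"
  shows "\<exists>f\<in>L2. ae_eq (fourier f) G"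
proof
  \<comment> \<open>The inverse transform of \<open>G\<close>, as prescribed by
    \<open>fourier_fourier\<close>.\<close>
  let ?f = "\<lambda>x. of_real (1 / (2 * pi)) * fourier G (- x)"
  show "?f \<in> L2" by (intro L2_cmult L2_uminus L2_fourier G)
  have FG: "fourier G \<in> L2" using G by auto
  have AE_uminus: "AE x in lborel. P (- x)" if "AE x in lborel. P x" for P :: "real \<Rightarrow> bool"
    using that by (subst (asm) lborel_distr_uminus[symmetric]) (auto simp: AE_distr_iff dest!: AE_distrD[rotated])
  have "AE x in lborel. fourier ?f x = of_real (1 / (2 * pi)) * fourier (\<lambda>x. fourier G (- x)) x"
    using fourier_cmult[OF L2_uminus[OF FG], of "of_real (1 / (2 * pi))"] unfolding ae_eq_def .
  moreover have "AE x in lborel. fourier (\<lambda>x. fourier G (- x)) x = fourier (fourier G) (- x)"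
    using fourier_uminus[OF FG] by (simp add: ae_eq_def)
  moreover have "AE x in lborel. fourier (fourier G) (- x) = of_real (2 * pi) * G x"
    using AE_uminus[OF fourier_fourier[OF G, unfolded ae_eq_def]] by simp
  ultimately show "ae_eq (fourier ?f) G"
    unfolding ae_eq_def by eventually_elim simp
qed

section \<open>Test functions\<close>

lemma test_function_iff:
  "test_function \<phi> \<longleftrightarrow> (\<forall>n x. (fun_deriv ^^ n) \<phi> differentiable at x) \<and> (\<exists>R. \<forall>x. \<bar>x\<bar> > R \<longrightarrow> \<phi> x = 0)"
proof -
  have "bounded {x. \<phi> x \<noteq> 0} \<longleftrightarrow> (\<exists>R. \<forall>x. \<bar>x\<bar> > R \<longrightarrow> \<phi> x = 0)"
    unfolding bounded_iff by (auto simp: not_le[symmetric])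
  then show ?thesis by (simp add: test_function_def)
qed

lemma test_function_has_deriv:
  assumes "test_function \<phi>"
  shows "(\<phi> has_vector_derivative fun_deriv \<phi> x) (at x)"
proof -
  have "(fun_deriv ^^ 0) \<phi> differentiable at x" using assms unfolding test_function_def by blast
  then show ?thesis by (simp add: fun_deriv_def vector_derivative_works)
qed

lemma fun_deriv_eqI:
  assumes "\<And>x. (\<phi> has_vector_derivative \<phi>' x) (at x)"
  shows "fun_deriv \<phi> = \<phi>'"
  using assms by (auto simp: fun_deriv_def vector_derivative_at)

lemma test_function_fun_deriv [intro]:
  assumes "test_function \<phi>"
  shows "test_function (fun_deriv \<phi>)"
  unfolding test_function_iff
proof
  show "\<forall>n x. (fun_deriv ^^ n) (fun_deriv \<phi>) differentiable at x"
  proof (intro allI)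
    fix n x
    have "(fun_deriv ^^ Suc n) \<phi> differentiable at x" using assms unfolding test_function_def by blast
    then show "(fun_deriv ^^ n) (fun_deriv \<phi>) differentiable at x" by (simp only: funpow_Suc_right o_apply)
  qed
  obtain R where R: "\<And>x. \<bar>x\<bar> > R \<Longrightarrow> \<phi> x = 0"
    using assms unfolding test_function_iff by blast
  have "fun_deriv \<phi> x = 0" if "\<bar>x\<bar> > R" for x
  proof -
    have "open {x::real. \<bar>x\<bar> > R}"
      by (intro open_Collect_less continuous_intros)
    then have "((\<lambda>_. 0) has_vector_derivative fun_deriv \<phi> x) (at x)"
      using R that by (intro has_vector_derivative_transform_within_open[OF test_function_has_deriv[OF assms]]) auto
    then show ?thesis using has_vector_derivative_const vector_derivative_unique_at by blast
  qed
  then show "\<exists>R. \<forall>x. \<bar>x\<bar> > R \<longrightarrow> fun_deriv \<phi> x = 0" by blast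
qed

lemma test_function_continuous:
  assumes "test_function \<phi>"
  shows "continuous_on A \<phi>"
  using test_function_has_deriv[OF assms] 
  by (intro continuous_at_imp_continuous_on) (auto intro: has_vector_derivative_continuous)

lemma test_function_borel [measurable_dest]: "test_function \<phi> \<Longrightarrow> \<phi> \<in> borel_measurable borel"
  by (intro borel_measurable_continuous_onI test_function_continuous)

lemma continuous_compact_support_L2:
  fixes \<phi> :: "real \<Rightarrow> complex"
  assumes cont: "continuous_on UNIV \<phi>" and R: "\<And>x. \<bar>x\<bar> > R \<Longrightarrow> \<phi> x = 0"
  shows "integrable lborel \<phi>" "\<phi> \<in> L2"
proof -
  have [measurable]: "\<phi> \<in> borel_measurable borel" using cont by (rule borel_measurable_continuous_onI)
  have "compact (\<phi> ` {-R..R})"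
    by (intro compact_continuous_image continuous_on_subset[OF cont]) auto
  then obtain C where C: "\<And>x. x \<in> {-R..R} \<Longrightarrow> norm (\<phi> x) \<le> C"
    by (metis compact_imp_bounded bounded_iff imageI)
  have *: "norm (\<phi> x) \<le> norm (of_real C * indicator {-R..R} x :: complex)" for x
  proof (cases "x \<in> {-R..R}")
    case True then show ?thesis using C[OF True] by simp
  next
    case False then show ?thesis using R[of x] by auto
  qed
  show "integrable lborel \<phi>"
    by (rule Bochner_Integration.integrable_bound[OF integrable_mult_right[OF integrable_indicator_Icc]])
       (use * in auto)
  show "\<phi> \<in> L2"
    by (rule L2_bound[OF L2_cmult[OF L2_indicator_Icc]]) (use * in auto)
qed

lemma test_function_L2 [intro]:
  assumes "test_function \<phi>"
  shows "integrable lborel \<phi>" "\<phi> \<in> L2"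
  using continuous_compact_support_L2[OF test_function_continuous[OF assms]] assms
  unfolding test_function_iff by blast+

lemma cis_has_vector_derivative:
  "((\<lambda>u. cis (- (x * u))) has_vector_derivative (- (\<i> * of_real x * cis (- (x * u))))) (at u)"
proof -
  have "((\<lambda>z. exp (- (\<i> * of_real x) * z)) has_field_derivative - (\<i> * of_real x) * exp (- (\<i> * of_real x) * of_real u)) (at (of_real u))"
    by (auto intro!: derivative_eq_intros)
  then have "((\<lambda>u. exp (- (\<i> * of_real x) * of_real u)) has_vector_derivative - (\<i> * of_real x) * exp (- (\<i> * of_real x) * of_real u)) (at u)"
    by (rule has_vector_derivative_real_field)
  then show ?thesis by (simp add: cis_conv_exp mult.assoc)
qed

text \<open>Integration by parts on an interval strictly larger than the supports of
  \<open>\<phi>\<close> and its derivative: the boundary terms vanish and nothing is cut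
  off.\<close>

lemma fourier_L1_fun_deriv:
  assumes "test_function \<phi>"
  shows "fourier_L1 (fun_deriv \<phi>) x = \<i> * of_real x * fourier_L1 \<phi> x"
proof -
  have \<phi>': "test_function (fun_deriv \<phi>)" using assms by auto
  obtain R0 where R0: "\<And>x. \<bar>x\<bar> > R0 \<Longrightarrow> \<phi> x = 0"
    using assms unfolding test_function_iff by blast
  obtain R1 where R1: "\<And>x. \<bar>x\<bar> > R1 \<Longrightarrow> fun_deriv \<phi> x = 0"
    using \<phi>' unfolding test_function_iff by blast
  define R where "R = max 1 (max (R0 + 1) (R1 + 1))"
  have R: "R > 0" "R > R0" "R > R1" by (auto simp: R_def)
  let ?F = "\<lambda>u. cis (- (x * u)) * \<phi> u"
  let ?f = "\<lambda>u. cis (- (x * u)) * fun_deriv \<phi> u + (- (\<i> * of_real x * cis (- (x * u)))) * \<phi> u"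
  have "(LINT u|lborel. indicator {-R..R} u *\<^sub>R ?f u) = ?F R - ?F (- R)"
  proof (rule integral_FTC_Icc)
    show "(?F has_vector_derivative ?f u) (at u within {-R..R})" for u
      by (rule has_vector_derivative_at_within)
         (intro has_vector_derivative_mult cis_has_vector_derivative test_function_has_deriv assms)
    show "continuous_on {- R..R} ?f"
      by (intro continuous_intros test_function_continuous assms \<phi>')
  qed (use R in auto)
  also have "\<dots> = 0" using R R0[of R] R0[of "-R"] by auto
  also have "(LINT u|lborel. indicator {-R..R} u *\<^sub>R ?f u) = (LINT u|lborel. ?f u)"
    using R R0 R1 by (intro Bochner_Integration.integral_cong) (auto simp: indicator_def)
  also have "\<dots> = fourier_L1 (fun_deriv \<phi>) x + (LINT u|lborel. - (\<i> * of_real x) * (cis (- (x * u)) * \<phi> u))"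
  proof -
    have "?f u = cis (- (x * u)) * fun_deriv \<phi> u + - (\<i> * of_real x) * (cis (- (x * u)) * \<phi> u)" for u
      by (simp add: mult.assoc)
    then show ?thesis
      using test_function_L2(1)[OF assms] test_function_L2(1)[OF \<phi>']
      by (simp only: fourier_L1_def[of "fun_deriv \<phi>"])
         (intro Bochner_Integration.integral_add integrable_mult_right integrable_cis_mult)
  qed
  also have "(LINT u|lborel. - (\<i> * of_real x) * (cis (- (x * u)) * \<phi> u)) = - (\<i> * of_real x) * fourier_L1 \<phi> x"
    unfolding fourier_L1_def by (rule integral_mult_right_zero)
  finally show ?thesis by (simp add: eq_neg_iff_add_eq_0)
qed

text \<open>The second conjunct strengthens the induction, whose step differentiates the n-th
  derivative by the chain rule.\<close>

lemma fun_deriv_funpow_affine: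
  assumes "test_function \<phi>"
  shows "(fun_deriv ^^ n) (\<lambda>u. \<phi> (c * u + d)) = (\<lambda>u. of_real c ^ n * (fun_deriv ^^ n) \<phi> (c * u + d)) \<and>
    test_function ((fun_deriv ^^ n) \<phi>)"
proof (induction n)
  case (Suc n)
  let ?\<psi> = "(fun_deriv ^^ n) \<phi>"
  have "fun_deriv (\<lambda>u. of_real c ^ n * ?\<psi> (c * u + d)) = (\<lambda>u. of_real c ^ n * (of_real c * fun_deriv ?\<psi> (c * u + d)))"
  proof (rule fun_deriv_eqI)
    fix u
    have "((?\<psi> \<circ> (\<lambda>u. c * u + d)) has_vector_derivative c *\<^sub>R fun_deriv ?\<psi> (c * u + d)) (at u)"
      by (intro vector_diff_chain_at) (use Suc in \<open>auto intro!: derivative_eq_intros test_function_has_deriv\<close>)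
    then have "((\<lambda>u. ?\<psi> (c * u + d)) has_vector_derivative of_real c * fun_deriv ?\<psi> (c * u + d)) (at u)"
      by (simp add: o_def scaleR_conv_of_real)
    then show "((\<lambda>u. of_real c ^ n * ?\<psi> (c * u + d)) has_vector_derivative of_real c ^ n * (of_real c * fun_deriv ?\<psi> (c * u + d))) (at u)"
      by (rule has_vector_derivative_mult_right)
  qed
  then show ?case using Suc by (auto simp: mult_ac)
qed (simp add: assms)

lemma test_function_affine:
  assumes "test_function \<phi>" "c \<noteq> 0"
  shows "test_function (\<lambda>u. \<phi> (c * u + d))"
  unfolding test_function_iff
proof
  have diff: "(\<lambda>u. (fun_deriv ^^ n) \<phi> (c * u + d)) differentiable at x" for n x
  proof -
    have "(fun_deriv ^^ n) \<phi> differentiable at (c * x + d)"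
      using assms unfolding test_function_def by blast
    then have "((fun_deriv ^^ n) \<phi> \<circ> (\<lambda>u. c * u + d)) differentiable at x"
      by (intro differentiable_chain_at) auto
    then show ?thesis by (simp add: o_def)
  qed
  then show "\<forall>n x. (fun_deriv ^^ n) (\<lambda>u. \<phi> (c * u + d)) differentiable at x"
    using fun_deriv_funpow_affine[OF assms(1)] by (auto intro!: derivative_intros)
  obtain R where R: "\<And>x. \<bar>x\<bar> > R \<Longrightarrow> \<phi> x = 0"
    using assms(1) unfolding test_function_iff by blast
  have "\<phi> (c * x + d) = 0" if "\<bar>x\<bar> > (\<bar>R\<bar> + \<bar>d\<bar>) / \<bar>c\<bar>" for x
  proof (rule R)
    have "\<bar>R\<bar> + \<bar>d\<bar> < \<bar>c * x\<bar>" using that assms(2) by (simp add: field_simps abs_mult)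
    then show "R < \<bar>c * x + d\<bar>" by linarith
  qed
  then show "\<exists>R. \<forall>x. \<bar>x\<bar> > R \<longrightarrow> \<phi> (c * x + d) = 0" by blast
qed

section \<open>A smooth function with compact support\<close>

definition bump_half :: "real poly \<Rightarrow> real \<Rightarrow> real" where
  "bump_half p x = (if x > 0 then poly p (1 / x) * exp (- (1 / x)) else 0)"

text \<open>The extra power of \<open>t\<close> carries the induction: removing the constant
  coefficient of the polynomial shifts one factor \<open>t\<close> into it.\<close>

lemma poly_times_exp_tendsto_0: "((\<lambda>t. t ^ k * poly p t * exp (- t)) \<longlongrightarrow> (0::real)) at_top"
proof (induction p arbitrary: k)
  case (pCons a p)
  have "((\<lambda>t. a * (t ^ k / exp t) + t ^ Suc k * poly p t * exp (- t)) \<longlongrightarrow> a * 0 + 0) at_top"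
    by (intro tendsto_intros tendsto_power_div_exp_0 pCons)
  then show ?case by (simp add: algebra_simps exp_minus divide_inverse)
qed simp

text \<open>The polynomial parameter makes the family closed under differentiation: for x > 0 the
  derivative has the factor x^(-2), which is \<open>[:0, 0, 1:]\<close> at 1/x, times p - p' at 1/x.
  At 0 the difference quotient tends to 0 from the right because the exponential beats every
  polynomial.\<close>

lemma bump_half_DERIV:
  "(bump_half p has_real_derivative bump_half ([:0, 0, 1:] * (p - pderiv p)) x) (at x)"
proof -
  consider "x > 0" | "x < 0" | "x = 0" by linarith
  then show ?thesis
  proof cases
    case 1
    have "((\<lambda>x. poly p (1 / x) * exp (- (1 / x))) has_real_derivative bump_half ([:0, 0, 1:] * (p - pderiv p)) x) (at x)"
      using 1 by (auto intro!: derivative_eq_intros poly_DERIV[THEN DERIV_chain2] 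
          simp: bump_half_def power2_eq_square divide_simps) (simp add: algebra_simps)
    then show ?thesis
      by (rule has_field_derivative_transform_within[OF _ 1]) (auto simp: bump_half_def dist_real_def)
  next
    case 2
    have "((\<lambda>x. 0) has_real_derivative 0) (at x)" by simp
    then have "(bump_half p has_real_derivative 0) (at x)"
      by (rule has_field_derivative_transform_within[where d = "- x"]) (use 2 in \<open>auto simp: bump_half_def dist_real_def\<close>)
    then show ?thesis using 2 by (simp add: bump_half_def)
  next
    case 3
    have "((\<lambda>h. (h ^ 1 * poly p h * exp (- h))) \<longlongrightarrow> 0) at_top" by (rule poly_times_exp_tendsto_0)
    then have "((\<lambda>h. (inverse h) ^ 1 * poly p (inverse h) * exp (- (inverse h))) \<longlongrightarrow> 0) (at_right 0)"
      by (rule filterlim_compose[OF _ filterlim_inverse_at_top_right])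
    then have "((\<lambda>h. bump_half p h / h) \<longlongrightarrow> 0) (at_right 0)"
      by (rule Lim_transform_eventually)
         (auto simp: eventually_at_filter bump_half_def divide_inverse mult_ac)
    moreover have "((\<lambda>h. bump_half p h / h) \<longlongrightarrow> 0) (at_left 0)"
      by (rule tendsto_eventually) (auto simp: eventually_at_filter bump_half_def)
    ultimately have "((\<lambda>h. bump_half p h / h) \<longlongrightarrow> 0) (at 0)"
      by (simp add: filterlim_split_at)
    then show ?thesis
      using 3 by (simp add: DERIV_def bump_half_def)
  qed
qed

text \<open>Finite sums are needed since the product rule creates two terms. Scalars can be absorbed
  into the polynomials, so sums of products already form a class closed under
  differentiation.\<close>

inductive_set bump_span :: "(real \<Rightarrow> real) set" where
  zero: "(\<lambda>x. 0) \<in> bump_span"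
| add: "f \<in> bump_span \<Longrightarrow> (\<lambda>x. bump_half p x * bump_half q (1 - x) + f x) \<in> bump_span"

lemma bump_span_DERIV:
  assumes "f \<in> bump_span"
  shows "\<exists>g\<in>bump_span. \<forall>x. (f has_real_derivative g x) (at x)"
  using assms
proof induction
  case zero
  show ?case by (rule bexI[OF _ bump_span.zero]) auto
next
  case (add f p q)
  then obtain g where g: "g \<in> bump_span" "\<And>x. (f has_real_derivative g x) (at x)" by blast
  let ?D = "\<lambda>p. [:0, 0, 1:] * (p - pderiv p)"
  \<comment> \<open>The sign from differentiating 1 - x is absorbed into the polynomial of the
    second factor.\<close>
  let ?g = "\<lambda>x. bump_half (?D p) x * bump_half q (1 - x) + (bump_half p x * bump_half (- ?D q) (1 - x) + g x)"
  have neg: "bump_half (- r) y = - bump_half r y" for r y by (simp add: bump_half_def)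
  have "((\<lambda>x. bump_half p x * bump_half q (1 - x) + f x) has_real_derivative ?g x) (at x)" for x
    unfolding neg
    by (rule derivative_eq_intros g(2) bump_half_DERIV bump_half_DERIV[THEN DERIV_chain2] refl)+ (simp del: mult_pCons_left)
  moreover have "?g \<in> bump_span" by (intro bump_span.add g)
  ultimately show ?case by (intro bexI[of _ ?g] allI)
qed

lemma bump_span_support: "f \<in> bump_span \<Longrightarrow> x \<le> 0 \<or> x \<ge> 1 \<Longrightarrow> f x = 0"
  by (induction rule: bump_span.induct) (auto simp: bump_half_def)

lemma bump_span_fun_deriv_funpow:
  assumes "f \<in> bump_span"
  shows "\<exists>g\<in>bump_span. (fun_deriv ^^ n) (\<lambda>x. of_real (f x)) = (\<lambda>x. of_real (g x))"
proof (induction n)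
  case (Suc n)
  then obtain g where g: "g \<in> bump_span" "(fun_deriv ^^ n) (\<lambda>x. of_real (f x)) = (\<lambda>x. of_real (g x))" by blast
  obtain h where h: "h \<in> bump_span" "\<And>x. (g has_real_derivative h x) (at x)"
    using bump_span_DERIV[OF g(1)] by blast
  have "fun_deriv (\<lambda>x. of_real (g x)) = (\<lambda>x. of_real (h x))"
    using h(2) by (intro fun_deriv_eqI has_vector_derivative_of_real) (auto simp: has_real_derivative_iff_has_vector_derivative)
  then show ?case using g h by auto
qed (use assms in auto)

lemma bump_span_test_function:
  assumes "f \<in> bump_span"
  shows "test_function (\<lambda>x. of_real (f x))"
  unfolding test_function_iff
proof
  show "\<forall>n x. (fun_deriv ^^ n) (\<lambda>x. of_real (f x)) differentiable at x"
  proof (intro allI)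
    fix n x
    obtain g where g: "g \<in> bump_span" "(fun_deriv ^^ n) (\<lambda>x. of_real (f x)) = (\<lambda>x. of_real (g x))"
      using bump_span_fun_deriv_funpow[OF assms] by blast
    obtain h where h: "(g has_real_derivative h x) (at x)"
      using bump_span_DERIV[OF g(1)] by blast
    have "((\<lambda>x. complex_of_real (g x)) has_vector_derivative of_real (h x)) (at x)"
      using h by (intro has_vector_derivative_of_real) (auto simp: has_real_derivative_iff_has_vector_derivative)
    then show "(fun_deriv ^^ n) (\<lambda>x. of_real (f x)) differentiable at x"
      unfolding g by (auto simp: has_vector_derivative_def differentiable_def)
  qed
  show "\<exists>R. \<forall>x. \<bar>x\<bar> > R \<longrightarrow> complex_of_real (f x) = 0"
  proof (intro exI[of _ 1] allI impI)
    fix x :: real assume "1 < \<bar>x\<bar>"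
    then have "x \<le> 0 \<or> x \<ge> 1" by linarith
    then show "complex_of_real (f x) = 0" using bump_span_support[OF assms] by simp
  qed
qed

text \<open>The transform at 0 is the integral, which is positive for a nonnegative bump that is
  positive on the open unit interval.\<close>

lemma test_function_exists: "\<exists>\<psi>. test_function \<psi> \<and> fourier_L1 \<psi> 0 \<noteq> 0"
proof -
  define f where "f x = bump_half 1 x * bump_half 1 (1 - x)" for x
  have "(\<lambda>x. bump_half 1 x * bump_half 1 (1 - x) + 0) \<in> bump_span"
    by (rule bump_span.add[OF bump_span.zero])
  then have f: "f \<in> bump_span" by (simp add: f_def[abs_def])
  let ?\<psi> = "\<lambda>x. complex_of_real (f x)"
  have \<psi>: "test_function ?\<psi>" by (rule bump_span_test_function[OF f])
  have int: "integrable lborel f" using test_function_L2(1)[OF \<psi>] by (simp add: complex_of_real_integrable_eq)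
  have nn: "f x \<ge> 0" for x by (simp add: f_def bump_half_def)
  have pos: "f x > 0" if "0 < x" "x < 1" for x using that by (simp add: f_def bump_half_def)
  have "(LINT x|lborel. f x) \<noteq> 0"
  proof
    assume "(LINT x|lborel. f x) = 0"
    then have "AE x in lborel. f x = 0"
      using int nn by (subst (asm) integral_nonneg_eq_0_iff_AE) auto
    then have "AE x in lborel. x \<notin> {0<..<1::real}"
      by (rule eventually_mono) (use pos in force)
    then have "emeasure lborel {x \<in> space lborel. \<not> (x \<notin> {0<..<1::real})} = 0"
      by (subst (asm) AE_iff_measurable[OF _ refl]) auto
    also have "{x \<in> space lborel. \<not> (x \<notin> {0<..<1::real})} = {0<..<1}" by auto
    finally show False by simp
  qed
  then have "fourier_L1 ?\<psi> 0 \<noteq> 0" by (simp add: fourier_L1_def)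
  with \<psi> show ?thesis by blast
qed

section \<open>Fourier multipliers and distributional derivatives\<close>

abbreviation cpoly :: "complex poly \<Rightarrow> real \<Rightarrow> complex" where
  "cpoly p x \<equiv> poly p (of_real x)"

lemma borel_measurable_cpoly [measurable (raw)]:
  "f \<in> borel_measurable M \<Longrightarrow> (\<lambda>x. cpoly p (f x)) \<in> borel_measurable M"
  by (rule measurable_compose[of f M borel "cpoly p" borel])
     (auto intro!: borel_measurable_continuous_onI continuous_intros)

lemma fourier_L1_test_function_times_x:
  assumes "test_function \<phi>"
  shows "of_real x * fourier_L1 \<phi> (- x) = \<i> * fourier_L1 (fun_deriv \<phi>) (- x)"
  using fourier_L1_fun_deriv[OF assms, of "- x"] by (simp add: mult.assoc[symmetric])

text \<open>Multiplication by x on the Fourier side is differentiation of \<open>\<phi>\<close> up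
  to a factor, and the derivative is again a test function. Hence the induction on the polynomial
  must leave \<open>\<phi>\<close> arbitrary.\<close>

lemma cpoly_fourier_L1_test_function:
  assumes "test_function \<phi>"
  shows "(\<lambda>x. cpoly p x * fourier_L1 \<phi> (- x)) \<in> L2"
    and "\<exists>C. \<forall>x. norm (cpoly p x * fourier_L1 \<phi> (- x)) \<le> C"
proof -
  have "(\<lambda>x. cpoly p x * fourier_L1 \<phi> (- x)) \<in> L2 \<and> (\<exists>C. \<forall>x. norm (cpoly p x * fourier_L1 \<phi> (- x)) \<le> C)"
    using assms
  proof (induction p arbitrary: \<phi>)
    case (pCons a p)
    let ?\<psi> = "fun_deriv \<phi>"
    have eq: "cpoly (pCons a p) x * fourier_L1 \<phi> (- x) = a * fourier_L1 \<phi> (- x) + \<i> * (cpoly p x * fourier_L1 ?\<psi> (- x))" for x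
    proof -
      have "cpoly (pCons a p) x * fourier_L1 \<phi> (- x) = a * fourier_L1 \<phi> (- x) + cpoly p x * (of_real x * fourier_L1 \<phi> (- x))"
        by (simp add: algebra_simps)
      then show ?thesis
        unfolding fourier_L1_test_function_times_x[OF pCons.prems] by (simp add: mult.left_commute)
    qed
    have IH: "(\<lambda>x. cpoly p x * fourier_L1 ?\<psi> (- x)) \<in> L2" "\<exists>C. \<forall>x. norm (cpoly p x * fourier_L1 ?\<psi> (- x)) \<le> C"
      using pCons.IH[of ?\<psi>] pCons.prems by auto
    obtain C where C: "\<And>x. norm (cpoly p x * fourier_L1 ?\<psi> (- x)) \<le> C" using IH(2) by blast
    have E: "(\<lambda>x. fourier_L1 \<phi> (- x)) \<in> L2"
      using pCons.prems by (intro L2_uminus L2_fourier_L1) auto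
    have "norm (cpoly (pCons a p) x * fourier_L1 \<phi> (- x)) \<le> norm a * (LINT u|lborel. norm (\<phi> u)) + C" for x
      unfolding eq using norm_fourier_L1_le[OF test_function_L2(1)[OF pCons.prems], of "- x"] C[of x]
      by (intro order_trans[OF norm_triangle_ineq] add_mono) (auto simp: norm_mult intro: mult_left_mono)
    moreover have "(\<lambda>x. cpoly (pCons a p) x * fourier_L1 \<phi> (- x)) \<in> L2"
      unfolding eq by (intro L2_add L2_cmult E IH)
    ultimately show ?case by blast
  qed (auto intro: exI[of _ 0])
  then show "(\<lambda>x. cpoly p x * fourier_L1 \<phi> (- x)) \<in> L2"
    and "\<exists>C. \<forall>x. norm (cpoly p x * fourier_L1 \<phi> (- x)) \<le> C" by blast+
qed

lemma fourier_L1_test_function_uminus_L2: "test_function \<phi> \<Longrightarrow> (\<lambda>x. fourier_L1 \<phi> (- x)) \<in> L2"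
  using cpoly_fourier_L1_test_function(1)[of \<phi> 1] by simp

text \<open>The pairing of \<open>\<phi>\<close> with the tempered distribution whose Fourier transform is \<open>p \<cdot> fourier f\<close>.\<close>

definition multiplier_pairing :: "complex poly \<Rightarrow> (real \<Rightarrow> complex) \<Rightarrow> distribution" where
  "multiplier_pairing p f \<phi> =
     (LINT x|lborel. fourier f x * (cpoly p x * fourier_L1 \<phi> (- x))) / of_real (2 * pi)"

lemma integrable_multiplier_pairing:
  assumes "f \<in> L2" "test_function \<phi>"
  shows "integrable lborel (\<lambda>x. fourier f x * (cpoly p x * fourier_L1 \<phi> (- x)))"
  using assms by (intro L2_mult_integrable cpoly_fourier_L1_test_function) auto

lemma regular_distribution_eq_multiplier_pairing:
  assumes f: "f \<in> L2" and \<phi>: "test_function \<phi>"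
  shows "regular_distribution f \<phi> = multiplier_pairing 1 f \<phi>"
proof -
  have \<phi>2: "\<phi> \<in> L2" "integrable lborel \<phi>" "fourier_L1 \<phi> \<in> L2" using \<phi> by (auto intro: L2_fourier_L1)
  have "of_real (2 * pi) * (LINT x|lborel. f x * \<phi> x) = of_real (2 * pi) * (LINT x|lborel. f (- x) * \<phi> (- x))"
    using lborel_integral_uminus[of "\<lambda>x. f x * \<phi> x"] by simp
  also have "\<dots> = (LINT x|lborel. fourier f x * fourier (\<lambda>x. \<phi> (- x)) x)"
    using f \<phi>2 by (intro fourier_Parseval[symmetric]) auto
  also have "\<dots> = (LINT x|lborel. fourier f x * fourier_L1 \<phi> (- x))"
  proof (rule integral_mult_cong_ae)
    have "ae_eq (fourier (\<lambda>x. \<phi> (- x))) (fourier_L1 (\<lambda>x. \<phi> (- x)))"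
      using \<phi>2 lborel_integrable_real_affine[OF \<phi>2(2), of "-1" 0] by (intro fourier_eq_fourier_L1) auto
    also have "fourier_L1 (\<lambda>x. \<phi> (- x)) = (\<lambda>x. fourier_L1 \<phi> (- x))"
      using lborel_integral_uminus[of "\<lambda>u. cis (_ * u) * \<phi> u"] by (simp add: fourier_L1_def fun_eq_iff)
    finally show "ae_eq (fourier (\<lambda>x. \<phi> (- x))) (\<lambda>x. fourier_L1 \<phi> (- x))" .
  qed (use f \<phi>2 in auto)
  finally show ?thesis by (simp add: regular_distribution_def multiplier_pairing_def field_simps)
qed

lemma multiplier_pairing_fun_deriv:
  assumes "f \<in> L2" "test_function \<phi>"
  shows "multiplier_pairing p f (fun_deriv \<phi>) = - multiplier_pairing ([:0, \<i>:] * p) f \<phi>"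
proof -
  have "fourier f x * (cpoly p x * fourier_L1 (fun_deriv \<phi>) (- x)) = - (fourier f x * (cpoly ([:0, \<i>:] * p) x * fourier_L1 \<phi> (- x)))" for x
    unfolding fourier_L1_fun_deriv[OF assms(2)] by (simp add: algebra_simps)
  then show ?thesis by (simp add: multiplier_pairing_def)
qed

lemma multiplier_pairing_add:
  assumes "f \<in> L2" "test_function \<phi>"
  shows "multiplier_pairing (p + q) f \<phi> = multiplier_pairing p f \<phi> + multiplier_pairing q f \<phi>"
  using integrable_multiplier_pairing[OF assms]
  by (simp add: multiplier_pairing_def distrib_left distrib_right add_divide_distrib)

lemma multiplier_pairing_smult:
  "multiplier_pairing (smult c p) f \<phi> = c * multiplier_pairing p f \<phi>"
  by (simp add: multiplier_pairing_def mult.left_commute[of _ c] mult.assoc)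

lemma distr_deriv_funpow:
  assumes f: "f \<in> L2" and \<phi>: "test_function \<phi>"
  shows "(distr_deriv ^^ k) (regular_distribution f) \<phi> = multiplier_pairing ([:0, \<i>:] ^ k) f \<phi>"
  using \<phi>
proof (induction k arbitrary: \<phi>)
  case 0
  then show ?case using f by (simp add: regular_distribution_eq_multiplier_pairing)
next
  case (Suc k)
  then have "(distr_deriv ^^ k) (regular_distribution f) (fun_deriv \<phi>) = multiplier_pairing ([:0, \<i>:] ^ k) f (fun_deriv \<phi>)"
    by auto
  then show ?case
    using f Suc.prems
    by (simp add: distr_deriv_def[of "(distr_deriv ^^ k) (regular_distribution f)"] multiplier_pairing_fun_deriv del: mult_pCons_left)
qed

text \<open>The operator with D replaced by multiplication by ix. It is left unexpanded, with
  explicit factors 1, so that its product with a power distributes into exactly the terms that the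
  recursion on \<open>s\<close> produces.\<close>

definition quad_symbol :: "real \<Rightarrow> real \<Rightarrow> complex poly" where
  "quad_symbol \<alpha> \<beta> = [:0, \<i>:] * ([:0, \<i>:] * 1) + (smult (- \<i> * of_real (\<alpha> + \<beta>)) ([:0, \<i>:] * 1) + smult (- of_real (\<alpha> * \<beta>)) 1)"

lemma cpoly_quad_symbol: "cpoly (quad_symbol \<alpha> \<beta>) x = - of_real ((x - \<alpha>) * (x - \<beta>))"
  by (simp add: quad_symbol_def algebra_simps flip: mult.assoc)

lemma diff_op_distr_eq:
  assumes f: "f \<in> L2" and \<phi>: "test_function \<phi>"
  shows "diff_op_distr \<alpha> \<beta> s f \<phi> = multiplier_pairing (quad_symbol \<alpha> \<beta> ^ s) f \<phi>"
  unfolding diff_op_distr_def using \<phi>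
proof (induction s arbitrary: \<phi>)
  case 0
  then show ?case using f by (simp add: regular_distribution_eq_multiplier_pairing)
next
  case (Suc s)
  let ?T = "(quadratic_distr_op \<alpha> \<beta> ^^ s) (regular_distribution f)" and ?q = "quad_symbol \<alpha> \<beta> ^ s"
  have \<phi>': "test_function (fun_deriv \<phi>)" "test_function (fun_deriv (fun_deriv \<phi>))"
    using Suc.prems by auto
  \<comment> \<open>Each distributional derivative contributes a sign, so the second-order term is
    unchanged and the first-order term changes sign.\<close>
  have quad: "quadratic_distr_op \<alpha> \<beta> T \<phi> = T (fun_deriv (fun_deriv \<phi>)) + \<i> * of_real (\<alpha> + \<beta>) * T (fun_deriv \<phi>)
     - of_real (\<alpha> * \<beta>) * T \<phi>" for T
    by (simp add: quadratic_distr_op_def distr_deriv_def)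
  have "(quadratic_distr_op \<alpha> \<beta> ^^ Suc s) (regular_distribution f) \<phi> =
    multiplier_pairing ?q f (fun_deriv (fun_deriv \<phi>)) + \<i> * of_real (\<alpha> + \<beta>) * multiplier_pairing ?q f (fun_deriv \<phi>)
     - of_real (\<alpha> * \<beta>) * multiplier_pairing ?q f \<phi>"
    using Suc.IH[OF Suc.prems] Suc.IH[OF \<phi>'(1)] Suc.IH[OF \<phi>'(2)]
    by (simp only: funpow.simps o_apply quad)
  also have "\<dots> = multiplier_pairing ([:0, \<i>:] * ([:0, \<i>:] * ?q)) f \<phi> + (multiplier_pairing (smult (- \<i> * of_real (\<alpha> + \<beta>)) ([:0, \<i>:] * ?q)) f \<phi>
     + multiplier_pairing (smult (- of_real (\<alpha> * \<beta>)) ?q) f \<phi>)"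
    unfolding multiplier_pairing_fun_deriv[OF f \<phi>'(1)] multiplier_pairing_fun_deriv[OF f Suc.prems] multiplier_pairing_smult
    by simp
  also have "\<dots> = multiplier_pairing ([:0, \<i>:] * ([:0, \<i>:] * ?q) + (smult (- \<i> * of_real (\<alpha> + \<beta>)) ([:0, \<i>:] * ?q) + smult (- of_real (\<alpha> * \<beta>)) ?q)) f \<phi>"
    unfolding multiplier_pairing_add[OF f Suc.prems] ..
  also have "[:0, \<i>:] * ([:0, \<i>:] * ?q) + (smult (- \<i> * of_real (\<alpha> + \<beta>)) ([:0, \<i>:] * ?q) + smult (- of_real (\<alpha> * \<beta>)) ?q) = quad_symbol \<alpha> \<beta> ^ Suc s"
    unfolding quad_symbol_def power_Suc distrib_right mult_smult_left mult.assoc mult_1_left ..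
  finally show ?case .
qed

lemma fourier_L1_zero_imp_ae_zero:
  assumes "f \<in> L2" "integrable lborel f" "\<And>x. fourier_L1 f x = 0"
  shows "ae_eq f (\<lambda>x. 0)"
proof -
  have "l2sq (fourier f) = 0"
    using fourier_eq_fourier_L1[OF assms(1,2)] assms by (subst l2sq_eq_0_iff) (auto simp: ae_eq_def)
  then have "l2sq f = 0" using l2sq_fourier[OF assms(1)] by simp
  then show ?thesis using assms(1) by (subst (asm) l2sq_eq_0_iff) auto
qed

text \<open>
  Translates of a fixed test function turn the hypothesis into the vanishing of the Fourier transform of
  \<open>(A p - B) \<cdot> fourier_L1 \<psi> (- x)\<close>, and dilating \<open>\<psi>\<close> makes this factor nonzero at any given point.
\<close>

lemma multiplier_eqI:
  assumes A: "A \<in> L2" and B: "B \<in> L2"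
    and eq: "\<And>\<phi>. test_function \<phi> \<Longrightarrow>
      (LINT x|lborel. A x * (cpoly p x * fourier_L1 \<phi> (- x))) = (LINT x|lborel. B x * fourier_L1 \<phi> (- x))"
  shows "AE x in lborel. A x * cpoly p x = B x"
proof -
  have [measurable]: "A \<in> borel_measurable borel" "B \<in> borel_measurable borel"
    using A B by (auto dest: L2_borel)
  obtain \<psi> where \<psi>: "test_function \<psi>" "fourier_L1 \<psi> 0 \<noteq> 0" using test_function_exists by blast
  have [measurable]: "\<psi> \<in> borel_measurable borel" using \<psi>(1) by (rule test_function_borel)
  define D where "D n u = \<psi> (real (Suc n) * u + 0)" for n u
  have D: "test_function (D n)" for n
    unfolding D_def[abs_def] by (rule test_function_affine[OF \<psi>(1)]) simp
  have D_fourier: "fourier_L1 (D n) (- x) = of_real (1 / real (Suc n)) * fourier_L1 \<psi> (- x / real (Suc n))" for n x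
  proof -
    have "fourier_L1 (D n) (- x) = \<bar>1 / real (Suc n)\<bar> *\<^sub>R (LINT u|lborel. cis (- (- x * (0 + 1 / real (Suc n) * u))) * D n (0 + 1 / real (Suc n) * u))"
      unfolding fourier_L1_def by (rule lborel_integral_real_affine) simp
    then show ?thesis unfolding D_def fourier_L1_def by (simp add: scaleR_conv_of_real del: of_nat_Suc)
  qed
  have zero: "AE x in lborel. (A x * cpoly p x - B x) * fourier_L1 (D n) (- x) = 0" for n
  proof -
    let ?E = "\<lambda>x. fourier_L1 (D n) (- x)"
    let ?H = "\<lambda>x. A x * (cpoly p x * ?E x) - B x * ?E x"
    have E: "?E \<in> L2" by (rule fourier_L1_test_function_uminus_L2[OF D])
    have pE: "(\<lambda>x. cpoly p x * ?E x) \<in> L2" by (rule cpoly_fourier_L1_test_function[OF D])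
    have L2_bounded: "(\<lambda>x. a x * k x) \<in> L2" if a: "a \<in> L2" and k: "k \<in> L2" and bk: "\<exists>C. \<forall>x. norm (k x) \<le> C" for a k
    proof -
      obtain C where C: "\<And>x. norm (k x) \<le> C" using bk by blast
      have C0: "0 \<le> C" using C[of 0] norm_ge_zero order_trans by blast
      show ?thesis
      proof (rule L2_bound[OF L2_cmult[OF a, of "of_real C"]])
        show "(\<lambda>x. a x * k x) \<in> borel_measurable borel"
          using a k by (intro borel_measurable_times L2_borel)
        show "AE x in lborel. norm (a x * k x) \<le> norm (of_real C * a x)"
          using C C0 by (intro AE_I2) (simp add: norm_mult mult.commute[of C] mult_left_mono)
      qed
    qed
    have bE: "\<exists>C. \<forall>x. norm (?E x) \<le> C"
      using norm_fourier_L1_le[OF test_function_L2(1)[OF D[of n]]] by blast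
    have H: "?H \<in> L2"
      by (intro L2_diff L2_bounded A B E pE bE cpoly_fourier_L1_test_function(2) D)
    have Hint: "integrable lborel ?H"
      by (intro Bochner_Integration.integrable_diff L2_mult_integrable A B E pE)
    have "fourier_L1 ?H t = 0" for t
    proof -
      let ?\<phi> = "\<lambda>u. D n (1 * u + t)"
      have \<phi>: "test_function ?\<phi>" by (rule test_function_affine[OF D]) simp
      have \<phi>E: "fourier_L1 ?\<phi> (- x) = cis (- (t * x)) * ?E x" for x
      proof -
        have "fourier_L1 ?\<phi> (- x) = \<bar>1\<bar> *\<^sub>R (LINT u|lborel. cis (- (- x * (- t + 1 * u))) * D n (1 * (- t + 1 * u) + t))"
          unfolding fourier_L1_def by (rule lborel_integral_real_affine) simp
        also have "\<dots> = (LINT u|lborel. cis (- (t * x)) * (cis (- (- x * u)) * D n u))"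
          unfolding mult.assoc[symmetric] cis_mult by (simp add: algebra_simps)
        finally show ?thesis by (simp add: fourier_L1_def)
      qed
      have "fourier_L1 ?H t = (LINT x|lborel. A x * (cpoly p x * fourier_L1 ?\<phi> (- x)) - B x * fourier_L1 ?\<phi> (- x))"
        unfolding fourier_L1_def[of ?H] \<phi>E
        by (intro Bochner_Integration.integral_cong) (simp_all add: algebra_simps)
      also have "\<dots> = 0"
        using eq[OF \<phi>] A B \<phi> 
        by (subst Bochner_Integration.integral_diff)
           (auto intro!: L2_mult_integrable cpoly_fourier_L1_test_function fourier_L1_test_function_uminus_L2)
      finally show ?thesis .
    qed
    then have "ae_eq ?H (\<lambda>x. 0)" by (rule fourier_L1_zero_imp_ae_zero[OF H Hint])
    then show ?thesis unfolding ae_eq_def by (rule eventually_mono) (simp add: algebra_simps)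
  qed
  have lim: "(\<lambda>n. fourier_L1 \<psi> (- x / real (Suc n))) \<longlonglongrightarrow> fourier_L1 \<psi> 0" for x
    unfolding fourier_L1_def
  proof (rule integral_dominated_convergence[where w="\<lambda>u. norm (\<psi> u)"])
    show "AE u in lborel. (\<lambda>n. cis (- (- x / real (Suc n) * u)) * \<psi> u) \<longlonglongrightarrow> cis (- (0 * u)) * \<psi> u"
    proof (rule AE_I2)
      fix u
      have "(\<lambda>n. cis (- (- x * inverse (real (Suc n)) * u)) * \<psi> u) \<longlonglongrightarrow> cis (- (- x * 0 * u)) * \<psi> u"
        by (intro tendsto_intros LIMSEQ_inverse_real_of_nat isCont_tendsto_compose[of _ cis] continuous_intros)
      then show "(\<lambda>n. cis (- (- x / real (Suc n) * u)) * \<psi> u) \<longlonglongrightarrow> cis (- (0 * u)) * \<psi> u"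
        by (simp add: divide_inverse del: of_nat_Suc)
    qed
  qed (use test_function_L2(1)[OF \<psi>(1)] in \<open>auto simp: norm_mult\<close>)
  have "AE x in lborel. \<forall>n. (A x * cpoly p x - B x) * fourier_L1 (D n) (- x) = 0"
    unfolding AE_all_countable using zero by blast
  then show ?thesis
  proof (rule eventually_mono)
    fix x assume *: "\<forall>n. (A x * cpoly p x - B x) * fourier_L1 (D n) (- x) = 0"
    have "\<forall>\<^sub>F n in sequentially. fourier_L1 \<psi> (- x / real (Suc n)) \<noteq> 0"
      by (rule tendsto_imp_eventually_ne[OF lim \<psi>(2)])
    then obtain n where "fourier_L1 \<psi> (- x / real (Suc n)) \<noteq> 0"
      using eventually_happens trivial_limit_sequentially by blast
    then have "fourier_L1 (D n) (- x) \<noteq> 0" unfolding D_fourier by (simp del: of_nat_Suc)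
    then show "A x * cpoly p x = B x" using * by auto
  qed
qed

text \<open>The bridge from distributions to functions: Sobolev membership and the action of the
  differential operator are both obtained from this equivalence.\<close>

lemma is_L2_function_multiplier_iff:
  assumes f: "f \<in> L2" and T: "\<And>\<phi>. test_function \<phi> \<Longrightarrow> T \<phi> = multiplier_pairing p f \<phi>"
  shows "is_L2_function T h \<longleftrightarrow> h \<in> L2 \<and> (AE x in lborel. fourier h x = cpoly p x * fourier f x)"
proof (cases "h \<in> L2")
  case h: True
  have F: "fourier f \<in> L2" "fourier h \<in> L2" using f h by auto
  have [measurable]: "fourier f \<in> borel_measurable borel" "fourier h \<in> borel_measurable borel"
    using F by (auto dest: L2_borel)
  have "is_L2_function T h \<longleftrightarrow> (\<forall>\<phi>. test_function \<phi> \<longrightarrow> multiplier_pairing p f \<phi> = multiplier_pairing 1 h \<phi>)"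
    using T h by (auto simp: is_L2_function_def regular_distribution_eq_multiplier_pairing)
  also have "\<dots> \<longleftrightarrow> (\<forall>\<phi>. test_function \<phi> \<longrightarrow>
      (LINT x|lborel. fourier f x * (cpoly p x * fourier_L1 \<phi> (- x))) = (LINT x|lborel. fourier h x * fourier_L1 \<phi> (- x)))"
    by (simp add: multiplier_pairing_def)
  also have "\<dots> \<longleftrightarrow> (AE x in lborel. fourier h x = cpoly p x * fourier f x)"
  proof
    assume "\<forall>\<phi>. test_function \<phi> \<longrightarrow>
      (LINT x|lborel. fourier f x * (cpoly p x * fourier_L1 \<phi> (- x))) = (LINT x|lborel. fourier h x * fourier_L1 \<phi> (- x))"
    then have "AE x in lborel. fourier f x * cpoly p x = fourier h x"
      by (intro multiplier_eqI F) blast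
    then show "AE x in lborel. fourier h x = cpoly p x * fourier f x"
      by (rule eventually_mono) (simp add: mult.commute)
  next
    assume *: "AE x in lborel. fourier h x = cpoly p x * fourier f x"
    show "\<forall>\<phi>. test_function \<phi> \<longrightarrow>
      (LINT x|lborel. fourier f x * (cpoly p x * fourier_L1 \<phi> (- x))) = (LINT x|lborel. fourier h x * fourier_L1 \<phi> (- x))"
    proof (intro allI impI)
      fix \<phi> assume "test_function \<phi>"
      then have [measurable]: "\<phi> \<in> borel_measurable borel" by (rule test_function_borel)
      show "(LINT x|lborel. fourier f x * (cpoly p x * fourier_L1 \<phi> (- x))) = (LINT x|lborel. fourier h x * fourier_L1 \<phi> (- x))"
        using * by (intro integral_cong_AE) (auto elim!: eventually_mono simp: mult_ac)
    qed
  qed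
  finally show ?thesis using h by simp
qed (simp add: is_L2_function_def)

lemma sobolev_iff:
  "f \<in> sobolev k \<longleftrightarrow> f \<in> L2 \<and> (\<lambda>x. of_real x ^ k * fourier f x) \<in> L2"
proof (cases "f \<in> L2")
  case f: True
  have [measurable]: "fourier f \<in> borel_measurable borel"
    using f by (auto dest: L2_borel)
  have iff: "is_L2_function ((distr_deriv ^^ k) (regular_distribution f)) h \<longleftrightarrow>
      h \<in> L2 \<and> (AE x in lborel. fourier h x = cpoly ([:0, \<i>:] ^ k) x * fourier f x)" for h
    by (rule is_L2_function_multiplier_iff[OF f distr_deriv_funpow[OF f]])
  then have iff': "is_L2_function ((distr_deriv ^^ k) (regular_distribution f)) =
      (\<lambda>h. h \<in> L2 \<and> (AE x in lborel. fourier h x = cpoly ([:0, \<i>:] ^ k) x * fourier f x))" by blast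
  have p: "cpoly ([:0, \<i>:] ^ k) x = \<i> ^ k * of_real x ^ k" for x
    by (simp add: power_mult_distrib mult.commute)
  have "f \<in> sobolev k \<longleftrightarrow> (\<exists>h. h \<in> L2 \<and> (AE x in lborel. fourier h x = \<i> ^ k * of_real x ^ k * fourier f x))"
    using f by (simp add: sobolev_def iff' p power_mult_distrib mult_ac)
  also have "\<dots> \<longleftrightarrow> (\<lambda>x. of_real x ^ k * fourier f x) \<in> L2"
  proof
    assume "\<exists>h. h \<in> L2 \<and> (AE x in lborel. fourier h x = \<i> ^ k * of_real x ^ k * fourier f x)"
    then obtain h where h: "h \<in> L2" "AE x in lborel. fourier h x = \<i> ^ k * of_real x ^ k * fourier f x" by blast
    show "(\<lambda>x. of_real x ^ k * fourier f x) \<in> L2"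
      using h(2) by (intro L2_bound[OF L2_fourier[OF h(1)]]) (auto simp: norm_mult norm_power elim!: eventually_mono)
  next
    assume "(\<lambda>x. of_real x ^ k * fourier f x) \<in> L2"
    then have "(\<lambda>x. \<i> ^ k * (of_real x ^ k * fourier f x)) \<in> L2" by auto
    from fourier_surj[OF this] show "\<exists>h. h \<in> L2 \<and> (AE x in lborel. fourier h x = \<i> ^ k * of_real x ^ k * fourier f x)"
      by (auto simp: ae_eq_def mult.assoc)
  qed
  finally show ?thesis using f by simp
qed (simp add: sobolev_def)

section \<open>Finitely supported measures and differences\<close>

text \<open>Only Borel sets are constrained, because the integral in \<open>cm_conv\<close> is
  evaluated for measurable integrands alone. Weights may vanish, so \<open>S\<close> can be larger
  than the set of atoms.\<close>

definition discrete_cm :: "cmeasure \<Rightarrow> real set \<Rightarrow> (real \<Rightarrow> complex) \<Rightarrow> bool" where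
  "discrete_cm \<mu> S w \<longleftrightarrow> finite S \<and> (\<forall>A\<in>sets borel. \<mu> A = (\<Sum>a\<in>S. w a * indicator A a))"

text \<open>The supremum is attained at the set of points of \<open>S\<close> in \<open>A\<close>
  with positive weight, a finite and therefore Borel set.\<close>

lemma upper_variation_discrete:
  assumes S: "finite S" and \<nu>: "\<And>A. A \<in> sets borel \<Longrightarrow> \<nu> A = (\<Sum>a\<in>S. w a * indicator A a)"
  shows "upper_variation \<nu> = distr (point_measure S (\<lambda>a. ennreal (max 0 (w a)))) borel (\<lambda>x. x)"
    (is "_ = ?M")
proof -
  have SUP: "(SUP B \<in> {B \<in> sets borel. B \<subseteq> A}. ennreal (\<nu> B)) = emeasure ?M A" if A: "A \<in> sets borel" for A
  proof -
    have M: "emeasure ?M A = (\<Sum>a\<in>S \<inter> A. ennreal (max 0 (w a)))"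
      using S A by (subst emeasure_distr)
        (auto simp: space_point_measure emeasure_point_measure_finite measurable_point_measure_eq1 Int_commute)
    show ?thesis
    proof (rule antisym)
      show "(SUP B \<in> {B \<in> sets borel. B \<subseteq> A}. ennreal (\<nu> B)) \<le> emeasure ?M A"
      proof (rule SUP_least)
        fix B assume B: "B \<in> {B \<in> sets borel. B \<subseteq> A}"
        have "\<nu> B = (\<Sum>a\<in>S. w a * indicator B a)" using \<nu> B by auto
        also have "\<dots> \<le> (\<Sum>a\<in>S. max 0 (w a) * indicator A a)"
          using B by (intro sum_mono) (auto simp: indicator_def)
        also have "\<dots> = (\<Sum>a\<in>S \<inter> A. max 0 (w a))"
          using S by (simp add: indicator_def sum.inter_restrict if_distrib cong: if_cong)
        finally have "ennreal (\<nu> B) \<le> ennreal (\<Sum>a\<in>S \<inter> A. max 0 (w a))" by (rule ennreal_leI)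
        then show "ennreal (\<nu> B) \<le> emeasure ?M A" unfolding M by (subst sum_ennreal) auto
      qed
      let ?B = "{a \<in> S \<inter> A. 0 < w a}"
      have B: "?B \<in> sets borel" using S by (intro borel_closed finite_imp_closed) simp
      have "emeasure ?M A = ennreal (\<Sum>a\<in>S \<inter> A. max 0 (w a))" unfolding M by (subst sum_ennreal) auto
      also have "(\<Sum>a\<in>S \<inter> A. max 0 (w a)) = \<nu> ?B"
        unfolding \<nu>[OF B] by (rule sum.mono_neutral_cong_left) (use S in \<open>auto simp: indicator_def max_def\<close>)
      finally have "emeasure ?M A = ennreal (\<nu> ?B)" .
      then show "emeasure ?M A \<le> (SUP B \<in> {B \<in> sets borel. B \<subseteq> A}. ennreal (\<nu> B))"
        using B by (auto intro!: SUP_upper)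
    qed
  qed
  have "upper_variation \<nu> = measure_of UNIV (sets borel) (emeasure ?M)"
    unfolding upper_variation_def using SUP
    by (intro measure_of_eq) (auto simp: sets.sigma_sets_eq[of "borel :: real measure", simplified])
  also have "\<dots> = ?M"
    using measure_of_of_measure[of ?M] by simp
  finally show ?thesis .
qed

lemma integral_upper_variation_discrete:
  fixes f :: "real \<Rightarrow> complex"
  assumes S: "finite S" and \<nu>: "\<And>A. A \<in> sets borel \<Longrightarrow> \<nu> A = (\<Sum>a\<in>S. w a * indicator A a)"
    and [measurable]: "f \<in> borel_measurable borel"
  shows "(LINT x|upper_variation \<nu>. f x) = (\<Sum>a\<in>S. of_real (max 0 (w a)) * f a)"
proof -
  have "(LINT x|upper_variation \<nu>. f x) = (LINT x|point_measure S (\<lambda>a. ennreal (max 0 (w a))). f x)"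
    by (subst upper_variation_discrete[of S \<nu> w, OF S \<nu>], assumption, subst integral_distr)
       (auto simp: measurable_point_measure_eq1)
  also have "\<dots> = (\<Sum>a\<in>S. of_real (max 0 (w a)) * f a)"
    using S by (simp only: lebesgue_integral_point_measure_finite scaleR_conv_of_real max.cobounded1)
  finally show ?thesis .
qed

text \<open>Each atom contributes the positive part of its weight minus the positive part of the
  negated weight; the four variation integrals reassemble the complex weight.\<close>

lemma cm_integral_discrete:
  assumes "discrete_cm \<mu> S w" and f: "f \<in> borel_measurable borel"
  shows "cm_integral \<mu> f = (\<Sum>a\<in>S. w a * f a)"
proof -
  have S: "finite S" and \<mu>: "\<And>A. A \<in> sets borel \<Longrightarrow> \<mu> A = (\<Sum>a\<in>S. w a * indicator A a)"
    using assms by (auto simp: discrete_cm_def)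
  have ind: "(indicator A a :: complex) = of_real (indicator A a)" for A and a :: real
    by (simp add: indicator_def)
  have Re: "Re (\<mu> A) = (\<Sum>a\<in>S. Re (w a) * indicator A a)" "Im (\<mu> A) = (\<Sum>a\<in>S. Im (w a) * indicator A a)"
    "- Re (\<mu> A) = (\<Sum>a\<in>S. - Re (w a) * indicator A a)" "- Im (\<mu> A) = (\<Sum>a\<in>S. - Im (w a) * indicator A a)"
    if "A \<in> sets borel" for A
    unfolding \<mu>[OF that] ind by (simp_all add: sum_negf)
  have max: "complex_of_real (max 0 r) - of_real (max 0 (- r)) = of_real r" for r
    by (auto simp: max_def)
  have I: "(LINT x|upper_variation (\<lambda>B. Re (\<mu> B)). f x) = (\<Sum>a\<in>S. of_real (max 0 (Re (w a))) * f a)"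
    "(LINT x|upper_variation (\<lambda>B. Im (\<mu> B)). f x) = (\<Sum>a\<in>S. of_real (max 0 (Im (w a))) * f a)"
    "(LINT x|upper_variation (\<lambda>B. - Re (\<mu> B)). f x) = (\<Sum>a\<in>S. of_real (max 0 (- Re (w a))) * f a)"
    "(LINT x|upper_variation (\<lambda>B. - Im (\<mu> B)). f x) = (\<Sum>a\<in>S. of_real (max 0 (- Im (w a))) * f a)"
    by (rule integral_upper_variation_discrete[OF S _ f], erule Re)+
  have "cm_integral \<mu> f =
    (\<Sum>a\<in>S. (of_real (max 0 (Re (w a))) - of_real (max 0 (- Re (w a)))) * f a
      + \<i> * ((of_real (max 0 (Im (w a))) - of_real (max 0 (- Im (w a)))) * f a))"
    unfolding cm_integral_def I
    by (simp add: sum.distrib sum_subtractf sum_distrib_left left_diff_distrib right_diff_distrib)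
  also have "\<dots> = (\<Sum>a\<in>S. w a * f a)"
  proof (intro sum.cong refl)
    fix a
    have "w a = of_real (Re (w a)) + \<i> * of_real (Im (w a))" by (rule complex_eq)
    then show "(of_real (max 0 (Re (w a))) - of_real (max 0 (- Re (w a)))) * f a
      + \<i> * ((of_real (max 0 (Im (w a))) - of_real (max 0 (- Im (w a)))) * f a) = w a * f a"
      unfolding max by (metis distrib_right mult.assoc)
  qed
  finally show ?thesis .
qed

text \<open>The points \<open>p i\<close> may coincide, for instance all three points of a
  difference with u = 0, so weights are collected over the fibres of \<open>p\<close>. The second
  conclusion is all that is later needed of the new weights.\<close>

lemma discrete_cm_indexed:
  assumes I: "finite I" and \<mu>: "\<And>A. A \<in> sets borel \<Longrightarrow> \<mu> A = (\<Sum>i\<in>I. w i * indicator A (p i))"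
  obtains S v where "discrete_cm \<mu> S v" "\<And>f :: real \<Rightarrow> complex. (\<Sum>a\<in>S. v a * f a) = (\<Sum>i\<in>I. w i * f (p i))"
proof
  let ?v = "\<lambda>a. \<Sum>i\<in>{i\<in>I. p i = a}. w i"
  show eq: "(\<Sum>a\<in>p ` I. ?v a * f a) = (\<Sum>i\<in>I. w i * f (p i))" for f :: "real \<Rightarrow> complex"
  proof -
    have "(\<Sum>a\<in>p ` I. ?v a * f a) = (\<Sum>a\<in>p ` I. \<Sum>i\<in>{i\<in>I. p i = a}. w i * f (p i))"
      by (intro sum.cong refl) (simp add: sum_distrib_right)
    also have "\<dots> = (\<Sum>i\<in>I. w i * f (p i))"
      using I by (intro sum.group) auto
    finally show ?thesis .
  qed
  show "discrete_cm \<mu> (p ` I) ?v"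
    unfolding discrete_cm_def using I \<mu> eq[of "indicator _"] by auto
qed

lemma cm_conv_fun_discrete:
  assumes "discrete_cm \<mu> S w" and [measurable]: "g \<in> borel_measurable borel"
  shows "cm_conv_fun \<mu> g = (\<lambda>x. \<Sum>a\<in>S. w a * g (x - a))"
  unfolding cm_conv_fun_def by (subst cm_integral_discrete[OF assms(1)]) auto

lemma discrete_cm_conv:
  assumes \<mu>: "discrete_cm \<mu> S w" and \<nu>: "discrete_cm \<nu> T v"
  obtains U z where "discrete_cm (cm_conv \<mu> \<nu>) U z"
    and "\<And>f :: real \<Rightarrow> complex. (\<Sum>c\<in>U. z c * f c) = (\<Sum>a\<in>S. w a * (\<Sum>b\<in>T. v b * f (a + b)))"
proof -
  have fin: "finite S" "finite T" using assms by (auto simp: discrete_cm_def)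
  let ?I = "S \<times> T"
  have "cm_conv \<mu> \<nu> A = (\<Sum>(a, b)\<in>?I. w a * v b * indicator A (a + b))" if A[measurable]: "A \<in> sets borel" for A
  proof -
    have "\<mu> {x. x + y \<in> A} = (\<Sum>a\<in>S. w a * indicator A (a + y))" for y
    proof -
      have "{x. x + y \<in> A} \<in> sets borel" by measurable
      then show ?thesis using \<mu> by (simp add: discrete_cm_def indicator_def)
    qed
    then have "cm_conv \<mu> \<nu> A = cm_integral \<nu> (\<lambda>y. \<Sum>a\<in>S. w a * indicator A (a + y))"
      by (simp add: cm_conv_def)
    also have "\<dots> = (\<Sum>b\<in>T. v b * (\<Sum>a\<in>S. w a * indicator A (a + b)))"
      by (rule cm_integral_discrete[OF \<nu>]) measurable
    also have "\<dots> = (\<Sum>a\<in>S. \<Sum>b\<in>T. w a * v b * indicator A (a + b))"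
      by (subst sum.swap) (simp add: sum_distrib_left mult_ac)
    finally show ?thesis by (simp add: sum.cartesian_product)
  qed
  then have "\<And>A. A \<in> sets borel \<Longrightarrow> cm_conv \<mu> \<nu> A = (\<Sum>i\<in>?I. (w (fst i) * v (snd i)) * indicator A (fst i + snd i))"
    by (simp add: case_prod_beta)
  then obtain U z where U: "discrete_cm (cm_conv \<mu> \<nu>) U z"
    and eq: "\<And>f :: real \<Rightarrow> complex. (\<Sum>a\<in>U. z a * f a) = (\<Sum>i\<in>?I. (w (fst i) * v (snd i)) * f (fst i + snd i))"
    using discrete_cm_indexed[of ?I "cm_conv \<mu> \<nu>" "\<lambda>i. w (fst i) * v (snd i)" "\<lambda>i. fst i + snd i"] fin by blast
  have "(\<Sum>c\<in>U. z c * f c) = (\<Sum>a\<in>S. w a * (\<Sum>b\<in>T. v b * f (a + b)))" for f :: "real \<Rightarrow> complex"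
    unfolding eq by (simp add: sum.cartesian_product' sum_distrib_left mult_ac)
  with U show ?thesis by (rule that)
qed

section \<open>Differences as operators on functions, and their symbols\<close>

definition diff_step :: "real \<Rightarrow> real \<Rightarrow> real \<Rightarrow> (real \<Rightarrow> complex) \<Rightarrow> real \<Rightarrow> complex" where
  "diff_step \<alpha> \<beta> u g x =
     (cis (u * ((\<alpha> - \<beta>) / 2)) + cis (- (u * ((\<alpha> - \<beta>) / 2)))) * g x
     + (- cis (u * ((\<alpha> + \<beta>) / 2)) * g (x - u) + - cis (- (u * ((\<alpha> + \<beta>) / 2))) * g (x - (- u)))"

lemma borel_measurable_diff_step [measurable]:
  assumes [measurable]: "g \<in> borel_measurable borel"
  shows "diff_step \<alpha> \<beta> u g \<in> borel_measurable borel"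
  unfolding diff_step_def[abs_def] by measurable

lemma discrete_cm_difference_measure:
  obtains S w where "discrete_cm (difference_measure \<alpha> \<beta> u) S w"
    "\<And>g x. (\<Sum>a\<in>S. w a * g (x - a)) = diff_step \<alpha> \<beta> u g x"
proof -
  define w where "w = (\<lambda>i::nat. if i = 0 then cis (u * ((\<alpha> - \<beta>) / 2)) + cis (- (u * ((\<alpha> - \<beta>) / 2)))
    else if i = 1 then - cis (u * ((\<alpha> + \<beta>) / 2)) else - cis (- (u * ((\<alpha> + \<beta>) / 2))))"
  define p where "p = (\<lambda>i::nat. if i = 0 then 0 else if i = 1 then u else - u)"
  have sum: "(\<Sum>i\<in>{0,1,2}. w i * f (p i)) = (cis (u * ((\<alpha> - \<beta>) / 2)) + cis (- (u * ((\<alpha> - \<beta>) / 2)))) * f 0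
     + (- cis (u * ((\<alpha> + \<beta>) / 2)) * f u + - cis (- (u * ((\<alpha> + \<beta>) / 2))) * f (- u))" for f :: "real \<Rightarrow> complex"
    by (simp add: w_def p_def)
  have "difference_measure \<alpha> \<beta> u A = (\<Sum>i\<in>{0,1,2}. w i * indicator A (p i))" for A
    unfolding sum by (simp add: difference_measure_def dirac_def)
  then obtain S v where S: "discrete_cm (difference_measure \<alpha> \<beta> u) S v"
    "\<And>f :: real \<Rightarrow> complex. (\<Sum>a\<in>S. v a * f a) = (\<Sum>i\<in>{0,1,2}. w i * f (p i))"
    using discrete_cm_indexed[of "{0,1,2::nat}" "difference_measure \<alpha> \<beta> u" w p] by blast
  have "(\<Sum>a\<in>S. v a * g (x - a)) = diff_step \<alpha> \<beta> u g x" for g x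
    unfolding S(2)[of "\<lambda>a. g (x - a)"] sum[of "\<lambda>a. g (x - a)"] diff_step_def by simp
  with S(1) show ?thesis by (rule that)
qed

text \<open>The induction carries the action of the discrete representation on every function at
  every point: convolving with one more factor composes these actions, and the actual atoms and
  weights never have to be computed.\<close>

lemma cm_conv_fun_difference_power:
  assumes g: "g \<in> borel_measurable borel"
  shows "cm_conv_fun (cm_power (difference_measure \<alpha> \<beta> u) s) g = (diff_step \<alpha> \<beta> u ^^ s) g"
proof -
  have "\<exists>S w. discrete_cm (cm_power (difference_measure \<alpha> \<beta> u) s) S w \<and>
    (\<forall>g x. (\<Sum>a\<in>S. w a * g (x - a)) = (diff_step \<alpha> \<beta> u ^^ s) g x)"
  proof (induction s)
    case 0
    have "discrete_cm (dirac 0) {0} (\<lambda>_. 1)" by (simp add: discrete_cm_def dirac_def)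
    then show ?case by (intro exI[of _ "{0}"] exI[of _ "\<lambda>_. 1"]) simp
  next
    case (Suc s)
    then obtain T v where T: "discrete_cm (cm_power (difference_measure \<alpha> \<beta> u) s) T v"
      "\<And>g x. (\<Sum>a\<in>T. v a * g (x - a)) = (diff_step \<alpha> \<beta> u ^^ s) g x" by blast
    obtain S w where S: "discrete_cm (difference_measure \<alpha> \<beta> u) S w"
      "\<And>g x. (\<Sum>a\<in>S. w a * g (x - a)) = diff_step \<alpha> \<beta> u g x"
      by (rule discrete_cm_difference_measure) blast
    obtain U z where U: "discrete_cm (cm_conv (difference_measure \<alpha> \<beta> u) (cm_power (difference_measure \<alpha> \<beta> u) s)) U z"
      "\<And>f :: real \<Rightarrow> complex. (\<Sum>c\<in>U. z c * f c) = (\<Sum>a\<in>S. w a * (\<Sum>b\<in>T. v b * f (a + b)))"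
      by (rule discrete_cm_conv[OF S(1) T(1)]) blast
    have "(\<Sum>c\<in>U. z c * g (x - c)) = (diff_step \<alpha> \<beta> u ^^ Suc s) g x" for g x
      unfolding U(2)[of "\<lambda>c. g (x - c)"] by (simp add: diff_diff_eq[symmetric] T(2) S(2))
    then show ?case using U(1) by auto
  qed
  then obtain S w where "discrete_cm (cm_power (difference_measure \<alpha> \<beta> u) s) S w"
    "\<And>g x. (\<Sum>a\<in>S. w a * g (x - a)) = (diff_step \<alpha> \<beta> u ^^ s) g x" by blast
  then show ?thesis using cm_conv_fun_discrete[OF _ g] by fastforce
qed

lemma L2_diff_step [intro]: "g \<in> L2 \<Longrightarrow> diff_step \<alpha> \<beta> u g \<in> L2"
  unfolding diff_step_def[abs_def] by (intro L2_add L2_cmult L2_shift)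

lemma L2_diff_step_funpow [intro]: "g \<in> L2 \<Longrightarrow> (diff_step \<alpha> \<beta> u ^^ s) g \<in> L2"
  by (induction s) auto

definition diff_symbol :: "real \<Rightarrow> real \<Rightarrow> real \<Rightarrow> real \<Rightarrow> real" where
  "diff_symbol \<alpha> \<beta> u x = 4 * sin (u * ((x - \<alpha>) / 2)) * sin (u * ((x - \<beta>) / 2))"

text \<open>Conjugate exponentials pair up to cosines, and 4 sin a sin b = 2 cos (a - b) - 2 cos (a
  + b).\<close>

lemma diff_symbol_cis:
  "(cis (u * ((\<alpha> - \<beta>) / 2)) + cis (- (u * ((\<alpha> - \<beta>) / 2))))
     + (- cis (u * ((\<alpha> + \<beta>) / 2)) * cis (- (u * x)) + - cis (- (u * ((\<alpha> + \<beta>) / 2))) * cis (- (- u * x)))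
   = of_real (diff_symbol \<alpha> \<beta> u x)"
proof -
  let ?a = "u * ((x - \<alpha>) / 2)" and ?b = "u * ((x - \<beta>) / 2)"
  have "diff_symbol \<alpha> \<beta> u x = 2 * cos (?a - ?b) - 2 * cos (?a + ?b)"
    by (simp add: diff_symbol_def cos_add cos_diff)
  also have "?a - ?b = - (u * ((\<alpha> - \<beta>) / 2))" by (simp add: field_simps)
  also have "?a + ?b = - (u * ((\<alpha> + \<beta>) / 2) + - (u * x))" by (simp add: field_simps)
  finally have eq: "diff_symbol \<alpha> \<beta> u x = 2 * cos (u * ((\<alpha> - \<beta>) / 2)) - 2 * cos (u * ((\<alpha> + \<beta>) / 2) + - (u * x))"
    by (simp only: cos_minus)
  have two: "cis t + cis (- t) = of_real (2 * cos t)" for t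
    by (simp add: complex_eq_iff)
  have "(- cis (u * ((\<alpha> + \<beta>) / 2)) * cis (- (u * x)) + - cis (- (u * ((\<alpha> + \<beta>) / 2))) * cis (- (- u * x)))
    = - (cis (u * ((\<alpha> + \<beta>) / 2) + - (u * x)) + cis (- (u * ((\<alpha> + \<beta>) / 2) + - (u * x))))"
    by (simp add: cis_mult)
  then show ?thesis unfolding eq two by simp
qed

lemma fourier_diff_step:
  assumes g: "g \<in> L2"
  shows "ae_eq (fourier (diff_step \<alpha> \<beta> u g)) (\<lambda>x. of_real (diff_symbol \<alpha> \<beta> u x) * fourier g x)"
proof -
  define A B C where "A = cis (u * ((\<alpha> - \<beta>) / 2)) + cis (- (u * ((\<alpha> - \<beta>) / 2)))"
    and "B = - cis (u * ((\<alpha> + \<beta>) / 2))" and "C = - cis (- (u * ((\<alpha> + \<beta>) / 2)))"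
  let ?a = "\<lambda>x. A * g x" and ?b = "\<lambda>x. B * g (x - u)" and ?c = "\<lambda>x. C * g (x - (- u))"
  have L: "?a \<in> L2" "?b \<in> L2" "?c \<in> L2" using g by (intro L2_cmult L2_shift; simp)+
  have s: "(\<lambda>x. g (x - u)) \<in> L2" "(\<lambda>x. g (x - (- u))) \<in> L2" using g by (intro L2_shift; simp)+
  have "AE x in lborel. fourier (\<lambda>x. ?a x + (?b x + ?c x)) x = fourier ?a x + fourier (\<lambda>x. ?b x + ?c x) x"
    using fourier_add[OF L(1) L2_add[OF L(2,3)]] by (simp add: ae_eq_def)
  moreover have "AE x in lborel. fourier (\<lambda>x. ?b x + ?c x) x = fourier ?b x + fourier ?c x"
    using fourier_add[OF L(2,3)] by (simp add: ae_eq_def)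
  moreover have "AE x in lborel. fourier ?a x = A * fourier g x"
    using fourier_cmult[OF g] by (simp add: ae_eq_def)
  moreover have "AE x in lborel. fourier ?b x = B * fourier (\<lambda>x. g (x - u)) x"
    using fourier_cmult[OF s(1)] by (simp add: ae_eq_def)
  moreover have "AE x in lborel. fourier ?c x = C * fourier (\<lambda>x. g (x - (- u))) x"
    using fourier_cmult[OF s(2)] unfolding ae_eq_def .
  moreover have "AE x in lborel. fourier (\<lambda>x. g (x - u)) x = cis (- (u * x)) * fourier g x"
    using fourier_shift[OF g] by (simp add: ae_eq_def)
  moreover have "AE x in lborel. fourier (\<lambda>x. g (x - (- u))) x = cis (- (- u * x)) * fourier g x"
    using fourier_shift[OF g] unfolding ae_eq_def .
  ultimately have "AE x in lborel. fourier (\<lambda>x. ?a x + (?b x + ?c x)) x = of_real (diff_symbol \<alpha> \<beta> u x) * fourier g x"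
  proof eventually_elim
    case (elim x)
    have "fourier (\<lambda>x. ?a x + (?b x + ?c x)) x = (A + (B * cis (- (u * x)) + C * cis (- (- u * x)))) * fourier g x"
      unfolding elim by (simp only: distrib_right mult.assoc)
    then show ?case unfolding A_def B_def C_def diff_symbol_cis .
  qed
  then show ?thesis by (simp add: ae_eq_def diff_step_def[abs_def] A_def B_def C_def)
qed

lemma fourier_diff_step_funpow:
  assumes g: "g \<in> L2"
  shows "ae_eq (fourier ((diff_step \<alpha> \<beta> u ^^ s) g)) (\<lambda>x. of_real (diff_symbol \<alpha> \<beta> u x) ^ s * fourier g x)"
proof (induction s)
  case (Suc s)
  have "ae_eq (fourier (diff_step \<alpha> \<beta> u ((diff_step \<alpha> \<beta> u ^^ s) g))) (\<lambda>x. of_real (diff_symbol \<alpha> \<beta> u x) * fourier ((diff_step \<alpha> \<beta> u ^^ s) g) x)"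
    using g by (intro fourier_diff_step) auto
  with Suc show ?case
    unfolding ae_eq_def by eventually_elim simp
qed simp

section \<open>Negative powers of the sine function\<close>

text \<open>\<open>powr\<close> takes the value 0 at 0. The value infinity there keeps
  \<open>inverse_sum_le_prod\<close> true when a summand vanishes.\<close>

definition inv_powr :: "real \<Rightarrow> real \<Rightarrow> ennreal" where
  "inv_powr q x = (if x = 0 then \<infinity> else ennreal (\<bar>x\<bar> powr - q))"

lemma borel_measurable_inv_powr [measurable]: "inv_powr q \<in> borel_measurable borel"
  unfolding inv_powr_def by measurable

lemma inv_powr_minus [simp]: "inv_powr q (- x) = inv_powr q x"
  by (simp add: inv_powr_def)

lemma inv_powr_mono:
  assumes "c > 0" "q \<ge> 0" "c * \<bar>y\<bar> \<le> \<bar>x\<bar>"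
  shows "inv_powr q x \<le> ennreal (c powr - q) * inv_powr q y"
proof (cases "y = 0")
  case True then show ?thesis using assms by (simp add: inv_powr_def ennreal_mult_top)
next
  case False
  then have "0 < c * \<bar>y\<bar>" using assms by simp
  then have "x \<noteq> 0" using assms by auto
  have "\<bar>x\<bar> powr - q \<le> (c * \<bar>y\<bar>) powr - q"
    using assms \<open>0 < c * \<bar>y\<bar>\<close> by (intro powr_mono2') auto
  also have "\<dots> = c powr - q * \<bar>y\<bar> powr - q" using assms by (simp add: powr_mult)
  finally show ?thesis
    using False \<open>x \<noteq> 0\<close> by (simp add: inv_powr_def flip: ennreal_mult)
qed

lemma nn_integral_inv_powr_finite:
  assumes q: "0 \<le> q" "q < 1" and R: "0 \<le> R"
  shows "(\<integral>\<^sup>+ x. inv_powr q x * indicator {-R..R} x \<partial>lborel) < \<infinity>"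
proof -
  have half: "(\<integral>\<^sup>+ x. inv_powr q x * indicator {0..R} x \<partial>lborel) < \<infinity>"
  proof -
    have "((\<lambda>x. x powr - q) has_integral (R powr (- q + 1) / (- q + 1))) {0..R}"
      using q R by (intro has_integral_powr_from_0) auto
    then have "((\<lambda>x. if x \<in> {0..R} then x powr - q else 0) has_integral (R powr (- q + 1) / (- q + 1))) UNIV"
      by (simp only: has_integral_restrict_UNIV)
    then have "(\<integral>\<^sup>+ x. ennreal (if x \<in> {0..R} then x powr - q else 0) \<partial>lborel) = ennreal (R powr (- q + 1) / (- q + 1))"
      by (intro nn_integral_has_integral_lborel) auto
    also have "(\<integral>\<^sup>+ x. ennreal (if x \<in> {0..R} then x powr - q else 0) \<partial>lborel) = (\<integral>\<^sup>+ x. inv_powr q x * indicator {0..R} x \<partial>lborel)"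
      \<comment> \<open>Within the interval the integrands differ only at 0, where
        \<open>powr\<close> is 0 and \<open>inv_powr\<close> is infinite.\<close>
      by (intro nn_integral_cong_AE eventually_mono[OF AE_lborel_singleton[of 0]]) (auto simp: inv_powr_def indicator_def)
    finally show ?thesis by simp
  qed
  have "(\<integral>\<^sup>+ x. inv_powr q x * indicator {-R..R} x \<partial>lborel) \<le>
      (\<integral>\<^sup>+ x. inv_powr q x * indicator {0..R} x + inv_powr q x * indicator {-R..0} x \<partial>lborel)"
    by (intro nn_integral_mono) (auto simp: indicator_def)
  also have "\<dots> = (\<integral>\<^sup>+ x. inv_powr q x * indicator {0..R} x \<partial>lborel) + (\<integral>\<^sup>+ x. inv_powr q x * indicator {-R..0} x \<partial>lborel)"
    by (rule nn_integral_add) measurable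
  also have "(\<integral>\<^sup>+ x. inv_powr q x * indicator {-R..0} x \<partial>lborel) = (\<integral>\<^sup>+ x. inv_powr q (- x) * indicator {-R..0} (- x) \<partial>lborel)"
    using nn_integral_real_affine[of "\<lambda>x. inv_powr q x * indicator {-R..0} x" "-1" 0] by simp
  also have "\<dots> = (\<integral>\<^sup>+ x. inv_powr q x * indicator {0..R} x \<partial>lborel)"
    by (intro nn_integral_cong) (auto simp: indicator_def)
  finally show ?thesis
    by (rule le_less_trans) (use half in \<open>auto simp: less_top[symmetric]\<close>)
qed

text \<open>Up to pi/3 the cosine is at least 1/2 and the mean value theorem applies; beyond, the
  sine is at least 1/2 while \<theta>/4 is at most pi/8 < 1/2. The constant 1/4 is crude but
  sufficient.\<close>

lemma sin_ge_quarter: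
  assumes "0 \<le> \<theta>" "\<theta> \<le> pi / 2"
  shows "\<theta> / 4 \<le> sin \<theta>"
proof (cases "\<theta> \<le> pi / 3")
  case True
  show ?thesis
  proof (cases "\<theta> = 0")
    case False
    then have "0 < \<theta>" using assms by simp
    then obtain z where z: "0 < z" "z < \<theta>" "sin \<theta> - sin 0 = (\<theta> - 0) * cos z"
      using MVT2[of 0 \<theta> sin cos] by auto
    have "cos (pi / 3) \<le> cos z" using z True pi_gt_zero by (intro cos_monotone_0_pi_le) auto
    then have "1/2 \<le> cos z" by (simp add: cos_60)
    then have "\<theta> * (1/2) \<le> \<theta> * cos z" using assms by (intro mult_left_mono) auto
    then show ?thesis using z assms by simp
  qed simp
next
  case False
  have "sin (pi / 3) \<le> sin \<theta>" using False assms by (intro sin_monotone_2pi_le) auto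
  moreover have "1 \<le> sqrt (3::real)" by simp
  ultimately have "1/2 \<le> sin \<theta>" unfolding sin_60 by linarith
  then show ?thesis using assms pi_less_4 by linarith
qed

lemma abs_sin_ge_quarter: "\<bar>\<theta>\<bar> \<le> pi / 2 \<Longrightarrow> 1/4 * \<bar>\<theta>\<bar> \<le> \<bar>sin \<theta>\<bar>"
  using sin_ge_quarter[of "\<bar>\<theta>\<bar>"] by (cases "\<theta> \<ge> 0") auto

text \<open>The sine vanishes at both ends of the interval; the sum of the linear bounds from either
  end dominates throughout.\<close>

lemma nn_integral_inv_powr_sin_finite:
  assumes q: "0 \<le> q" "q < 1"
  shows "(\<integral>\<^sup>+ x. inv_powr q (sin x) * indicator {0..pi} x \<partial>lborel) < \<infinity>"
proof -
  let ?c = "ennreal ((1/4) powr - q)"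
  have *: "inv_powr q (sin x) \<le> ?c * inv_powr q x + ?c * inv_powr q (pi - x)" if "x \<in> {0..pi}" for x
  proof (cases "x \<le> pi / 2")
    case True
    then have "inv_powr q (sin x) \<le> ?c * inv_powr q x"
      using that q by (intro inv_powr_mono abs_sin_ge_quarter) auto
    then show ?thesis by (simp add: add_increasing2)
  next
    case False
    then have "inv_powr q (sin (pi - x)) \<le> ?c * inv_powr q (pi - x)"
      using that q by (intro inv_powr_mono abs_sin_ge_quarter) auto
    then show ?thesis by (simp add: add_increasing)
  qed
  have "(\<integral>\<^sup>+ x. inv_powr q (sin x) * indicator {0..pi} x \<partial>lborel) \<le>
    (\<integral>\<^sup>+ x. ?c * (inv_powr q x * indicator {-pi..pi} x) + ?c * (inv_powr q (pi - x) * indicator {-pi..pi} (pi - x)) \<partial>lborel)"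
    using * by (intro nn_integral_mono) (auto simp: indicator_def)
  also have "\<dots> = ?c * (\<integral>\<^sup>+ x. inv_powr q x * indicator {-pi..pi} x \<partial>lborel)
    + ?c * (\<integral>\<^sup>+ x. inv_powr q (pi - x) * indicator {-pi..pi} (pi - x) \<partial>lborel)"
    by (subst nn_integral_add) (auto simp: nn_integral_cmult)
  also have "(\<integral>\<^sup>+ x. inv_powr q (pi - x) * indicator {-pi..pi} (pi - x) \<partial>lborel) = (\<integral>\<^sup>+ x. inv_powr q x * indicator {-pi..pi} x \<partial>lborel)"
    using nn_integral_real_affine[of "\<lambda>x. inv_powr q x * indicator {-pi..pi} x" "-1" pi] by simp
  finally show ?thesis
    using nn_integral_inv_powr_finite[OF q, of pi] by (auto simp: ennreal_mult_less_top intro: le_less_trans)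
qed

lemma abs_sin_add_npi: "\<bar>sin (x + real n * pi)\<bar> = \<bar>sin x\<bar>"
proof (induction n)
  case (Suc n)
  have "sin (x + real (Suc n) * pi) = sin ((x + real n * pi) + pi)" by (simp add: algebra_simps)
  also have "\<dots> = - sin (x + real n * pi)" by (rule sin_periodic_pi)
  finally show ?case using Suc by simp
qed simp

lemma inv_powr_sin_periodic: "inv_powr q (sin (x + real k * pi - real n * pi)) = inv_powr q (sin x)"
proof -
  have "\<bar>sin (x + real k * pi - real n * pi)\<bar> = \<bar>sin (x + real k * pi - real n * pi + real n * pi)\<bar>"
    by (rule abs_sin_add_npi[symmetric])
  then have "\<bar>sin (x + real k * pi - real n * pi)\<bar> = \<bar>sin x\<bar>" by (simp add: abs_sin_add_npi)
  then show ?thesis unfolding inv_powr_def by (metis abs_eq_0)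
qed

lemma nn_integral_inv_powr_sin_periods:
  "(\<integral>\<^sup>+ x. inv_powr q (sin x) * indicator {- real n * pi..real n * pi} x \<partial>lborel) \<le>
    of_nat (2 * n) * (\<integral>\<^sup>+ x. inv_powr q (sin x) * indicator {0..pi} x \<partial>lborel)"
proof -
  let ?S = "\<integral>\<^sup>+ x. inv_powr q (sin x) * indicator {0..pi} x \<partial>lborel"
  let ?t = "\<lambda>k. real k * pi - real n * pi"
  have shift: "(\<integral>\<^sup>+ x. inv_powr q (sin x) * indicator {?t k..?t k + pi} x \<partial>lborel) = ?S" for k
  proof -
    have "(\<integral>\<^sup>+ x. inv_powr q (sin x) * indicator {?t k..?t k + pi} x \<partial>lborel) =
      (\<integral>\<^sup>+ x. inv_powr q (sin (?t k + 1 * x)) * indicator {?t k..?t k + pi} (?t k + 1 * x) \<partial>lborel)"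
      using nn_integral_real_affine[of "\<lambda>x. inv_powr q (sin x) * indicator {?t k..?t k + pi} x" 1 "?t k"] by simp
    also have "\<dots> = ?S"
    proof (intro nn_integral_cong)
      fix x
      have "?t k + 1 * x = x + real k * pi - real n * pi" by simp
      then show "inv_powr q (sin (?t k + 1 * x)) * indicator {?t k..?t k + pi} (?t k + 1 * x) = inv_powr q (sin x) * indicator {0..pi} x"
        by (simp only: inv_powr_sin_periodic) (simp add: indicator_def)
    qed
    finally show ?thesis .
  qed
  have "(\<integral>\<^sup>+ x. inv_powr q (sin x) * indicator {- real n * pi..?t k} x \<partial>lborel) \<le> of_nat k * ?S" for k
  proof (induction k)
    case 0
    have "(\<integral>\<^sup>+ x. inv_powr q (sin x) * indicator {- real n * pi..?t 0} x \<partial>lborel) = (\<integral>\<^sup>+ (x::real). 0 \<partial>lborel)"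
      by (intro nn_integral_cong_AE eventually_mono[OF AE_lborel_singleton[of "- real n * pi"]]) (auto simp: indicator_def)
    then show ?case by simp
  next
    case (Suc k)
    have "(\<integral>\<^sup>+ x. inv_powr q (sin x) * indicator {- real n * pi..?t (Suc k)} x \<partial>lborel) \<le>
      (\<integral>\<^sup>+ x. inv_powr q (sin x) * indicator {- real n * pi..?t k} x + inv_powr q (sin x) * indicator {?t k..?t k + pi} x \<partial>lborel)"
      by (intro nn_integral_mono) (auto simp: indicator_def algebra_simps)
    also have "\<dots> = (\<integral>\<^sup>+ x. inv_powr q (sin x) * indicator {- real n * pi..?t k} x \<partial>lborel) + ?S"
      unfolding shift[of k, symmetric] by (rule nn_integral_add) measurable
    also have "\<dots> \<le> of_nat k * ?S + ?S" using Suc by (intro add_right_mono)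
    finally show ?case by (simp add: distrib_right add.commute)
  qed
  moreover have "?t (2 * n) = real n * pi" by (simp add: algebra_simps)
  ultimately show ?thesis by metis
qed

text \<open>For small \<open>a\<close> the argument stays where the sine is comparable to the
  identity, which gives \<open>\<bar>a\<bar> powr - q\<close>. Otherwise the interval covers a
  number of periods of the absolute sine proportional to \<open>\<bar>a\<bar>\<close>, and this
  factor cancels against the change of variables.\<close>

lemma nn_integral_inv_powr_sin_scaled:
  assumes q: "0 \<le> q" "q < 1" and N: "N > 0"
  shows "\<exists>C>0. \<forall>a. a \<noteq> 0 \<longrightarrow>
    (\<integral>\<^sup>+ u. inv_powr q (sin (u * a)) * indicator {-N..N} u \<partial>lborel) \<le> ennreal (C * (1 + \<bar>a\<bar> powr - q))"
proof -
  let ?S = "\<integral>\<^sup>+ x. inv_powr q (sin x) * indicator {0..pi} x \<partial>lborel"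
  let ?L = "\<integral>\<^sup>+ x. inv_powr q x * indicator {-N..N} x \<partial>lborel"
  obtain S where S: "?S = ennreal S" "S \<ge> 0"
    using nn_integral_inv_powr_sin_finite[OF q] by (cases ?S) auto
  obtain L where L: "?L = ennreal L" "L \<ge> 0"
    using nn_integral_inv_powr_finite[OF q, of N] N by (cases ?L) auto
  \<comment> \<open>\<open>6 * N / pi * S\<close> bounds 2n periods with integral \<open>S\<close>
    each, where n is at most \<open>3 * N * \<bar>a\<bar> / pi\<close>, after division by
    \<open>\<bar>a\<bar>\<close>. The leading 1 makes \<open>C\<close> positive.\<close>
  define C where "C = 1 + (1/4) powr - q * L + 6 * N / pi * S"
  have C0: "0 \<le> (1/4) powr - q * L" "0 \<le> 6 * N / pi * S" using S L N by auto
  then have C: "(1/4) powr - q * L \<le> C" "6 * N / pi * S \<le> C" "C > 0" unfolding C_def by linarith+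
  have "(\<integral>\<^sup>+ u. inv_powr q (sin (u * a)) * indicator {-N..N} u \<partial>lborel) \<le> ennreal (C * (1 + \<bar>a\<bar> powr - q))"
    if a: "a \<noteq> 0" for a
  proof (cases "N * \<bar>a\<bar> \<le> pi / 2")
    case True
    have *: "inv_powr q (sin (u * a)) \<le> ennreal ((1/4 * \<bar>a\<bar>) powr - q) * inv_powr q u" if u: "u \<in> {-N..N}" for u
    proof (rule inv_powr_mono)
      have "\<bar>u * a\<bar> \<le> N * \<bar>a\<bar>" using u by (auto simp: abs_mult intro!: mult_right_mono)
      then show "1/4 * \<bar>a\<bar> * \<bar>u\<bar> \<le> \<bar>sin (u * a)\<bar>"
        using abs_sin_ge_quarter[of "u * a"] True by (simp add: abs_mult mult_ac)
    qed (use a q in auto)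
    have "(\<integral>\<^sup>+ u. inv_powr q (sin (u * a)) * indicator {-N..N} u \<partial>lborel) \<le>
      (\<integral>\<^sup>+ u. ennreal ((1/4 * \<bar>a\<bar>) powr - q) * (inv_powr q u * indicator {-N..N} u) \<partial>lborel)"
      using * by (intro nn_integral_mono) (auto simp: indicator_def)
    also have "\<dots> = ennreal ((1/4 * \<bar>a\<bar>) powr - q) * ennreal L"
      by (subst nn_integral_cmult) (auto simp: L)
    also have "\<dots> = ennreal (((1/4) powr - q * L) * \<bar>a\<bar> powr - q)"
      using L by (subst powr_mult) (auto simp: mult_ac simp flip: ennreal_mult)
    also have "\<dots> \<le> ennreal (C * (1 + \<bar>a\<bar> powr - q))"
      using C C0 by (intro ennreal_leI mult_mono) auto
    finally show ?thesis .
  next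
    case False
    define n where "n = nat \<lceil>N * \<bar>a\<bar> / pi\<rceil>"
    have n: "N * \<bar>a\<bar> \<le> real n * pi"
    proof -
      have "N * \<bar>a\<bar> / pi \<le> real n" unfolding n_def by linarith
      then show ?thesis by (simp add: field_simps)
    qed
    \<comment> \<open>In this case \<open>N * \<bar>a\<bar> / pi\<close> exceeds 1/2, so the 1 lost
      in rounding up is at most twice that quantity.\<close>
    have n2: "real n \<le> 3 * (N * \<bar>a\<bar> / pi)"
    proof -
      have "1/2 < N * \<bar>a\<bar> / pi" using False by (simp add: field_simps)
      moreover have "real n \<le> N * \<bar>a\<bar> / pi + 1" unfolding n_def using N by (simp add: of_nat_nat)
      ultimately show ?thesis by linarith
    qed
    have ind: "indicator {-N..N} u \<le> (indicator {- real n * pi..real n * pi} (u * a) :: ennreal)" for u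
    proof -
      have "- real n * pi \<le> u * a \<and> u * a \<le> real n * pi" if "u \<in> {-N..N}"
      proof -
        have "\<bar>u * a\<bar> \<le> N * \<bar>a\<bar>" using that by (auto simp: abs_mult intro!: mult_right_mono)
        then show ?thesis using n by linarith
      qed
      then show ?thesis by (auto simp: indicator_def)
    qed
    let ?G = "\<lambda>x. inv_powr q (sin x) * indicator {- real n * pi..real n * pi} x"
    have "ennreal \<bar>a\<bar> * (\<integral>\<^sup>+ u. ?G (0 + a * u) \<partial>lborel) = (\<integral>\<^sup>+ x. ?G x \<partial>lborel)"
      by (rule nn_integral_real_affine[symmetric]) (use a in auto)
    also have "\<dots> \<le> of_nat (2 * n) * ?S" by (rule nn_integral_inv_powr_sin_periods)
    also have "\<dots> = ennreal (real (2 * n) * S)" unfolding S(1) using S(2) by (simp add: ennreal_of_nat_eq_real_of_nat flip: ennreal_mult)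
    also have "\<dots> \<le> ennreal (\<bar>a\<bar> * (6 * N / pi * S))"
    proof (rule ennreal_leI)
      have "real (2 * n) * S \<le> (6 * (N * \<bar>a\<bar> / pi)) * S" using n2 S by (intro mult_right_mono) auto
      then show "real (2 * n) * S \<le> \<bar>a\<bar> * (6 * N / pi * S)" by (simp add: mult_ac)
    qed
    also have "\<dots> = ennreal \<bar>a\<bar> * ennreal (6 * N / pi * S)" by (intro ennreal_mult) (use C0 in auto)
    finally have "(\<integral>\<^sup>+ u. ?G (0 + a * u) \<partial>lborel) \<le> ennreal (6 * N / pi * S)"
      using a by (subst (asm) ennreal_mult_le_mult_iff) auto
    moreover have "(\<integral>\<^sup>+ u. inv_powr q (sin (u * a)) * indicator {-N..N} u \<partial>lborel) \<le> (\<integral>\<^sup>+ u. ?G (0 + a * u) \<partial>lborel)"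
      using ind by (intro nn_integral_mono) (auto simp: mult.commute[of a] intro!: mult_left_mono)
    moreover have "ennreal (6 * N / pi * S) \<le> ennreal (C * (1 + \<bar>a\<bar> powr - q))"
      using C C0 by (intro ennreal_leI) (simp add: algebra_simps add_increasing2)
    ultimately show ?thesis by (meson order_trans)
  qed
  then show ?thesis using C(3) by blast
qed

section \<open>Pointwise bounds that separate the steps and the two sines\<close>

text \<open>Each summand is at most the total \<open>?Y\<close>, so replacing \<open>?Y\<close> by
  \<open>y j\<close> in a negative power increases it; \<open>inverse ?Y\<close> is a product of
  \<open>card I\<close> equal such powers. If a summand vanishes, the right side is infinite because
  no factor of it is 0.\<close>

lemma inverse_sum_le_prod:
  fixes y :: "'a \<Rightarrow> real"
  assumes I: "finite I" "I \<noteq> {}" and y: "\<And>j. j \<in> I \<Longrightarrow> y j \<ge> 0"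
  shows "inverse (ennreal (\<Sum>j\<in>I. y j)) \<le> (\<Prod>j\<in>I. inv_powr (1 / real (card I)) (y j))"
proof (cases "\<exists>j\<in>I. y j = 0")
  case True
  then obtain j where j: "j \<in> I" "y j = 0" by blast
  have pos: "0 < (\<Prod>j\<in>J. inv_powr (1 / real (card I)) (y j))" if "finite J" for J
    using that by (induction J) (auto simp: ennreal_zero_less_mult_iff inv_powr_def)
  have "(\<Prod>j\<in>I. inv_powr (1 / real (card I)) (y j)) = inv_powr (1 / real (card I)) (y j) * (\<Prod>j\<in>I - {j}. inv_powr (1 / real (card I)) (y j))"
    using I j by (intro prod.remove)
  also have "\<dots> = \<top>"
    using pos[of "I - {j}"] I j by (simp add: inv_powr_def ennreal_top_mult)
  finally show ?thesis by simp
next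
  case False
  then have pos: "y j > 0" if "j \<in> I" for j using y that by (auto simp: less_le)
  let ?Y = "\<Sum>j\<in>I. y j" and ?m = "real (card I)"
  have m: "?m > 0" using I by (simp add: card_gt_0_iff)
  have Y: "?Y > 0" using I pos by (intro sum_pos) auto
  have "inverse ?Y = (?Y powr - (1 / ?m)) ^ card I"
    using Y m by (simp add: powr_minus powr_powr inverse_powr flip: powr_realpow)
  also have "\<dots> = (\<Prod>j\<in>I. ?Y powr - (1 / ?m))" by simp
  also have "\<dots> \<le> (\<Prod>j\<in>I. y j powr - (1 / ?m))"
    using I pos y by (intro prod_mono) (auto intro!: powr_mono2' member_le_sum)
  finally have "ennreal (inverse ?Y) \<le> ennreal (\<Prod>j\<in>I. y j powr - (1 / ?m))" by (rule ennreal_leI)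
  also have "\<dots> = (\<Prod>j\<in>I. ennreal (y j powr - (1 / ?m)))" by (simp add: prod_ennreal)
  also have "\<dots> = (\<Prod>j\<in>I. inv_powr (1 / ?m) (y j))"
    using pos by (intro prod.cong) (auto simp: inv_powr_def less_le)
  finally show ?thesis using Y by (simp add: inverse_ennreal)
qed

text \<open>With X = (|a| / |sin (v a)|)^(q/2) and Y likewise for b, the inequality XY \<le> X^2 +
  Y^2 separates the sines. Normalising by the frequencies keeps the two terms balanced when a is
  much smaller than b: integrated over a bounded range of v, the first term is of order 1 +
  |a|^q.\<close>

lemma inv_powr_diff_symbol_le:
  assumes s: "s \<ge> 1" and q: "q = 4 * real s / real m" and m: "m > 0"
    and ab: "a \<noteq> 0" "b \<noteq> 0"
  shows "inv_powr (1 / real m) ((4 * sin (v * a) * sin (v * b)) ^ (2 * s)) \<le>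
    ennreal (\<bar>a * b\<bar> powr - (q / 2)) * (ennreal (\<bar>a\<bar> powr q) * inv_powr q (sin (v * a)) + ennreal (\<bar>b\<bar> powr q) * inv_powr q (sin (v * b)))"
proof (cases "sin (v * a) = 0 \<or> sin (v * b) = 0")
  case True
  then have top: "ennreal (\<bar>a\<bar> powr q) * inv_powr q (sin (v * a)) + ennreal (\<bar>b\<bar> powr q) * inv_powr q (sin (v * b)) = \<top>"
    using ab by (auto simp: inv_powr_def ennreal_mult_top)
  show ?thesis unfolding top using ab by (simp add: ennreal_mult_top)
next
  case False
  let ?A = "\<bar>sin (v * a)\<bar>" and ?B = "\<bar>sin (v * b)\<bar>"
  have pos: "?A > 0" "?B > 0" "\<bar>a\<bar> > 0" "\<bar>b\<bar> > 0" using False ab by auto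
  have q0: "q > 0" using s m q by simp
  have "\<bar>(4 * sin (v * a) * sin (v * b)) ^ (2 * s)\<bar> powr - (1 / real m) = (4 * ?A * ?B) powr (- (q / 2))"
  proof -
    have "\<bar>(4 * sin (v * a) * sin (v * b)) ^ (2 * s)\<bar> = (4 * ?A * ?B) powr real (2 * s)"
      using pos powr_realpow[of "4 * ?A * ?B" "2 * s"] by (simp only: power_abs abs_mult) simp
    then show ?thesis using pos m by (simp add: powr_powr q)
  qed
  \<comment> \<open>The factor 4 may be dropped, as it is at least 1 and the exponent is
    negative.\<close>
  also have "\<dots> \<le> (?A * ?B) powr (- (q / 2))"
    using pos q0 by (intro powr_mono2') auto
  also have "\<dots> = (\<bar>a\<bar> * \<bar>b\<bar>) powr - (q / 2) * ((\<bar>a\<bar> / ?A) powr (q / 2) * (\<bar>b\<bar> / ?B) powr (q / 2))"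
    using pos by (simp add: powr_mult powr_divide powr_minus field_simps)
  also have "\<dots> \<le> (\<bar>a\<bar> * \<bar>b\<bar>) powr - (q / 2) * (((\<bar>a\<bar> / ?A) powr (q / 2))\<^sup>2 + ((\<bar>b\<bar> / ?B) powr (q / 2))\<^sup>2)"
  proof (intro mult_left_mono)
    have *: "X * Y \<le> X\<^sup>2 + Y\<^sup>2" if "0 \<le> X" "0 \<le> Y" for X Y :: real
    proof -
      have "0 \<le> (X - Y)\<^sup>2" "0 \<le> X * Y" using that by auto
      then show ?thesis unfolding power2_diff mult.assoc by linarith
    qed
    show "(\<bar>a\<bar> / ?A) powr (q / 2) * (\<bar>b\<bar> / ?B) powr (q / 2) \<le> ((\<bar>a\<bar> / ?A) powr (q / 2))\<^sup>2 + ((\<bar>b\<bar> / ?B) powr (q / 2))\<^sup>2"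
      by (intro *) auto
  qed auto
  also have "((\<bar>a\<bar> / ?A) powr (q / 2))\<^sup>2 = \<bar>a\<bar> powr q * ?A powr - q"
    using pos by (simp add: power2_eq_square powr_add[symmetric] powr_divide powr_minus field_simps)
  also have "((\<bar>b\<bar> / ?B) powr (q / 2))\<^sup>2 = \<bar>b\<bar> powr q * ?B powr - q"
    using pos by (simp add: power2_eq_square powr_add[symmetric] powr_divide powr_minus field_simps)
  finally have "ennreal (\<bar>(4 * sin (v * a) * sin (v * b)) ^ (2 * s)\<bar> powr - (1 / real m)) \<le>
     ennreal (\<bar>a * b\<bar> powr - (q / 2) * (\<bar>a\<bar> powr q * ?A powr - q + \<bar>b\<bar> powr q * ?B powr - q))"
    unfolding abs_mult[symmetric, of a b] by (rule ennreal_leI)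
  also have "\<dots> = ennreal (\<bar>a * b\<bar> powr - (q / 2)) * (ennreal (\<bar>a\<bar> powr q) * ennreal (?A powr - q) + ennreal (\<bar>b\<bar> powr q) * ennreal (?B powr - q))"
    by (simp add: ennreal_mult ennreal_plus)
  finally show ?thesis using False by (simp add: inv_powr_def)
qed

text \<open>When a - b is fixed, a^2 + b^2 equals d^2 + 2ab, so the sum of squares is large only if
  the product is. This excludes that one frequency is large while the other is near 0.\<close>

lemma power_bound_sum_squares:
  fixes a b d :: real
  assumes "d = a - b"
  shows "(1 + a\<^sup>2 + b\<^sup>2) ^ k \<le> (2 * (2 + d\<^sup>2)) ^ k * (1 + \<bar>a * b\<bar> ^ k)"
proof -
  have "a\<^sup>2 + b\<^sup>2 = d\<^sup>2 + 2 * (a * b)" by (simp add: assms power2_eq_square algebra_simps)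
  also have "\<dots> \<le> d\<^sup>2 + 2 * \<bar>a * b\<bar>" by simp
  finally have "a\<^sup>2 + b\<^sup>2 \<le> d\<^sup>2 + 2 * \<bar>a * b\<bar>" .
  then have "1 + a\<^sup>2 + b\<^sup>2 \<le> (2 + d\<^sup>2) * (1 + \<bar>a * b\<bar>)"
  proof -
    have "0 \<le> \<bar>a * b\<bar> * d\<^sup>2" by simp
    moreover have "(2 + d\<^sup>2) * (1 + \<bar>a * b\<bar>) = 2 + d\<^sup>2 + 2 * \<bar>a * b\<bar> + \<bar>a * b\<bar> * d\<^sup>2"
      by (simp add: algebra_simps)
    ultimately show ?thesis using \<open>a\<^sup>2 + b\<^sup>2 \<le> d\<^sup>2 + 2 * \<bar>a * b\<bar>\<close> by linarith
  qed
  also have "\<dots> \<le> (2 + d\<^sup>2) * (2 * max 1 \<bar>a * b\<bar>)"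
    by (intro mult_left_mono) auto
  finally have "(1 + a\<^sup>2 + b\<^sup>2) ^ k \<le> ((2 + d\<^sup>2) * (2 * max 1 \<bar>a * b\<bar>)) ^ k"
    by (intro power_mono) auto
  also have "\<dots> = (2 * (2 + d\<^sup>2)) ^ k * max 1 \<bar>a * b\<bar> ^ k"
  proof -
    have "(2 + d\<^sup>2) * (2 * max 1 \<bar>a * b\<bar>) = (2 * (2 + d\<^sup>2)) * max 1 \<bar>a * b\<bar>" by simp
    then show ?thesis by (simp only: power_mult_distrib[of "2 * (2 + d\<^sup>2)"])
  qed
  also have "\<dots> \<le> (2 * (2 + d\<^sup>2)) ^ k * (1 + \<bar>a * b\<bar> ^ k)"
    by (intro mult_left_mono) (auto simp: max_def add_increasing)
  finally show ?thesis .
qed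

section \<open>Solving for the differences\<close>

abbreviation (input) quad_weight :: "real \<Rightarrow> real \<Rightarrow> nat \<Rightarrow> real \<Rightarrow> real" where
  "quad_weight \<alpha> \<beta> s x \<equiv> (x - \<alpha>) ^ (2 * s) * (x - \<beta>) ^ (2 * s)"

lemma quad_weight_nonneg: "quad_weight \<alpha> \<beta> s x \<ge> 0"
  by simp

lemma borel_measurable_diff_symbol [measurable (raw)]:
  assumes [measurable]: "f \<in> borel_measurable M" "g \<in> borel_measurable M"
  shows "(\<lambda>x. diff_symbol \<alpha> \<beta> (f x) (g x)) \<in> borel_measurable M"
  unfolding diff_symbol_def by measurable

lemma ennreal_mult_add:
  assumes "0 \<le> c" "0 \<le> a" "0 \<le> b" "0 \<le> a'" "0 \<le> b'"
  shows "ennreal c * (ennreal a * ennreal b + ennreal a' * ennreal b') = ennreal (c * (a * b + a' * b'))"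
  using assms by (simp add: ennreal_mult ennreal_plus)

text \<open>The separated bound integrates to a multiple of |ab|^(-q/2) (1 + a^2 + b^2)^(q/2). Its
  m-th power has the integer exponent 2s, and \<open>power_bound_sum_squares\<close> reduces it to 1
  + |ab|^(-2s).\<close>

lemma nn_integral_diff_symbol_power_le:
  assumes s: "s \<ge> 1" and m: "m = 4 * s + 1" and N: "N > 0"
  shows "\<exists>C\<ge>0. \<forall>x. x \<noteq> \<alpha> \<longrightarrow> x \<noteq> \<beta> \<longrightarrow>
    (\<integral>\<^sup>+ v. inv_powr (1 / real m) (diff_symbol \<alpha> \<beta> v x ^ (2 * s)) * indicator {-N..N} v \<partial>lborel) ^ m
      \<le> ennreal (C * (1 + 1 / quad_weight \<alpha> \<beta> s x))"
proof -
  \<comment> \<open>\<open>q / 2\<close> is the exponent of each sine in the m-th root of the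
    inverse squared symbol, and \<open>q\<close> the one after separation; \<open>4 * s + 1\<close>
    is the least \<open>m\<close> with \<open>q < 1\<close>.\<close>
  define q where "q = 4 * real s / real m"
  have q: "0 \<le> q" "q < 1" "q > 0" using s m by (auto simp: q_def field_simps)
  obtain C0 where C0: "C0 > 0" "\<And>a. a \<noteq> 0 \<Longrightarrow>
    (\<integral>\<^sup>+ u. inv_powr q (sin (u * a)) * indicator {-N..N} u \<partial>lborel) \<le> ennreal (C0 * (1 + \<bar>a\<bar> powr - q))"
    using nn_integral_inv_powr_sin_scaled[OF q(1,2) N] by blast
  define d where "d = (\<beta> - \<alpha>) / 2"
  \<comment> \<open>The factor 4 bounds
    \<open>2 + \<bar>a\<bar> powr q + \<bar>b\<bar> powr q\<close> by a multiple of
    \<open>Z powr (q / 2)\<close>; the second factor comes from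
    \<open>power_bound_sum_squares\<close>. The \<open>16 ^ s\<close> in the claim arises from ab =
    (x - \<alpha>)(x - \<beta>)/4.\<close>
  define K where "K = (4 * C0) ^ m * (2 * (2 + d\<^sup>2)) ^ (2 * s)"
  have K: "K \<ge> 0" using C0 by (simp add: K_def)
  have "(\<integral>\<^sup>+ v. inv_powr (1 / real m) (diff_symbol \<alpha> \<beta> v x ^ (2 * s)) * indicator {-N..N} v \<partial>lborel) ^ m
      \<le> ennreal (K * 16 ^ s * (1 + 1 / quad_weight \<alpha> \<beta> s x))" (is "?J ^ m \<le> _")
    if x: "x \<noteq> \<alpha>" "x \<noteq> \<beta>" for x
  proof -
    define a b where "a = (x - \<alpha>) / 2" and "b = (x - \<beta>) / 2"
    have ab: "a \<noteq> 0" "b \<noteq> 0" using x by (auto simp: a_def b_def)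
    let ?c = "\<bar>a * b\<bar> powr - (q / 2)"
    define Z where "Z = 1 + a\<^sup>2 + b\<^sup>2"
    have Z: "Z \<ge> 1" "a\<^sup>2 \<le> Z" "b\<^sup>2 \<le> Z" by (auto simp: Z_def)
    have powr_le: "\<bar>y\<bar> powr q \<le> Z powr (q / 2)" if "y \<noteq> 0" "y\<^sup>2 \<le> Z" for y
    proof -
      have "\<bar>y\<bar> powr q = (\<bar>y\<bar> powr 2) powr (q / 2)" by (subst powr_powr) simp
      also have "\<dots> = (y\<^sup>2) powr (q / 2)" using that by (simp add: powr_numeral)
      also have "\<dots> \<le> Z powr (q / 2)" using that q by (intro powr_mono2) auto
      finally show ?thesis .
    qed
    have Z1: "1 \<le> Z powr (q / 2)" using Z q by (intro ge_one_powr_ge_zero) auto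
    have "?J \<le> (\<integral>\<^sup>+ v. ennreal ?c * (ennreal (\<bar>a\<bar> powr q) * (inv_powr q (sin (v * a)) * indicator {-N..N} v)
         + ennreal (\<bar>b\<bar> powr q) * (inv_powr q (sin (v * b)) * indicator {-N..N} v)) \<partial>lborel)"
    proof (rule nn_integral_mono)
      fix v
      have "inv_powr (1 / real m) (diff_symbol \<alpha> \<beta> v x ^ (2 * s)) \<le>
        ennreal ?c * (ennreal (\<bar>a\<bar> powr q) * inv_powr q (sin (v * a)) + ennreal (\<bar>b\<bar> powr q) * inv_powr q (sin (v * b)))"
        unfolding diff_symbol_def a_def[symmetric] b_def[symmetric]
        using m by (intro inv_powr_diff_symbol_le[OF s q_def _ ab]) auto
      then show "inv_powr (1 / real m) (diff_symbol \<alpha> \<beta> v x ^ (2 * s)) * indicator {-N..N} v \<le>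
        ennreal ?c * (ennreal (\<bar>a\<bar> powr q) * (inv_powr q (sin (v * a)) * indicator {-N..N} v)
         + ennreal (\<bar>b\<bar> powr q) * (inv_powr q (sin (v * b)) * indicator {-N..N} v))"
        by (auto simp: indicator_def)
    qed
    also have "\<dots> = ennreal ?c * (ennreal (\<bar>a\<bar> powr q) * (\<integral>\<^sup>+ v. inv_powr q (sin (v * a)) * indicator {-N..N} v \<partial>lborel)
         + ennreal (\<bar>b\<bar> powr q) * (\<integral>\<^sup>+ v. inv_powr q (sin (v * b)) * indicator {-N..N} v \<partial>lborel))"
      by (simp add: nn_integral_cmult nn_integral_add)
    also have "\<dots> \<le> ennreal ?c * (ennreal (\<bar>a\<bar> powr q) * ennreal (C0 * (1 + \<bar>a\<bar> powr - q)) + ennreal (\<bar>b\<bar> powr q) * ennreal (C0 * (1 + \<bar>b\<bar> powr - q)))"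
      using C0(2)[OF ab(1)] C0(2)[OF ab(2)] by (intro mult_left_mono add_mono) auto
    also have "\<dots> = ennreal (?c * (\<bar>a\<bar> powr q * (C0 * (1 + \<bar>a\<bar> powr - q)) + \<bar>b\<bar> powr q * (C0 * (1 + \<bar>b\<bar> powr - q))))"
      using C0(1) by (intro ennreal_mult_add) auto
    also have "\<bar>a\<bar> powr q * (C0 * (1 + \<bar>a\<bar> powr - q)) + \<bar>b\<bar> powr q * (C0 * (1 + \<bar>b\<bar> powr - q)) = C0 * (2 + \<bar>a\<bar> powr q + \<bar>b\<bar> powr q)"
      using ab by (simp add: powr_minus field_simps)
    also have "ennreal (?c * (C0 * (2 + \<bar>a\<bar> powr q + \<bar>b\<bar> powr q))) \<le> ennreal (?c * (C0 * (4 * Z powr (q / 2))))"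
      using powr_le[OF ab(1) Z(2)] powr_le[OF ab(2) Z(3)] Z1 C0(1)
      by (intro ennreal_leI mult_left_mono) auto
    finally have "?J ^ m \<le> ennreal (?c * (C0 * (4 * Z powr (q / 2)))) ^ m"
      by (intro power_mono) auto
    also have "\<dots> = ennreal ((?c * (C0 * (4 * Z powr (q / 2)))) ^ m)"
      using C0(1) by (intro ennreal_power) auto
    finally have J: "?J ^ m \<le> ennreal ((?c * (C0 * (4 * Z powr (q / 2)))) ^ m)" .
    have m0: "real m \<noteq> 0" using m by simp
    have "(?c * (C0 * (4 * Z powr (q / 2)))) ^ m = ?c ^ m * ((4 * C0) ^ m * (Z powr (q / 2)) ^ m)"
      by (simp add: power_mult_distrib mult_ac)
    also have "(Z powr (q / 2)) ^ m = Z ^ (2 * s)"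
    proof -
      have "(Z powr (q / 2)) ^ m = Z powr (q / 2 * real m)"
        using Z by (subst powr_realpow[symmetric]) (auto simp: powr_powr)
      also have "q / 2 * real m = real (2 * s)" using m0 by (simp add: q_def)
      finally show ?thesis using Z by (subst (asm) powr_realpow) auto
    qed
    also have "?c ^ m = 1 / \<bar>a * b\<bar> ^ (2 * s)"
    proof -
      have ab0: "\<bar>a * b\<bar> > 0" using ab by simp
      have "?c ^ m = \<bar>a * b\<bar> powr (- (q / 2) * real m)"
        using ab0 by (subst powr_realpow[symmetric]) (auto simp: powr_powr)
      also have "- (q / 2) * real m = - real (2 * s)" using m0 by (simp add: q_def)
      also have "\<bar>a * b\<bar> powr - real (2 * s) = 1 / \<bar>a * b\<bar> ^ (2 * s)"
        using ab0 by (subst powr_minus, subst powr_realpow) (auto simp: inverse_eq_divide)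
      finally show ?thesis .
    qed
    also have "1 / \<bar>a * b\<bar> ^ (2 * s) * ((4 * C0) ^ m * Z ^ (2 * s)) \<le> 1 / \<bar>a * b\<bar> ^ (2 * s) * ((4 * C0) ^ m * ((2 * (2 + d\<^sup>2)) ^ (2 * s) * (1 + \<bar>a * b\<bar> ^ (2 * s))))"
      unfolding Z_def using C0(1)
      by (intro mult_left_mono power_bound_sum_squares) (auto simp: a_def b_def d_def field_simps)
    also have "\<dots> = K * (1 + 1 / \<bar>a * b\<bar> ^ (2 * s))"
      using ab by (simp add: K_def field_simps)
    also have "1 / \<bar>a * b\<bar> ^ (2 * s) = 16 ^ s / quad_weight \<alpha> \<beta> s x"
    proof -
      have "a * b = (x - \<alpha>) * (x - \<beta>) / 4" by (simp add: a_def b_def)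
      moreover have "((x - \<alpha>) * (x - \<beta>) / 4) ^ (2 * s) = quad_weight \<alpha> \<beta> s x / 16 ^ s"
        by (simp add: power_divide power_mult_distrib power_mult)
      ultimately have "(a * b) ^ (2 * s) = quad_weight \<alpha> \<beta> s x / 16 ^ s" by (simp only:)
      then show ?thesis by (simp add: power_even_abs)
    qed
    also have "K * (1 + 16 ^ s / quad_weight \<alpha> \<beta> s x) \<le> K * (16 ^ s + 16 ^ s / quad_weight \<alpha> \<beta> s x)"
      using K by (intro mult_left_mono add_right_mono) auto
    also have "\<dots> = K * 16 ^ s * (1 + 1 / quad_weight \<alpha> \<beta> s x)"
      by (simp add: distrib_left)
    finally have "(?c * (C0 * (4 * Z powr (q / 2)))) ^ m \<le> K * 16 ^ s * (1 + 1 / quad_weight \<alpha> \<beta> s x)" .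
    with J show ?thesis by (meson ennreal_leI order_trans)
  qed
  then show ?thesis using K by (intro exI[of _ "K * 16 ^ s"]) auto
qed

text \<open>Tonelli over a box of steps, on which the product bound factorises, gives finiteness for
  almost every point of the box. Boxes are used because the inverse of a bounded sum is not
  integrable over the whole product space; countably many of them exhaust it.\<close>

lemma AE_PiM_inverse_symbols_integrable:
  fixes H :: "real \<Rightarrow> ennreal" and I :: "'i set"
  assumes s: "s \<ge> 1" and I: "finite I" "card I = 4 * s + 1" and [measurable]: "H \<in> borel_measurable borel"
    and fin: "(\<integral>\<^sup>+ x. H x * ennreal (1 + 1 / quad_weight \<alpha> \<beta> s x) \<partial>lborel) < \<infinity>"
  shows "AE u in (\<Pi>\<^sub>M j\<in>I. lborel :: real measure).
    (\<integral>\<^sup>+ x. H x * inverse (ennreal (\<Sum>j\<in>I. diff_symbol \<alpha> \<beta> (u j) x ^ (2 * s))) \<partial>lborel) < \<infinity>"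
proof -
  let ?M = "\<Pi>\<^sub>M j\<in>I. lborel :: real measure"
  interpret P: product_sigma_finite "\<lambda>_::'i. lborel :: real measure" ..
  interpret M: sigma_finite_measure ?M using I by (intro P.sigma_finite)
  interpret pair_sigma_finite ?M "lborel :: real measure" ..
  define R where "R u x = H x * inverse (ennreal (\<Sum>j\<in>I. diff_symbol \<alpha> \<beta> (u j) x ^ (2 * s)))" for u :: "'i \<Rightarrow> real" and x
  \<comment> \<open>The indicator of a box, written as a product so that it merges with the factors
    of the bound; \<open>Suc N\<close> keeps the side length positive.\<close>
  define B where "B N u = (\<Prod>j\<in>I. indicator {- real (Suc N)..real (Suc N)} (u j) :: ennreal)" for N and u :: "'i \<Rightarrow> real"
  have [measurable]: "(\<lambda>p. R (fst p) (snd p)) \<in> borel_measurable (?M \<Otimes>\<^sub>M lborel)"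
    unfolding R_def by measurable
  have [measurable]: "B N \<in> borel_measurable ?M" for N
    unfolding B_def by measurable
  have "AE u in ?M. B N u * (\<integral>\<^sup>+ x. R u x \<partial>lborel) \<noteq> \<infinity>" for N
  proof (rule nn_integral_noteq_infinite)
    let ?N = "real (Suc N)" and ?m = "4 * s + 1"
    obtain C where C: "C \<ge> 0" "\<And>x. x \<noteq> \<alpha> \<Longrightarrow> x \<noteq> \<beta> \<Longrightarrow>
      (\<integral>\<^sup>+ v. inv_powr (1 / real ?m) (diff_symbol \<alpha> \<beta> v x ^ (2 * s)) * indicator {-?N..?N} v \<partial>lborel) ^ ?m
        \<le> ennreal (C * (1 + 1 / quad_weight \<alpha> \<beta> s x))"
      using nn_integral_diff_symbol_power_le[OF s refl, of ?N \<alpha> \<beta>] by auto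
    have inner: "(\<integral>\<^sup>+ u. B N u * R u x \<partial>?M) \<le> H x * ennreal (C * (1 + 1 / quad_weight \<alpha> \<beta> s x))"
      if x: "x \<noteq> \<alpha>" "x \<noteq> \<beta>" for x
    proof -
      let ?p = "\<lambda>v. inv_powr (1 / real ?m) (diff_symbol \<alpha> \<beta> v x ^ (2 * s)) * indicator {-?N..?N} v"
      have "(\<integral>\<^sup>+ u. B N u * R u x \<partial>?M) \<le> (\<integral>\<^sup>+ u. H x * (\<Prod>j\<in>I. ?p (u j)) \<partial>?M)"
      proof (rule nn_integral_mono)
        fix u
        have "inverse (ennreal (\<Sum>j\<in>I. diff_symbol \<alpha> \<beta> (u j) x ^ (2 * s))) \<le> (\<Prod>j\<in>I. inv_powr (1 / real (card I)) (diff_symbol \<alpha> \<beta> (u j) x ^ (2 * s)))"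
          using I by (intro inverse_sum_le_prod) auto
        then have "B N u * R u x \<le> B N u * (H x * (\<Prod>j\<in>I. inv_powr (1 / real ?m) (diff_symbol \<alpha> \<beta> (u j) x ^ (2 * s))))"
          unfolding R_def I(2) by (intro mult_left_mono) auto
        also have "\<dots> = H x * (\<Prod>j\<in>I. ?p (u j))"
          unfolding B_def by (simp only: prod.distrib mult_ac)
        finally show "B N u * R u x \<le> H x * (\<Prod>j\<in>I. ?p (u j))" .
      qed
      also have "\<dots> = H x * (\<integral>\<^sup>+ u. (\<Prod>j\<in>I. ?p (u j)) \<partial>?M)"
        by (rule nn_integral_cmult) measurable
      also have "(\<integral>\<^sup>+ u. (\<Prod>j\<in>I. ?p (u j)) \<partial>?M) = (\<Prod>j\<in>I. \<integral>\<^sup>+ v. ?p v \<partial>lborel)"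
        using I(1) by (intro P.product_nn_integral_prod) auto
      also have "\<dots> = (\<integral>\<^sup>+ v. ?p v \<partial>lborel) ^ ?m" using I(2) by simp
      also have "H x * \<dots> \<le> H x * ennreal (C * (1 + 1 / quad_weight \<alpha> \<beta> s x))"
        by (intro mult_left_mono C x) auto
      finally show ?thesis .
    qed
    have "(\<integral>\<^sup>+ u. B N u * (\<integral>\<^sup>+ x. R u x \<partial>lborel) \<partial>?M) = (\<integral>\<^sup>+ u. (\<integral>\<^sup>+ x. B N u * R u x \<partial>lborel) \<partial>?M)"
      by (intro nn_integral_cong nn_integral_cmult[symmetric]) (auto simp: R_def)
    also have "\<dots> = (\<integral>\<^sup>+ x. (\<integral>\<^sup>+ u. B N u * R u x \<partial>?M) \<partial>lborel)"
      by (rule Fubini'[symmetric]) measurable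
    also have "\<dots> \<le> (\<integral>\<^sup>+ x. ennreal C * (H x * ennreal (1 + 1 / quad_weight \<alpha> \<beta> s x)) \<partial>lborel)"
    proof (intro nn_integral_mono_AE)
      have "AE x in lborel. x \<noteq> \<alpha>" "AE x in lborel. x \<noteq> \<beta>" by (intro AE_lborel_singleton)+
      then show "AE x in lborel. (\<integral>\<^sup>+ u. B N u * R u x \<partial>?M) \<le> ennreal C * (H x * ennreal (1 + 1 / quad_weight \<alpha> \<beta> s x))"
      proof eventually_elim
        case (elim x)
        then show ?case using inner[of x] C(1) by (simp add: ennreal_mult' mult_ac)
      qed
    qed
    also have "\<dots> = ennreal C * (\<integral>\<^sup>+ x. H x * ennreal (1 + 1 / quad_weight \<alpha> \<beta> s x) \<partial>lborel)"
      by (rule nn_integral_cmult) measurable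
    also have "\<dots> < \<infinity>" using fin by (simp add: ennreal_mult_less_top)
    finally show "(\<integral>\<^sup>+ u. B N u * (\<integral>\<^sup>+ x. R u x \<partial>lborel) \<partial>?M) \<noteq> \<infinity>" by simp
  qed measurable
  then have "AE u in ?M. \<forall>N. B N u * (\<integral>\<^sup>+ x. R u x \<partial>lborel) \<noteq> \<infinity>"
    unfolding AE_all_countable by blast
  then show ?thesis
  proof eventually_elim
    case (elim u)
    define N where "N = nat \<lceil>\<Sum>j\<in>I. \<bar>u j\<bar>\<rceil>"
    have "B N u = 1"
      unfolding B_def
    proof (intro prod.neutral ballI)
      fix j assume "j \<in> I"
      then have "\<bar>u j\<bar> \<le> (\<Sum>j\<in>I. \<bar>u j\<bar>)" using I(1) by (intro member_le_sum) auto
      also have "\<dots> \<le> real (Suc N)" unfolding N_def by linarith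
      finally show "indicator {- real (Suc N)..real (Suc N)} (u j) = (1::ennreal)" by (auto simp: indicator_def)
    qed
    then have "(\<integral>\<^sup>+ x. R u x \<partial>lborel) \<noteq> \<infinity>" using elim[rule_format, of N] by simp
    then show ?case by (simp add: R_def less_top)
  qed
qed

text \<open>The minimal solution of a linear equation: on the Fourier side \<open>F j\<close> is the \<open>j\<close>-th symbol
  times \<open>fourier f\<close>, divided by the sum of the squared symbols.\<close>

lemma difference_sum_solvable:
  fixes I :: "'i set" and u :: "'i \<Rightarrow> real"
  assumes I: "finite I" and f: "f \<in> L2"
    and fin: "(\<integral>\<^sup>+ x. ennreal ((norm (fourier f x))\<^sup>2) * inverse (ennreal (\<Sum>j\<in>I. diff_symbol \<alpha> \<beta> (u j) x ^ (2 * s))) \<partial>lborel) < \<infinity>"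
  shows "\<exists>F. (\<forall>j\<in>I. F j \<in> L2) \<and>
    ae_eq f (\<lambda>x. \<Sum>j\<in>I. cm_conv_fun (cm_power (difference_measure \<alpha> \<beta> (u j)) s) (F j) x)"
proof -
  have [measurable]: "fourier f \<in> borel_measurable borel" using f by auto
  let ?\<phi> = "\<lambda>j x. diff_symbol \<alpha> \<beta> (u j) x"
  define Y where "Y x = (\<Sum>j\<in>I. ?\<phi> j x ^ (2 * s))" for x
  have Y0: "Y x \<ge> 0" for x unfolding Y_def by (intro sum_nonneg) auto
  have [measurable]: "Y \<in> borel_measurable borel" unfolding Y_def by measurable
  \<comment> \<open>Where all symbols vanish, division by zero makes \<open>G j x\<close> equal to
    0.\<close>
  define G where "G j x = of_real (?\<phi> j x ^ s / Y x) * fourier f x" for j x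
  have [measurable]: "G j \<in> borel_measurable borel" for j unfolding G_def by measurable
  have G: "G j \<in> L2" if j: "j \<in> I" for j
  proof -
    have "l2sq (G j) \<le> (\<integral>\<^sup>+ x. ennreal ((norm (fourier f x))\<^sup>2) * inverse (ennreal (Y x)) \<partial>lborel)"
      unfolding l2sq_def
    proof (rule nn_integral_mono)
      fix x
      show "ennreal ((norm (G j x))\<^sup>2) \<le> ennreal ((norm (fourier f x))\<^sup>2) * inverse (ennreal (Y x))"
      proof (cases "Y x = 0")
        case True then show ?thesis by (simp add: G_def)
      next
        case False
        then have Y: "Y x > 0" using Y0[of x] by simp
        have le: "?\<phi> j x ^ (2 * s) \<le> Y x"
          unfolding Y_def using I j by (intro member_le_sum) auto
        have "(norm (G j x))\<^sup>2 = (norm (fourier f x))\<^sup>2 * (?\<phi> j x ^ (2 * s) / (Y x)\<^sup>2)"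
          by (simp add: G_def norm_mult norm_divide norm_power power_mult_distrib power_divide power_mult[symmetric] mult.commute[of s] power_even_abs)
        also have "\<dots> \<le> (norm (fourier f x))\<^sup>2 * (Y x / (Y x)\<^sup>2)"
          using le by (intro mult_left_mono divide_right_mono) auto
        also have "\<dots> = (norm (fourier f x))\<^sup>2 * inverse (Y x)"
          using Y by (simp add: power2_eq_square field_simps)
        finally have "ennreal ((norm (G j x))\<^sup>2) \<le> ennreal ((norm (fourier f x))\<^sup>2 * inverse (Y x))" by (rule ennreal_leI)
        then show ?thesis using Y by (simp add: ennreal_mult inverse_ennreal)
      qed
    qed
    also have "\<dots> < \<infinity>" using fin by (simp add: Y_def)
    finally show ?thesis by (simp add: L2_iff)
  qed
  have "\<forall>j\<in>I. \<exists>F\<in>L2. ae_eq (fourier F) (G j)" using fourier_surj G by blast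
  then obtain F where F: "\<And>j. j \<in> I \<Longrightarrow> F j \<in> L2" "\<And>j. j \<in> I \<Longrightarrow> ae_eq (fourier (F j)) (G j)" by metis
  let ?T = "\<lambda>j. (diff_step \<alpha> \<beta> (u j) ^^ s) (F j)"
  have eq: "cm_conv_fun (cm_power (difference_measure \<alpha> \<beta> (u j)) s) (F j) = ?T j" if "j \<in> I" for j
    using F(1)[OF that] by (intro cm_conv_fun_difference_power) auto
  have T: "?T j \<in> L2" if "j \<in> I" for j using F(1)[OF that] by auto
  have "AE x in lborel. \<forall>j\<in>I. fourier (?T j) x = of_real (?\<phi> j x) ^ s * fourier (F j) x \<and> fourier (F j) x = G j x"
    using I F fourier_diff_step_funpow[OF F(1)] unfolding ae_eq_def
    by (intro AE_finite_allI AE_conjI) auto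
  moreover have "AE x in lborel. fourier (\<lambda>x. \<Sum>j\<in>I. ?T j x) x = (\<Sum>j\<in>I. fourier (?T j) x)"
    using fourier_sum[of I ?T] T by (simp add: ae_eq_def)
  \<comment> \<open>The inverse of 0 is infinite in \<open>ennreal\<close>, so this finiteness
    forces \<open>fourier f x = 0\<close> at almost every point where all symbols vanish.\<close>
  moreover have "AE x in lborel. ennreal ((norm (fourier f x))\<^sup>2) * inverse (ennreal (Y x)) \<noteq> \<infinity>"
    using fin by (intro nn_integral_noteq_infinite) (auto simp: Y_def)
  ultimately have "ae_eq (fourier (\<lambda>x. \<Sum>j\<in>I. ?T j x)) (fourier f)"
    unfolding ae_eq_def
  proof eventually_elim
    case (elim x)
    have "fourier (\<lambda>x. \<Sum>j\<in>I. ?T j x) x = (\<Sum>j\<in>I. of_real (?\<phi> j x ^ (2 * s)) * (fourier f x / of_real (Y x)))"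
      unfolding elim(2)
    proof (intro sum.cong refl)
      fix j assume "j \<in> I"
      then have "fourier (?T j) x = of_real (?\<phi> j x) ^ s * G j x" using elim(1) by metis
      then show "fourier (?T j) x = of_real (?\<phi> j x ^ (2 * s)) * (fourier f x / of_real (Y x))"
        by (simp add: G_def mult_2 power_add)
    qed
    also have "\<dots> = of_real (Y x) * (fourier f x / of_real (Y x))"
      unfolding Y_def of_real_sum by (rule sum_distrib_right[symmetric])
    also have "\<dots> = fourier f x"
    proof (cases "Y x = 0")
      case True
      then have "fourier f x = 0" using elim(3) by (auto simp: ennreal_mult_top split: if_splits)
      then show ?thesis by simp
    qed simp
    finally show ?case .
  qed
  then have "ae_eq (\<lambda>x. \<Sum>j\<in>I. ?T j x) f"
    by (intro fourier_inject[OF _ f] L2_sum T)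
  then have "ae_eq f (\<lambda>x. \<Sum>j\<in>I. cm_conv_fun (cm_power (difference_measure \<alpha> \<beta> (u j)) s) (F j) x)"
    using eq by (simp add: ae_eq_sym)
  then show ?thesis using F(1) by blast
qed

section \<open>Differences have finite weighted norm\<close>

text \<open>Admits \<open>W = 0\<close>, where the quotient is 0 by convention, so that the points
  \<alpha> and \<beta> need no separate treatment.\<close>

lemma divide_le_of_le_mult:
  fixes P A W :: real
  assumes "0 \<le> W" "0 \<le> A" "P \<le> A * W"
  shows "P / W \<le> A"
  using assms by (cases "W = 0") (auto simp: pos_divide_le_eq less_le)

lemma diff_symbol_le: "\<bar>diff_symbol \<alpha> \<beta> u x\<bar> \<le> u\<^sup>2 * \<bar>(x - \<alpha>) * (x - \<beta>)\<bar>"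
proof -
  have "\<bar>sin (u * ((x - \<alpha>) / 2))\<bar> * \<bar>sin (u * ((x - \<beta>) / 2))\<bar> \<le> \<bar>u * ((x - \<alpha>) / 2)\<bar> * \<bar>u * ((x - \<beta>) / 2)\<bar>"
    by (intro mult_mono abs_sin_x_le_abs_x) simp_all
  also have "\<dots> = \<bar>u\<^sup>2 * ((x - \<alpha>) * (x - \<beta>)) / 4\<bar>"
    unfolding abs_mult[symmetric] by (rule arg_cong[where f=abs]) (simp add: power2_eq_square)
  also have "\<dots> = u\<^sup>2 * \<bar>(x - \<alpha>) * (x - \<beta>)\<bar> / 4"
    by (simp add: abs_mult)
  finally show ?thesis by (simp add: diff_symbol_def abs_mult)
qed

lemma is_difference_weight_finite:
  assumes "is_difference \<alpha> \<beta> s f"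
  shows "f \<in> L2" "(\<integral>\<^sup>+ x. ennreal ((norm (fourier f x))\<^sup>2 / quad_weight \<alpha> \<beta> s x) \<partial>lborel) < \<infinity>"
proof -
  show f: "f \<in> L2" using assms by (simp add: is_difference_def)
  obtain g u where g: "g \<in> L2" "ae_eq f (cm_conv_fun (cm_power (difference_measure \<alpha> \<beta> u) s) g)"
    using assms by (auto simp: is_difference_def)
  have T: "cm_conv_fun (cm_power (difference_measure \<alpha> \<beta> u) s) g = (diff_step \<alpha> \<beta> u ^^ s) g"
    using g(1) by (intro cm_conv_fun_difference_power) auto
  have [measurable]: "fourier g \<in> borel_measurable borel" using g by auto
  have "ae_eq (fourier f) (fourier ((diff_step \<alpha> \<beta> u ^^ s) g))"
    using f g T by (intro fourier_cong) auto
  then have "ae_eq (fourier f) (\<lambda>x. of_real (diff_symbol \<alpha> \<beta> u x) ^ s * fourier g x)"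
    using fourier_diff_step_funpow[OF g(1)] by (rule ae_eq_trans)
  then have "(\<integral>\<^sup>+ x. ennreal ((norm (fourier f x))\<^sup>2 / quad_weight \<alpha> \<beta> s x) \<partial>lborel) \<le>
    (\<integral>\<^sup>+ x. ennreal (u ^ (4 * s)) * ennreal ((norm (fourier g x))\<^sup>2) \<partial>lborel)"
    unfolding ae_eq_def
  proof (intro nn_integral_mono_AE, eventually_elim)
    case (elim x)
    let ?W = "quad_weight \<alpha> \<beta> s x"
    have "(norm (fourier f x))\<^sup>2 = \<bar>diff_symbol \<alpha> \<beta> u x\<bar> ^ (2 * s) * (norm (fourier g x))\<^sup>2"
      unfolding elim by (simp add: norm_mult norm_power power_mult_distrib power_mult[symmetric] mult.commute[of s] power_even_abs)
    also have "\<dots> \<le> (u\<^sup>2 * \<bar>(x - \<alpha>) * (x - \<beta>)\<bar>) ^ (2 * s) * (norm (fourier g x))\<^sup>2"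
      by (intro mult_right_mono power_mono diff_symbol_le) auto
    also have "\<dots> = (u ^ (4 * s) * (norm (fourier g x))\<^sup>2) * ?W"
      by (simp add: power_mult_distrib power_even_abs power_mult[symmetric] abs_mult mult_ac)
    finally have "(norm (fourier f x))\<^sup>2 \<le> (u ^ (4 * s) * (norm (fourier g x))\<^sup>2) * ?W" .
    then have "(norm (fourier f x))\<^sup>2 / ?W \<le> u ^ (4 * s) * (norm (fourier g x))\<^sup>2"
      by (intro divide_le_of_le_mult quad_weight_nonneg mult_nonneg_nonneg zero_le_even_power) auto
    then show ?case by (subst ennreal_mult[symmetric]) (auto intro!: ennreal_leI zero_le_even_power)
  qed
  also have "\<dots> = ennreal (u ^ (4 * s)) * l2sq (fourier g)"
    unfolding l2sq_def by (rule nn_integral_cmult) measurable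
  also have "\<dots> < \<infinity>" using L2_fourier[OF g(1)] by (auto simp: L2_iff ennreal_mult_less_top)
  finally show "(\<integral>\<^sup>+ x. ennreal ((norm (fourier f x))\<^sup>2 / quad_weight \<alpha> \<beta> s x) \<partial>lborel) < \<infinity>" .
qed

text \<open>With the square root of the weight put into the function, the weighted inner product
  becomes the ordinary one of L2 and all its properties can be transferred.\<close>

definition weighted_L2 :: "(real \<Rightarrow> real) \<Rightarrow> (real \<Rightarrow> complex) set" where
  "weighted_L2 w = {f \<in> L2. (\<lambda>x. of_real (sqrt (w x)) * fourier f x) \<in> L2}"

lemma weighted_L2_iff:
  assumes w: "\<And>x. w x = 1 + v x" "\<And>x. v x \<ge> 0" and [measurable]: "v \<in> borel_measurable borel"
  shows "f \<in> weighted_L2 w \<longleftrightarrow> f \<in> L2 \<and> (\<integral>\<^sup>+ x. ennreal ((norm (fourier f x))\<^sup>2 * v x) \<partial>lborel) < \<infinity>"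
proof (cases "f \<in> L2")
  case f: True
  have [measurable]: "fourier f \<in> borel_measurable borel" using f by auto
  have w': "w = (\<lambda>x. 1 + v x)" using w by auto
  have [measurable]: "w \<in> borel_measurable borel" unfolding w' by measurable
  have "l2sq (\<lambda>x. of_real (sqrt (w x)) * fourier f x) = (\<integral>\<^sup>+ x. ennreal ((norm (fourier f x))\<^sup>2) + ennreal ((norm (fourier f x))\<^sup>2 * v x) \<partial>lborel)"
    unfolding l2sq_def
  proof (rule nn_integral_cong)
    fix x
    have "w x \<ge> 0" using w[of x] by simp
    then have "(norm (of_real (sqrt (w x)) * fourier f x))\<^sup>2 = (norm (fourier f x))\<^sup>2 + (norm (fourier f x))\<^sup>2 * v x"
      by (simp add: norm_mult power_mult_distrib w(1) algebra_simps)
    then show "ennreal ((norm (of_real (sqrt (w x)) * fourier f x))\<^sup>2) = ennreal ((norm (fourier f x))\<^sup>2) + ennreal ((norm (fourier f x))\<^sup>2 * v x)"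
      using w(2)[of x] by (simp add: ennreal_plus)
  qed
  also have "\<dots> = l2sq (fourier f) + (\<integral>\<^sup>+ x. ennreal ((norm (fourier f x))\<^sup>2 * v x) \<partial>lborel)"
    unfolding l2sq_def by (rule nn_integral_add) measurable
  finally show ?thesis
    using f L2_fourier[OF f] by (auto simp: weighted_L2_def L2_iff)
qed (simp add: weighted_L2_def)

section \<open>Weighted spaces on the Fourier side\<close>

text \<open>The lower bound on \<open>w\<close> makes the square root invertible and keeps division
  by it inside L2, as definiteness and completeness require.\<close>

locale fourier_weight =
  fixes w :: "real \<Rightarrow> real"
  assumes w_measurable [measurable]: "w \<in> borel_measurable borel" and w_ge_1: "\<And>x. w x \<ge> 1"
begin

definition \<Phi> :: "(real \<Rightarrow> complex) \<Rightarrow> real \<Rightarrow> complex" where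
  "\<Phi> f x = of_real (sqrt (w x)) * fourier f x"

lemma weighted_L2D:
  assumes "f \<in> weighted_L2 w"
  shows "f \<in> L2" "\<Phi> f \<in> L2"
  using assms by (auto simp: weighted_L2_def \<Phi>_def[abs_def])

lemma weighted_L2I: "f \<in> L2 \<Longrightarrow> \<Phi> f \<in> L2 \<Longrightarrow> f \<in> weighted_L2 w"
  by (auto simp: weighted_L2_def \<Phi>_def[abs_def])

lemma \<Phi>_measurable: "f \<in> L2 \<Longrightarrow> \<Phi> f \<in> borel_measurable borel"
proof -
  assume f: "f \<in> L2"
  then have [measurable]: "fourier f \<in> borel_measurable borel" by auto
  show ?thesis unfolding \<Phi>_def[abs_def] by measurable
qed

lemma \<Phi>_cong:
  assumes "f \<in> L2" "g \<in> L2" "ae_eq f g"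
  shows "ae_eq (\<Phi> f) (\<Phi> g)"
  using fourier_cong[OF assms] unfolding ae_eq_def \<Phi>_def by eventually_elim simp

lemma \<Phi>_add:
  assumes "f \<in> L2" "g \<in> L2"
  shows "ae_eq (\<Phi> (\<lambda>x. f x + g x)) (\<lambda>x. \<Phi> f x + \<Phi> g x)"
  using fourier_add[OF assms] unfolding ae_eq_def \<Phi>_def by eventually_elim (simp add: distrib_left)

lemma \<Phi>_cmult:
  assumes "f \<in> L2"
  shows "ae_eq (\<Phi> (\<lambda>x. c * f x)) (\<lambda>x. c * \<Phi> f x)"
  using fourier_cmult[OF assms, of c] unfolding ae_eq_def \<Phi>_def by eventually_elim (simp add: mult.left_commute)

lemma \<Phi>_diff:
  assumes "f \<in> L2" "g \<in> L2"
  shows "ae_eq (\<Phi> (\<lambda>x. f x - g x)) (\<lambda>x. \<Phi> f x - \<Phi> g x)"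
proof -
  have eq: "(\<lambda>x. f x - g x) = (\<lambda>x. f x + (-1) * g x)" by auto
  show ?thesis
    unfolding eq using \<Phi>_add[OF assms(1) L2_cmult[OF assms(2), of "-1"]] \<Phi>_cmult[OF assms(2), of "-1"]
    unfolding ae_eq_def by eventually_elim simp
qed

lemma subspace: "L2_subspace (weighted_L2 w)"
  unfolding L2_subspace_def
proof (intro conjI ballI allI)
  show "weighted_L2 w \<subseteq> L2" by (auto simp: weighted_L2_def)
  have "ae_eq (\<Phi> (\<lambda>x. 0 * 0)) (\<lambda>x. 0 * \<Phi> (\<lambda>x. 0) x)" by (rule \<Phi>_cmult) simp
  then show "(\<lambda>x. 0) \<in> weighted_L2 w"
    by (intro weighted_L2I L2_cong_AE[OF L2_zero] \<Phi>_measurable) auto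
  fix f assume f: "f \<in> weighted_L2 w"
  show "(\<lambda>x. c * f x) \<in> weighted_L2 w" for c
    using weighted_L2D[OF f]
    by (intro weighted_L2I L2_cong_AE[OF L2_cmult \<Phi>_measurable \<Phi>_cmult]) auto
  fix g assume g: "g \<in> weighted_L2 w"
  show "(\<lambda>x. f x + g x) \<in> weighted_L2 w"
    using weighted_L2D[OF f] weighted_L2D[OF g]
    by (intro weighted_L2I L2_cong_AE[OF L2_add \<Phi>_measurable \<Phi>_add]) auto
qed

lemma diff: "f \<in> weighted_L2 w \<Longrightarrow> g \<in> weighted_L2 w \<Longrightarrow> (\<lambda>x. f x - g x) \<in> weighted_L2 w"
proof -
  assume f: "f \<in> weighted_L2 w" and g: "g \<in> weighted_L2 w"
  show ?thesis
    using weighted_L2D[OF f] weighted_L2D[OF g]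
    by (intro weighted_L2I L2_cong_AE[OF L2_diff \<Phi>_measurable \<Phi>_diff]) auto
qed

lemma integrand: "of_real (w x) * fourier f x * cnj (fourier g x) = \<Phi> f x * cnj (\<Phi> g x)"
proof -
  have "complex_of_real (w x) = of_real (sqrt (w x)) * of_real (sqrt (w x))"
    using w_ge_1[of x] by (simp flip: of_real_mult)
  then show ?thesis by (simp add: \<Phi>_def mult_ac)
qed

lemma inner_eq: "weighted_inner w f g = (LINT x|lborel. \<Phi> f x * cnj (\<Phi> g x))"
  by (simp add: weighted_inner_def integrand)

lemma integrable_inner:
  assumes "f \<in> weighted_L2 w" "g \<in> weighted_L2 w"
  shows "integrable lborel (\<lambda>x. of_real (w x) * fourier f x * cnj (fourier g x))"
  unfolding integrand using weighted_L2D[OF assms(1)] weighted_L2D[OF assms(2)] by (intro L2_mult_integrable) auto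

lemma inner_self: "weighted_inner w f f = of_real (LINT x|lborel. (norm (\<Phi> f x))\<^sup>2)"
  unfolding inner_eq complex_norm_square[symmetric] by (simp flip: of_real_power)

lemma ip_norm_eq: "ip_norm (weighted_inner w) f = sqrt (LINT x|lborel. (norm (\<Phi> f x))\<^sup>2)"
  by (simp add: ip_norm_def inner_self)

lemma ip_norm_nonneg: "ip_norm (weighted_inner w) f \<ge> 0"
  by (simp add: ip_norm_eq integral_nonneg)

lemma l2sq_\<Phi>:
  assumes "f \<in> weighted_L2 w"
  shows "l2sq (\<Phi> f) = ennreal ((ip_norm (weighted_inner w) f)\<^sup>2)"
  using l2sq_eq_integral[OF weighted_L2D(2)[OF assms]] by (simp add: ip_norm_eq integral_nonneg)

lemma l2sq_\<Phi>_diff: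
  assumes "f \<in> weighted_L2 w" "g \<in> weighted_L2 w"
  shows "l2sq (\<lambda>x. \<Phi> f x - \<Phi> g x) = ennreal ((ip_norm (weighted_inner w) (\<lambda>x. f x - g x))\<^sup>2)"
proof -
  have "l2sq (\<lambda>x. \<Phi> f x - \<Phi> g x) = l2sq (\<Phi> (\<lambda>x. f x - g x))"
    using \<Phi>_diff[OF weighted_L2D(1)[OF assms(1)] weighted_L2D(1)[OF assms(2)]]
    by (intro l2sq_cong_AE) (auto simp: ae_eq_def elim!: eventually_mono)
  then show ?thesis using l2sq_\<Phi>[OF diff[OF assms]] by simp
qed

lemma inner_cong:
  assumes "ae_eq (\<Phi> f) F" "f \<in> L2" "F \<in> borel_measurable borel" "g \<in> L2"
  shows "weighted_inner w f g = (LINT x|lborel. F x * cnj (\<Phi> g x))"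
proof -
  have [measurable]: "\<Phi> f \<in> borel_measurable borel" "\<Phi> g \<in> borel_measurable borel" "F \<in> borel_measurable borel"
    using assms by (auto intro: \<Phi>_measurable)
  show ?thesis
    unfolding inner_eq using assms(1) by (intro integral_cong_AE) (auto simp: ae_eq_def elim!: eventually_mono)
qed

text \<open>The sequence of \<open>\<Phi> (h n)\<close> converges in L2 to some \<open>G\<close>;
  division by \<open>sqrt (w x)\<close> and surjectivity of the transform produce a function whose
  \<open>\<Phi>\<close> is \<open>G\<close>.\<close>

lemma complete:
  assumes h: "\<And>n. h n \<in> weighted_L2 w"
    and cauchy: "\<forall>e>0. \<exists>N. \<forall>m\<ge>N. \<forall>n\<ge>N. ip_norm (weighted_inner w) (\<lambda>x. h m x - h n x) < e"
  shows "\<exists>f\<in>weighted_L2 w. (\<lambda>n. ip_norm (weighted_inner w) (\<lambda>x. h n x - f x)) \<longlonglongrightarrow> 0"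
proof -
  let ?n = "ip_norm (weighted_inner w)"
  have "\<exists>G\<in>L2. L2_tendsto (\<lambda>n. \<Phi> (h n)) G"
  proof (rule L2_complete)
    fix e :: real assume e: "e > 0"
    then have "sqrt e > 0" by simp
    then obtain N where N: "\<forall>m\<ge>N. \<forall>n\<ge>N. ?n (\<lambda>x. h m x - h n x) < sqrt e"
      using cauchy by blast
    have "l2sq (\<lambda>x. \<Phi> (h m) x - \<Phi> (h n) x) < ennreal e" if mn: "m \<ge> N" "n \<ge> N" for m n
    proof -
      have "(?n (\<lambda>x. h m x - h n x))\<^sup>2 < (sqrt e)\<^sup>2"
        using N mn ip_norm_nonneg by (intro power_strict_mono) auto
      then show ?thesis unfolding l2sq_\<Phi>_diff[OF h h] using e by (intro ennreal_lessI) auto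
    qed
    then show "\<exists>N. \<forall>m\<ge>N. \<forall>n\<ge>N. l2sq (\<lambda>x. \<Phi> (h m) x - \<Phi> (h n) x) < ennreal e" by blast
  qed (use weighted_L2D(2)[OF h] in auto)
  then obtain G where G: "G \<in> L2" "L2_tendsto (\<lambda>n. \<Phi> (h n)) G" by blast
  have [measurable]: "G \<in> borel_measurable borel" using G(1) by (rule L2_borel)
  let ?G = "\<lambda>x. of_real (1 / sqrt (w x)) * G x"
  have "?G \<in> L2"
  proof (rule L2_bound[OF G(1)])
    show "?G \<in> borel_measurable borel" by measurable
    have "\<bar>1 / sqrt (w x)\<bar> \<le> 1" for x using w_ge_1[of x] by simp
    then show "AE x in lborel. norm (?G x) \<le> norm (G x)"
      unfolding norm_mult norm_of_real by (intro AE_I2 mult_left_le_one_le) auto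
  qed
  then obtain f where f: "f \<in> L2" "ae_eq (fourier f) ?G" using fourier_surj by blast
  have eq: "ae_eq (\<Phi> f) G"
    unfolding ae_eq_def using f(2)[unfolded ae_eq_def]
  proof eventually_elim
    case (elim x)
    have "sqrt (w x) \<noteq> 0" using w_ge_1[of x] by simp
    then show ?case unfolding \<Phi>_def elim by simp
  qed
  have fw: "f \<in> weighted_L2 w"
    by (rule weighted_L2I[OF f(1) L2_cong_AE[OF G(1) \<Phi>_measurable[OF f(1)] eq]])
  have "l2sq (\<lambda>x. \<Phi> (h n) x - G x) = ennreal ((?n (\<lambda>x. h n x - f x))\<^sup>2)" for n
    unfolding l2sq_\<Phi>_diff[OF h fw, symmetric]
    using eq by (intro l2sq_cong_AE) (auto simp: ae_eq_def elim!: eventually_mono)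
  then have "(\<lambda>n. ennreal ((?n (\<lambda>x. h n x - f x))\<^sup>2)) \<longlonglongrightarrow> ennreal 0"
    using G(2) by (simp add: L2_tendsto_iff)
  then have "(\<lambda>n. (?n (\<lambda>x. h n x - f x))\<^sup>2) \<longlonglongrightarrow> 0"
    by (subst (asm) tendsto_ennreal_iff) auto
  then have "(\<lambda>n. sqrt ((?n (\<lambda>x. h n x - f x))\<^sup>2)) \<longlonglongrightarrow> sqrt 0"
    by (rule tendsto_real_sqrt)
  then have "(\<lambda>n. ?n (\<lambda>x. h n x - f x)) \<longlonglongrightarrow> 0" using ip_norm_nonneg by simp
  with fw show ?thesis by blast
qed

lemma hilbert_space: "hilbert_space (weighted_L2 w) (weighted_inner w)"
  unfolding hilbert_space_def
proof (intro conjI ballI allI impI)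
  show "L2_subspace (weighted_L2 w)" by (rule subspace)
  fix f assume f: "f \<in> weighted_L2 w"
  note fL = weighted_L2D[OF f]
  show "0 \<le> Re (weighted_inner w f f)" by (simp add: inner_self integral_nonneg)
  show "ae_eq f (\<lambda>x. 0)" if zero: "weighted_inner w f f = 0"
  proof -
    have "l2sq (\<Phi> f) = 0" using zero fL l2sq_eq_integral[OF fL(2)] by (simp add: inner_self)
    then have "ae_eq (\<Phi> f) (\<lambda>x. 0)" using fL \<Phi>_measurable by (subst (asm) l2sq_eq_0_iff) auto
    then have "ae_eq (fourier f) (\<lambda>x. 0)"
      unfolding ae_eq_def
    proof eventually_elim
      case (elim x)
      then show ?case using w_ge_1[of x] by (simp add: \<Phi>_def)
    qed
    then have "l2sq (fourier f) = 0" using fL by (subst l2sq_eq_0_iff) auto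
    then have "l2sq f = 0" using l2sq_fourier[OF fL(1)] by simp
    then show ?thesis using fL by (subst (asm) l2sq_eq_0_iff) auto
  qed
  fix g assume g: "g \<in> weighted_L2 w"
  note gL = weighted_L2D[OF g]
  show "weighted_inner w (\<lambda>x. c * f x) g = c * weighted_inner w f g" for c
  proof -
    have "weighted_inner w (\<lambda>x. c * f x) g = (LINT x|lborel. (c * \<Phi> f x) * cnj (\<Phi> g x))"
      using fL gL by (intro inner_cong \<Phi>_cmult L2_borel[OF L2_cmult]) auto
    then show ?thesis by (simp add: mult.assoc inner_eq)
  qed
  show "weighted_inner w g f = cnj (weighted_inner w f g)"
    unfolding inner_eq Bochner_Integration.integral_cnj[symmetric] by (simp add: mult.commute)
  fix f' assume f': "f' \<in> weighted_L2 w"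
  note f'L = weighted_L2D[OF f']
  show "weighted_inner w (\<lambda>x. f x + g x) f' = weighted_inner w f f' + weighted_inner w g f'"
  proof -
    have "weighted_inner w (\<lambda>x. f x + g x) f' = (LINT x|lborel. (\<Phi> f x + \<Phi> g x) * cnj (\<Phi> f' x))"
      using fL gL f'L by (intro inner_cong \<Phi>_add L2_borel[OF L2_add]) auto
    also have "\<dots> = (LINT x|lborel. \<Phi> f x * cnj (\<Phi> f' x)) + (LINT x|lborel. \<Phi> g x * cnj (\<Phi> f' x))"
      unfolding distrib_right using fL gL f'L by (intro Bochner_Integration.integral_add L2_mult_integrable L2_cnj)
    finally show ?thesis by (simp add: inner_eq)
  qed
next
  fix f f' g assume f: "f \<in> weighted_L2 w" and f': "f' \<in> weighted_L2 w" and g: "g \<in> weighted_L2 w" and eq: "ae_eq f f'"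
  show "weighted_inner w f g = weighted_inner w f' g"
    using weighted_L2D[OF f] weighted_L2D[OF f'] weighted_L2D[OF g] \<Phi>_cong[OF _ _ eq] \<Phi>_measurable
      inner_cong[of f "\<Phi> f'" g] by (simp add: inner_eq)
next
  fix h :: "nat \<Rightarrow> real \<Rightarrow> complex" assume "(\<forall>n. h n \<in> weighted_L2 w) \<and>
    (\<forall>e>0. \<exists>N. \<forall>m\<ge>N. \<forall>n\<ge>N. ip_norm (weighted_inner w) (\<lambda>x. h m x - h n x) < e)"
  then show "\<exists>f\<in>weighted_L2 w. (\<lambda>n. ip_norm (weighted_inner w) (\<lambda>x. h n x - f x)) \<longlonglongrightarrow> 0"
    by (intro complete) auto
qed

end

section \<open>Multiplication operators between weighted spaces\<close>

text \<open>\<open>T\<close> is known only through its multiplier, almost everywhere; hence the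
  lemma applies to \<open>diff_op\<close>, which is given by choice, as well as to its inverse.
  Linearity is pulled back from the Fourier side by \<open>fourier_inject\<close>, and the bound on
  \<open>m\<close> yields the operator bound \<open>sqrt C\<close>.\<close>

lemma multiplier_bounded_operator:
  assumes "fourier_weight v" "fourier_weight w"
    and T: "\<And>f. f \<in> weighted_L2 v \<Longrightarrow> T f \<in> L2 \<and> (AE x in lborel. fourier (T f) x = m x * fourier f x)"
    and C: "C \<ge> 0" and le: "AE x in lborel. (norm (m x))\<^sup>2 * w x \<le> C * v x"
  shows "bounded_operator (weighted_L2 v) (weighted_inner v) (weighted_L2 w) (weighted_inner w) T"
proof -
  interpret V: fourier_weight v by fact
  interpret W: fourier_weight w by fact
  have T1: "T f \<in> L2" and T2: "AE x in lborel. fourier (T f) x = m x * fourier f x" if "f \<in> weighted_L2 v" for f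
    using T[OF that] by auto
  have bound: "AE x in lborel. norm (W.\<Phi> (T f) x) \<le> norm (of_real (sqrt C) * V.\<Phi> f x)" if f: "f \<in> weighted_L2 v" for f
    using le T2[OF f]
  proof eventually_elim
    case (elim x)
    have w0: "w x \<ge> 0" "v x \<ge> 0" using W.w_ge_1[of x] V.w_ge_1[of x] by auto
    have "(norm (W.\<Phi> (T f) x))\<^sup>2 = ((norm (m x))\<^sup>2 * w x) * (norm (fourier f x))\<^sup>2"
      using w0 unfolding W.\<Phi>_def elim(2) by (simp add: norm_mult power_mult_distrib)
    also have "\<dots> \<le> (C * v x) * (norm (fourier f x))\<^sup>2"
      using elim(1) by (intro mult_right_mono) auto
    also have "\<dots> = (norm (of_real (sqrt C) * V.\<Phi> f x))\<^sup>2"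
      using w0 C unfolding V.\<Phi>_def by (simp add: norm_mult power_mult_distrib)
    finally show ?case by (rule power2_le_imp_le) simp
  qed
  have TW: "T f \<in> weighted_L2 w" if f: "f \<in> weighted_L2 v" for f
    by (rule W.weighted_L2I[OF T1[OF f] L2_bound[OF L2_cmult[OF V.weighted_L2D(2)[OF f]] W.\<Phi>_measurable[OF T1[OF f]] bound[OF f]]])
  have norm_le: "ip_norm (weighted_inner w) (T f) \<le> sqrt C * ip_norm (weighted_inner v) f" if f: "f \<in> weighted_L2 v" for f
  proof -
    have "ennreal ((ip_norm (weighted_inner w) (T f))\<^sup>2) \<le> l2sq (\<lambda>x. of_real (sqrt C) * V.\<Phi> f x)"
      unfolding W.l2sq_\<Phi>[OF TW[OF f], symmetric] by (rule l2sq_mono_AE[OF bound[OF f]])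
    also have "\<dots> = ennreal ((sqrt C * ip_norm (weighted_inner v) f)\<^sup>2)"
      using V.\<Phi>_measurable[OF V.weighted_L2D(1)[OF f]] C
      by (subst l2sq_cmult) (auto simp: V.l2sq_\<Phi>[OF f] power_mult_distrib simp flip: ennreal_mult)
    finally have "(ip_norm (weighted_inner w) (T f))\<^sup>2 \<le> (sqrt C * ip_norm (weighted_inner v) f)\<^sup>2"
      by simp
    then show ?thesis by (rule power2_le_imp_le) (use C V.ip_norm_nonneg in auto)
  qed
  have lin: "linear_operator (weighted_L2 v) (weighted_L2 w) T"
    unfolding linear_operator_def
  proof (intro conjI ballI allI impI V.subspace W.subspace TW)
    fix f assume f: "f \<in> weighted_L2 v"
    note fL = V.weighted_L2D(1)[OF f]
    show "ae_eq (T (\<lambda>x. c * f x)) (\<lambda>x. c * T f x)" for c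
    proof (rule fourier_inject)
      have cf: "(\<lambda>x. c * f x) \<in> weighted_L2 v" using V.subspace f by (auto simp: L2_subspace_def)
      show "T (\<lambda>x. c * f x) \<in> L2" "(\<lambda>x. c * T f x) \<in> L2" by (intro T1 cf L2_cmult f)+
      show "ae_eq (fourier (T (\<lambda>x. c * f x))) (fourier (\<lambda>x. c * T f x))"
        using T2[OF cf] T2[OF f] fourier_cmult[OF T1[OF f], of c] fourier_cmult[OF fL, of c]
        unfolding ae_eq_def by eventually_elim simp
    qed
    fix g assume g: "g \<in> weighted_L2 v"
    note gL = V.weighted_L2D(1)[OF g]
    show "ae_eq (T (\<lambda>x. f x + g x)) (\<lambda>x. T f x + T g x)"
    proof (rule fourier_inject)
      have fg: "(\<lambda>x. f x + g x) \<in> weighted_L2 v" using V.subspace f g by (auto simp: L2_subspace_def)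
      show "T (\<lambda>x. f x + g x) \<in> L2" "(\<lambda>x. T f x + T g x) \<in> L2" by (intro T1 fg L2_add f g)+
      show "ae_eq (fourier (T (\<lambda>x. f x + g x))) (fourier (\<lambda>x. T f x + T g x))"
        using T2[OF fg] T2[OF f] T2[OF g] fourier_add[OF T1[OF f] T1[OF g]] fourier_add[OF fL gL]
        unfolding ae_eq_def by eventually_elim (simp add: distrib_left)
    qed
    show "ae_eq (T f) (T g)" if eq: "ae_eq f g"
    proof (rule fourier_inject)
      show "T f \<in> L2" "T g \<in> L2" by (intro T1 f g)+
      show "ae_eq (fourier (T f)) (fourier (T g))"
        using T2[OF f] T2[OF g] fourier_cong[OF fL gL eq]
        unfolding ae_eq_def by eventually_elim simp
    qed
  qed
  show ?thesis unfolding bounded_operator_def using lin norm_le by blast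
qed

lemma fourier_weight_diff_weight: "fourier_weight (diff_weight \<alpha> \<beta> s)"
  by standard (auto simp: diff_weight_def[abs_def])

lemma fourier_weight_sobolev: "fourier_weight (\<lambda>x. 1 + \<bar>x\<bar> ^ (2 * k))"
  by standard auto

lemma sobolev_eq: "sobolev k = weighted_L2 (\<lambda>x. 1 + \<bar>x\<bar> ^ (2 * k))"
proof -
  have "(norm (of_real x ^ k * fourier f x))\<^sup>2 = (norm (fourier f x))\<^sup>2 * \<bar>x\<bar> ^ (2 * k)" for f x
    by (simp add: norm_mult norm_power power_mult_distrib power_mult[symmetric] mult_ac)
  then have "f \<in> sobolev k \<longleftrightarrow> f \<in> weighted_L2 (\<lambda>x. 1 + \<bar>x\<bar> ^ (2 * k))" for f
    unfolding sobolev_iff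
    by (subst weighted_L2_iff[where v="\<lambda>x. \<bar>x\<bar> ^ (2 * k)"]) (auto simp: L2_iff l2sq_def)
  then show ?thesis by blast
qed

lemma weighted_L2_diff_weight_iff:
  "f \<in> weighted_L2 (diff_weight \<alpha> \<beta> s) \<longleftrightarrow>
    f \<in> L2 \<and> (\<integral>\<^sup>+ x. ennreal ((norm (fourier f x))\<^sup>2 / quad_weight \<alpha> \<beta> s x) \<partial>lborel) < \<infinity>"
  by (subst weighted_L2_iff[where v="\<lambda>x. 1 / quad_weight \<alpha> \<beta> s x"]) (auto simp: diff_weight_def)

section \<open>Sums of differences form a weighted space\<close>

lemma diff_space_subset: "diff_space \<alpha> \<beta> s \<subseteq> weighted_L2 (diff_weight \<alpha> \<beta> s)"
proof
  interpret fourier_weight "diff_weight \<alpha> \<beta> s" by (rule fourier_weight_diff_weight)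
  fix f assume "f \<in> diff_space \<alpha> \<beta> s"
  then obtain n h where f: "f \<in> L2" and h: "\<forall>j<(n::nat). is_difference \<alpha> \<beta> s (h j)" and eq: "ae_eq f (\<lambda>x. \<Sum>j<n. h j x)"
    by (auto simp: diff_space_def)
  have hw: "h j \<in> weighted_L2 (diff_weight \<alpha> \<beta> s)" if "j < n" for j
    using is_difference_weight_finite[of \<alpha> \<beta> s "h j"] h that by (simp add: weighted_L2_diff_weight_iff)
  have "(\<lambda>x. \<Sum>j<k. h j x) \<in> weighted_L2 (diff_weight \<alpha> \<beta> s)" if "k \<le> n" for k
    using that by (induction k) (use subspace hw in \<open>auto simp: L2_subspace_def\<close>)
  then have sum: "(\<lambda>x. \<Sum>j<n. h j x) \<in> weighted_L2 (diff_weight \<alpha> \<beta> s)" by simp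
  show "f \<in> weighted_L2 (diff_weight \<alpha> \<beta> s)"
    by (rule weighted_L2I[OF f L2_cong_AE[OF weighted_L2D(2)[OF sum] \<Phi>_measurable[OF f] \<Phi>_cong[OF f weighted_L2D(1)[OF sum] eq]]])
qed

text \<open>Condition (iii) with the steps fixed, so that the existence and the almost-everywhere
  version concern the same predicate.\<close>

definition difference_sum :: "real \<Rightarrow> real \<Rightarrow> nat \<Rightarrow> (nat \<Rightarrow> real) \<Rightarrow> (real \<Rightarrow> complex) \<Rightarrow> bool" where
  "difference_sum \<alpha> \<beta> s u f \<longleftrightarrow> (\<exists>F :: nat \<Rightarrow> real \<Rightarrow> complex.
     (\<forall>j\<in>{1..4 * s + 1}. F j \<in> L2) \<and>
     ae_eq f (\<lambda>x. \<Sum>j=1..4 * s + 1. cm_conv_fun (cm_power (difference_measure \<alpha> \<beta> (u j)) s) (F j) x))"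

lemma AE_difference_sum:
  assumes s: "s \<ge> 1" and f: "f \<in> weighted_L2 (diff_weight \<alpha> \<beta> s)"
  shows "AE u in (\<Pi>\<^sub>M j\<in>{1..4 * s + 1}. lborel :: real measure). difference_sum \<alpha> \<beta> s u f"
proof -
  interpret fourier_weight "diff_weight \<alpha> \<beta> s" by (rule fourier_weight_diff_weight)
  note fL = weighted_L2D[OF f]
  have [measurable]: "fourier f \<in> borel_measurable borel" using fL by auto
  have "(\<integral>\<^sup>+ x. ennreal ((norm (fourier f x))\<^sup>2) * ennreal (1 + 1 / quad_weight \<alpha> \<beta> s x) \<partial>lborel) = l2sq (\<Phi> f)"
    unfolding l2sq_def
  proof (rule nn_integral_cong)
    fix x
    have w: "1 + 1 / quad_weight \<alpha> \<beta> s x = diff_weight \<alpha> \<beta> s x" by (simp add: diff_weight_def)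
    have "diff_weight \<alpha> \<beta> s x \<ge> 0" using w_ge_1[of x] by simp
    then show "ennreal ((norm (fourier f x))\<^sup>2) * ennreal (1 + 1 / quad_weight \<alpha> \<beta> s x) = ennreal ((norm (\<Phi> f x))\<^sup>2)"
      unfolding w by (simp add: \<Phi>_def norm_mult power_mult_distrib ennreal_mult mult.commute)
  qed
  also have "\<dots> < \<infinity>" using fL by (simp add: L2_iff)
  finally have "AE u in (\<Pi>\<^sub>M j\<in>{1..4 * s + 1}. lborel :: real measure).
    (\<integral>\<^sup>+ x. ennreal ((norm (fourier f x))\<^sup>2) * inverse (ennreal (\<Sum>j=1..4 * s + 1. diff_symbol \<alpha> \<beta> (u j) x ^ (2 * s))) \<partial>lborel) < \<infinity>"
    by (intro AE_PiM_inverse_symbols_integrable[OF s]) auto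
  then show ?thesis
  proof eventually_elim
    case (elim u)
    then show ?case unfolding difference_sum_def by (intro difference_sum_solvable fL) auto
  qed
qed

text \<open>An almost-everywhere statement has an instance once the measure is nonzero; here the
  total mass is a product of positive factors.\<close>

lemma ex_difference_sum:
  assumes "s \<ge> 1" and "f \<in> weighted_L2 (diff_weight \<alpha> \<beta> s)"
  shows "\<exists>u. difference_sum \<alpha> \<beta> s u f"
proof (rule ccontr)
  let ?M = "\<Pi>\<^sub>M j\<in>{1..4 * s + 1}. lborel :: real measure"
  interpret P: product_sigma_finite "\<lambda>_::nat. lborel :: real measure" ..
  assume "\<nexists>u. difference_sum \<alpha> \<beta> s u f"
  then have "AE u in ?M. False" using AE_difference_sum[OF assms] by simp
  then have "emeasure ?M (space ?M) = 0"
    by (subst (asm) AE_iff_measurable[OF _ refl]) auto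
  moreover have "emeasure ?M (space ?M) = (\<Prod>j\<in>{1..4 * s + 1}. emeasure lborel (UNIV :: real set))"
    using P.emeasure_PiM[of "{1..4 * s + 1}" "\<lambda>_. UNIV"] by (simp add: space_PiM)
  moreover have "0 < (\<Prod>j\<in>J. emeasure lborel (UNIV :: real set))" if "finite J" for J :: "nat set"
    using that by (induction J) (auto simp: ennreal_zero_less_mult_iff)
  ultimately show False by (metis finite_atLeastAtMost less_irrefl)
qed

lemma difference_sum_imp_diff_space:
  assumes f: "f \<in> L2" and "difference_sum \<alpha> \<beta> s u f"
  shows "f \<in> diff_space \<alpha> \<beta> s"
proof -
  let ?n = "4 * s + 1"
  obtain F where F: "\<And>j. j \<in> {1..?n} \<Longrightarrow> F j \<in> L2"
    and eq: "ae_eq f (\<lambda>x. \<Sum>j=1..?n. cm_conv_fun (cm_power (difference_measure \<alpha> \<beta> (u j)) s) (F j) x)"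
    using assms(2) unfolding difference_sum_def by blast
  let ?h = "\<lambda>j. cm_conv_fun (cm_power (difference_measure \<alpha> \<beta> (u (Suc j))) s) (F (Suc j))"
  have "is_difference \<alpha> \<beta> s (?h j)" if "j < ?n" for j
  proof -
    have Fj: "F (Suc j) \<in> L2" using that by (intro F) auto
    have "?h j = (diff_step \<alpha> \<beta> (u (Suc j)) ^^ s) (F (Suc j))"
      using Fj by (intro cm_conv_fun_difference_power) auto
    then have "?h j \<in> L2" using Fj by auto
    then show ?thesis unfolding is_difference_def using Fj by (auto intro: ae_eq_refl)
  qed
  moreover have "(\<Sum>j=1..?n. cm_conv_fun (cm_power (difference_measure \<alpha> \<beta> (u j)) s) (F j) x) = (\<Sum>j<?n. ?h j x)" for x
    by (rule sum.reindex_bij_witness[of _ Suc "\<lambda>j. j - 1"]) auto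
  ultimately show ?thesis
    unfolding diff_space_def using f eq by (intro CollectI conjI exI[of _ ?n] exI[of _ ?h]) auto
qed

text \<open>Closes the circle: finite weighted norm gives a sum with generic steps, such a sum lies
  in \<open>diff_space\<close>, and every difference has finite weighted norm. The linear structure
  and completeness of \<open>diff_space\<close> are then inherited from the weighted space.\<close>

lemma diff_space_eq:
  assumes "s \<ge> 1"
  shows "diff_space \<alpha> \<beta> s = weighted_L2 (diff_weight \<alpha> \<beta> s)"
proof (intro antisym diff_space_subset subsetI)
  fix f assume f: "f \<in> weighted_L2 (diff_weight \<alpha> \<beta> s)"
  then have "f \<in> L2" by (simp add: weighted_L2_def)
  with ex_difference_sum[OF assms f] show "f \<in> diff_space \<alpha> \<beta> s"
    by (blast intro: difference_sum_imp_diff_space)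
qed

section \<open>Comparison of the quadratic weight with the Sobolev weight\<close>

lemma one_plus_square_power_le: "(1 + x\<^sup>2) ^ k \<le> 2 ^ k * (1 + \<bar>x::real\<bar> ^ (2 * k))"
proof -
  have "(1 + x\<^sup>2) ^ k \<le> (2 * max 1 (x\<^sup>2)) ^ k" by (intro power_mono) auto
  also have "\<dots> \<le> 2 ^ k * (1 + (x\<^sup>2) ^ k)"
    unfolding power_mult_distrib by (intro mult_left_mono) (auto simp: max_def)
  finally show ?thesis by (simp add: power_mult)
qed

lemma quad_weight_le:
  "\<exists>C\<ge>0. \<forall>x. 1 + quad_weight \<alpha> \<beta> s x \<le> C * (1 + \<bar>x\<bar> ^ (2 * (2 * s)))"
proof -
  \<comment> \<open>Chosen so that 4x^2 + 2\<alpha>^2 + 2\<beta>^2 is at most K (1 + x^2).\<close>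
  define K where "K = 1 + 4 + 2 * \<alpha>\<^sup>2 + 2 * \<beta>\<^sup>2"
  have K: "K \<ge> 1" by (simp add: K_def)
  have "1 + quad_weight \<alpha> \<beta> s x \<le> (1 + K ^ (2 * s) * 2 ^ (2 * s)) * (1 + \<bar>x\<bar> ^ (2 * (2 * s)))" for x
  proof -
    have "\<bar>(x - \<alpha>) * (x - \<beta>)\<bar> \<le> (x - \<alpha>)\<^sup>2 + (x - \<beta>)\<^sup>2"
    proof -
      have "0 \<le> (\<bar>x - \<alpha>\<bar> - \<bar>x - \<beta>\<bar>)\<^sup>2" "0 \<le> \<bar>x - \<alpha>\<bar> * \<bar>x - \<beta>\<bar>" by auto
      then show ?thesis unfolding power2_diff abs_mult power2_abs mult.assoc by linarith
    qed
    also have "\<dots> \<le> (2 * x\<^sup>2 + 2 * \<alpha>\<^sup>2) + (2 * x\<^sup>2 + 2 * \<beta>\<^sup>2)"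
      using norm_add_square_le[of x "- \<alpha>"] norm_add_square_le[of x "- \<beta>"] by simp
    also have "\<dots> \<le> K * (1 + x\<^sup>2)"
    proof -
      have "0 \<le> \<alpha>\<^sup>2 * x\<^sup>2" "0 \<le> \<beta>\<^sup>2 * x\<^sup>2" "0 \<le> x\<^sup>2" by simp_all
      then show ?thesis unfolding K_def by (simp add: algebra_simps)
    qed
    finally have "\<bar>(x - \<alpha>) * (x - \<beta>)\<bar> ^ (2 * s) \<le> (K * (1 + x\<^sup>2)) ^ (2 * s)" by (intro power_mono) auto
    also have "\<dots> \<le> K ^ (2 * s) * (2 ^ (2 * s) * (1 + \<bar>x\<bar> ^ (2 * (2 * s))))"
      unfolding power_mult_distrib[of K] using K by (intro mult_left_mono one_plus_square_power_le) auto
    finally have "quad_weight \<alpha> \<beta> s x \<le> K ^ (2 * s) * 2 ^ (2 * s) * (1 + \<bar>x\<bar> ^ (2 * (2 * s)))"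
      by (simp add: power_even_abs power_mult_distrib mult.assoc)
    moreover have "1 + W \<le> (1 + A) * B" if "W \<le> A * B" "1 \<le> B" for W A B :: real
      using that by (simp add: distrib_right)
    ultimately show ?thesis by simp
  qed
  then show ?thesis using K by (intro exI[of _ "1 + K ^ (2 * s) * 2 ^ (2 * s)"]) auto
qed

text \<open>Both sides have degree 4s, and the constant 1 compensates for the zeros at \<alpha> and
  \<beta>. The comparison passes through the sum of squares of x - \<alpha> and x - \<beta>, which
  \<open>power_bound_sum_squares\<close> controls by their product because their difference is
  constant.\<close>

lemma quad_weight_ge:
  "\<exists>C\<ge>0. \<forall>x. 1 + \<bar>x\<bar> ^ (2 * (2 * s)) \<le> C * (1 + quad_weight \<alpha> \<beta> s x)"
proof -
  define K where "K = 2 * (1 + \<alpha>\<^sup>2)"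
  define L where "L = (2 * (2 + (\<beta> - \<alpha>)\<^sup>2)) ^ (2 * s)"
  have K: "K \<ge> 1" and L: "L \<ge> 0" by (auto simp: K_def L_def)
  have "1 + \<bar>x\<bar> ^ (2 * (2 * s)) \<le> 2 * K ^ (2 * s) * L * (1 + quad_weight \<alpha> \<beta> s x)" for x
  proof -
    let ?a = "x - \<alpha>" and ?b = "x - \<beta>"
    have "\<bar>x\<bar> ^ (2 * (2 * s)) = (x\<^sup>2) ^ (2 * s)"
      by (simp only: power_mult[of "\<bar>x\<bar>" 2 "2 * s"] power2_abs)
    also have "\<dots> \<le> (1 + x\<^sup>2) ^ (2 * s)" by (intro power_mono) auto
    finally have "1 + \<bar>x\<bar> ^ (2 * (2 * s)) \<le> 2 * (1 + x\<^sup>2) ^ (2 * s)"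
      using one_le_power[of "1 + x\<^sup>2" "2 * s"] zero_le_power2[of x] by linarith
    also have "(1 + x\<^sup>2) ^ (2 * s) \<le> (K * (1 + ?a\<^sup>2 + ?b\<^sup>2)) ^ (2 * s)"
    proof (intro power_mono)
      have "x\<^sup>2 \<le> 2 * ?a\<^sup>2 + 2 * \<alpha>\<^sup>2" using norm_add_square_le[of "x - \<alpha>" \<alpha>] by simp
      moreover have "0 \<le> \<alpha>\<^sup>2 * ?a\<^sup>2" "0 \<le> \<alpha>\<^sup>2 * ?b\<^sup>2" "0 \<le> ?b\<^sup>2" by simp_all
      moreover have "K * (1 + ?a\<^sup>2 + ?b\<^sup>2) = 2 + 2 * ?a\<^sup>2 + 2 * ?b\<^sup>2 + 2 * \<alpha>\<^sup>2 + 2 * (\<alpha>\<^sup>2 * ?a\<^sup>2) + 2 * (\<alpha>\<^sup>2 * ?b\<^sup>2)"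
        unfolding K_def by (simp add: distrib_left distrib_right)
      ultimately show "1 + x\<^sup>2 \<le> K * (1 + ?a\<^sup>2 + ?b\<^sup>2)" by linarith
    qed auto
    also have "(K * (1 + ?a\<^sup>2 + ?b\<^sup>2)) ^ (2 * s) = K ^ (2 * s) * (1 + ?a\<^sup>2 + ?b\<^sup>2) ^ (2 * s)"
      by (rule power_mult_distrib)
    also have "(1 + ?a\<^sup>2 + ?b\<^sup>2) ^ (2 * s) \<le> L * (1 + \<bar>?a * ?b\<bar> ^ (2 * s))"
      unfolding L_def by (rule power_bound_sum_squares) simp
    also have "\<bar>?a * ?b\<bar> ^ (2 * s) = quad_weight \<alpha> \<beta> s x"
      by (simp add: power_even_abs power_mult_distrib)
    finally show ?thesis using K by (simp add: mult.assoc)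
  qed
  then show ?thesis using K L by (intro exI[of _ "2 * K ^ (2 * s) * L"]) auto
qed

section \<open>The differential operator\<close>

lemma cpoly_quad_symbol_power: "cpoly (quad_symbol \<alpha> \<beta> ^ s) x = (- of_real ((x - \<alpha>) * (x - \<beta>))) ^ s"
  by (simp only: poly_power cpoly_quad_symbol)

lemma norm_cpoly_quad_symbol_power: "(norm (cpoly (quad_symbol \<alpha> \<beta> ^ s) x))\<^sup>2 = quad_weight \<alpha> \<beta> s x"
proof -
  have "(norm (cpoly (quad_symbol \<alpha> \<beta> ^ s) x))\<^sup>2 = (\<bar>(x - \<alpha>) * (x - \<beta>)\<bar> ^ s)\<^sup>2"
    unfolding cpoly_quad_symbol_power norm_power norm_minus_cancel norm_of_real ..
  also have "\<dots> = \<bar>(x - \<alpha>) * (x - \<beta>)\<bar> ^ (2 * s)"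
    by (simp only: power_mult[symmetric] mult.commute[of s])
  also have "\<dots> = quad_weight \<alpha> \<beta> s x"
    by (simp add: power_even_abs power_mult_distrib)
  finally show ?thesis .
qed

abbreviation (input) sobolev_weight :: "nat \<Rightarrow> real \<Rightarrow> real" where
  "sobolev_weight k x \<equiv> 1 + \<bar>x\<bar> ^ (2 * k)"

text \<open>Shows that the choice in \<open>diff_op\<close> is not void: the symbol grows no faster
  than the square root of the Sobolev weight, so the symbol times \<open>fourier f\<close> lies in
  L2 and is a transform.\<close>

lemma diff_op_spec:
  assumes f: "f \<in> sobolev (2 * s)"
  shows "is_L2_function (diff_op_distr \<alpha> \<beta> s f) (diff_op \<alpha> \<beta> s f)"
    and "diff_op \<alpha> \<beta> s f \<in> L2 \<and>
      (AE x in lborel. fourier (diff_op \<alpha> \<beta> s f) x = cpoly (quad_symbol \<alpha> \<beta> ^ s) x * fourier f x)"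
proof -
  interpret fourier_weight "sobolev_weight (2 * s)" by (rule fourier_weight_sobolev)
  let ?m = "cpoly (quad_symbol \<alpha> \<beta> ^ s)"
  note fL = weighted_L2D[OF f[unfolded sobolev_eq]]
  have [measurable]: "fourier f \<in> borel_measurable borel" using fL(1) by (rule fourier_borel)
  have iff: "is_L2_function (diff_op_distr \<alpha> \<beta> s f) h \<longleftrightarrow> h \<in> L2 \<and> (AE x in lborel. fourier h x = ?m x * fourier f x)" for h
    by (rule is_L2_function_multiplier_iff[OF fL(1) diff_op_distr_eq[OF fL(1)]])
  obtain C where C: "C \<ge> 0" "\<And>x. 1 + quad_weight \<alpha> \<beta> s x \<le> C * sobolev_weight (2 * s) x"
    using quad_weight_le[of \<alpha> s \<beta>] by blast
  have "(\<lambda>x. ?m x * fourier f x) \<in> L2"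
  proof (rule L2_bound[OF L2_cmult[OF fL(2)]])
    show "(\<lambda>x. ?m x * fourier f x) \<in> borel_measurable borel" by measurable
    have "norm (?m x * fourier f x) \<le> norm (of_real (sqrt C) * \<Phi> f x)" for x
    proof (rule power2_le_imp_le)
      have "(norm (?m x * fourier f x))\<^sup>2 = quad_weight \<alpha> \<beta> s x * (norm (fourier f x))\<^sup>2"
        unfolding norm_mult power_mult_distrib norm_cpoly_quad_symbol_power ..
      also have "\<dots> \<le> (C * sobolev_weight (2 * s) x) * (norm (fourier f x))\<^sup>2"
        using C(2)[of x] by (intro mult_right_mono) auto
      also have "\<dots> = (norm (of_real (sqrt C) * \<Phi> f x))\<^sup>2"
        using C(1) unfolding \<Phi>_def by (simp add: norm_mult power_mult_distrib)
      finally show "(norm (?m x * fourier f x))\<^sup>2 \<le> (norm (of_real (sqrt C) * \<Phi> f x))\<^sup>2" .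
    qed simp
    then show "AE x in lborel. norm (?m x * fourier f x) \<le> norm (of_real (sqrt C) * \<Phi> f x)" by simp
  qed
  from fourier_surj[OF this] have "\<exists>h. is_L2_function (diff_op_distr \<alpha> \<beta> s f) h"
    unfolding iff ae_eq_def by blast
  then show "is_L2_function (diff_op_distr \<alpha> \<beta> s f) (diff_op \<alpha> \<beta> s f)"
    unfolding diff_op_def by (rule someI_ex)
  then show "diff_op \<alpha> \<beta> s f \<in> L2 \<and> (AE x in lborel. fourier (diff_op \<alpha> \<beta> s f) x = ?m x * fourier f x)"
    unfolding iff .
qed

lemma bounded_operator_diff_op:
  "bounded_operator (sobolev (2 * s)) (sobolev_inner (2 * s))
     (weighted_L2 (diff_weight \<alpha> \<beta> s)) (diff_inner \<alpha> \<beta> s) (diff_op \<alpha> \<beta> s)"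
proof -
  obtain C where C: "C \<ge> 0" "\<And>x. 1 + quad_weight \<alpha> \<beta> s x \<le> C * sobolev_weight (2 * s) x"
    using quad_weight_le[of \<alpha> s \<beta>] by blast
  show ?thesis
    unfolding sobolev_eq
  proof (rule multiplier_bounded_operator[OF fourier_weight_sobolev fourier_weight_diff_weight _ C(1)])
    show "diff_op \<alpha> \<beta> s f \<in> L2 \<and> (AE x in lborel. fourier (diff_op \<alpha> \<beta> s f) x = cpoly (quad_symbol \<alpha> \<beta> ^ s) x * fourier f x)"
      if "f \<in> weighted_L2 (sobolev_weight (2 * s))" for f
      using that by (intro diff_op_spec(2)) (simp only: sobolev_eq)
    show "AE x in lborel. (norm (cpoly (quad_symbol \<alpha> \<beta> ^ s) x))\<^sup>2 * diff_weight \<alpha> \<beta> s x \<le> C * sobolev_weight (2 * s) x"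
    proof (rule AE_I2)
      fix x
      \<comment> \<open>Equality except at \<open>W = 0\<close>, where the left side is 0.\<close>
      have "W * (1 + 1 / W) \<le> 1 + W" for W :: real by (cases "W = 0") (auto simp: distrib_left)
      from order_trans[OF this C(2)]
      show "(norm (cpoly (quad_symbol \<alpha> \<beta> ^ s) x))\<^sup>2 * diff_weight \<alpha> \<beta> s x \<le> C * sobolev_weight (2 * s) x"
        unfolding norm_cpoly_quad_symbol_power diff_weight_def .
    qed
  qed
qed

lemma AE_quad_weight_pos: "AE x in lborel. quad_weight \<alpha> \<beta> s x > 0"
proof -
  have "AE x in lborel. x \<noteq> \<alpha>" "AE x in lborel. x \<noteq> \<beta>" by (intro AE_lborel_singleton)+
  then show ?thesis
    by eventually_elim (simp add: zero_less_mult_iff zero_less_power_eq)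
qed

text \<open>The inverse multiplies by the reciprocal of the symbol. Its singularities at \<alpha>
  and \<beta> are harmless because the squared modulus of the reciprocal is a summand of
  \<open>diff_weight\<close>, and the symbol is nonzero almost everywhere.\<close>

lemma invertible_operator_diff_op:
  "invertible_operator (sobolev (2 * s)) (sobolev_inner (2 * s))
     (weighted_L2 (diff_weight \<alpha> \<beta> s)) (diff_inner \<alpha> \<beta> s) (diff_op \<alpha> \<beta> s)"
proof -
  let ?m = "cpoly (quad_symbol \<alpha> \<beta> ^ s)"
  let ?V = "weighted_L2 (diff_weight \<alpha> \<beta> s)"
  interpret fourier_weight "diff_weight \<alpha> \<beta> s" by (rule fourier_weight_diff_weight)
  obtain C where C: "C \<ge> 0" "\<And>x. sobolev_weight (2 * s) x \<le> C * (1 + quad_weight \<alpha> \<beta> s x)"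
    using quad_weight_ge[of s \<alpha> \<beta>] by blast
  have m0: "AE x in lborel. ?m x \<noteq> 0"
    using AE_quad_weight_pos[of \<alpha> s \<beta>] unfolding norm_cpoly_quad_symbol_power[symmetric]
    by (rule eventually_mono) auto
  have "\<exists>g. g \<in> L2 \<and> (AE x in lborel. fourier g x = inverse (?m x) * fourier f x)" if f: "f \<in> ?V" for f
  proof -
    note fL = weighted_L2D[OF f]
    have [measurable]: "fourier f \<in> borel_measurable borel" using fL(1) by (rule fourier_borel)
    have "(\<lambda>x. inverse (?m x) * fourier f x) \<in> L2"
    proof (rule L2_bound[OF fL(2)])
      show "(\<lambda>x. inverse (?m x) * fourier f x) \<in> borel_measurable borel" by measurable
      have "norm (inverse (?m x) * fourier f x) \<le> norm (\<Phi> f x)" for x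
      proof (rule power2_le_imp_le)
        have "(norm (inverse (?m x) * fourier f x))\<^sup>2 = inverse (quad_weight \<alpha> \<beta> s x) * (norm (fourier f x))\<^sup>2"
          unfolding norm_mult power_mult_distrib norm_inverse power_inverse norm_cpoly_quad_symbol_power ..
        also have "\<dots> \<le> diff_weight \<alpha> \<beta> s x * (norm (fourier f x))\<^sup>2"
          unfolding diff_weight_def inverse_eq_divide by (intro mult_right_mono) auto
        also have "\<dots> = (norm (\<Phi> f x))\<^sup>2"
          using w_ge_1[of x] unfolding \<Phi>_def by (simp add: norm_mult power_mult_distrib)
        finally show "(norm (inverse (?m x) * fourier f x))\<^sup>2 \<le> (norm (\<Phi> f x))\<^sup>2" .
      qed simp
      then show "AE x in lborel. norm (inverse (?m x) * fourier f x) \<le> norm (\<Phi> f x)" by simp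
    qed
    from fourier_surj[OF this] show ?thesis unfolding ae_eq_def by blast
  qed
  then obtain S where S: "\<And>f. f \<in> ?V \<Longrightarrow> S f \<in> L2 \<and> (AE x in lborel. fourier (S f) x = inverse (?m x) * fourier f x)"
    by metis
  have bS: "bounded_operator ?V (diff_inner \<alpha> \<beta> s) (sobolev (2 * s)) (sobolev_inner (2 * s)) S"
    unfolding sobolev_eq
  proof (rule multiplier_bounded_operator[OF fourier_weight_diff_weight fourier_weight_sobolev S C(1)])
    show "AE x in lborel. (norm (inverse (?m x)))\<^sup>2 * sobolev_weight (2 * s) x \<le> C * diff_weight \<alpha> \<beta> s x"
      using AE_quad_weight_pos[of \<alpha> s \<beta>]
    proof (rule eventually_mono)
      fix x assume pos: "quad_weight \<alpha> \<beta> s x > 0"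
      let ?W = "quad_weight \<alpha> \<beta> s x"
      \<comment> \<open>The remaining comparison of weights is that of \<open>quad_weight_ge\<close>
        divided by the positive quadratic weight.\<close>
      have "inverse W * X \<le> C * (1 + 1 / W)" if "W > 0" "X \<le> C * (1 + W)" for W X :: real
      proof -
        have "inverse W * X \<le> inverse W * (C * (1 + W))" using that by (intro mult_left_mono) auto
        also have "\<dots> = C * (1 + 1 / W)" using that by (simp add: field_simps)
        finally show ?thesis .
      qed
      from this[OF pos C(2)[of x]]
      show "(norm (inverse (?m x)))\<^sup>2 * sobolev_weight (2 * s) x \<le> C * diff_weight \<alpha> \<beta> s x"
        unfolding norm_inverse power_inverse norm_cpoly_quad_symbol_power diff_weight_def .
    qed
  qed
  have S_sobolev: "S f \<in> sobolev (2 * s)" if "f \<in> ?V" for f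
    using bS that by (simp add: bounded_operator_def linear_operator_def)
  have T_V: "diff_op \<alpha> \<beta> s f \<in> ?V" if "f \<in> sobolev (2 * s)" for f
    using bounded_operator_diff_op that by (simp add: bounded_operator_def linear_operator_def)
  have "ae_eq (S (diff_op \<alpha> \<beta> s f)) f" if f: "f \<in> sobolev (2 * s)" for f
  proof (rule fourier_inject)
    show "S (diff_op \<alpha> \<beta> s f) \<in> L2" using S[OF T_V[OF f]] by blast
    show "f \<in> L2" using f by (simp add: sobolev_def)
    show "ae_eq (fourier (S (diff_op \<alpha> \<beta> s f))) (fourier f)"
      using S[OF T_V[OF f], THEN conjunct2] diff_op_spec(2)[OF f, of \<alpha> \<beta>, THEN conjunct2] m0
      unfolding ae_eq_def by eventually_elim simp
  qed
  moreover have "ae_eq (diff_op \<alpha> \<beta> s (S h)) h" if h: "h \<in> ?V" for h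
  proof (rule fourier_inject)
    show "diff_op \<alpha> \<beta> s (S h) \<in> L2" using diff_op_spec(2)[OF S_sobolev[OF h]] by blast
    show "h \<in> L2" using weighted_L2D(1)[OF h] .
    show "ae_eq (fourier (diff_op \<alpha> \<beta> s (S h))) (fourier h)"
      using S[OF h, THEN conjunct2] diff_op_spec(2)[OF S_sobolev[OF h], of \<alpha> \<beta>, THEN conjunct2] m0
      unfolding ae_eq_def by eventually_elim simp
  qed
  ultimately show ?thesis unfolding invertible_operator_def using bS by blast
qed

lemma invertible_imp_onto:
  assumes "invertible_operator V ipV W ipW T"
  shows "onto_operator V W T"
  using assms unfolding invertible_operator_def onto_operator_def bounded_operator_def linear_operator_def by metis

text \<open>The identification of \<open>diff_space\<close> with a weighted space reduces each
  clause to an earlier result. Two clauses exclude vacuous readings of the definitions: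
  integrability shows that the inner product is not a default value 0, and
  \<open>is_L2_function\<close> that \<open>diff_op\<close> really represents the
  distribution.\<close>

theorem theorem3p1:
  fixes s :: nat and \<alpha> \<beta> :: real
  assumes "s \<ge> 1"
  shows
    "(\<forall>f\<in>L2.
        ((\<integral>\<^sup>+ x. ennreal ((norm (fourier f x))\<^sup>2 / ((x - \<alpha>) ^ (2 * s) * (x - \<beta>) ^ (2 * s))) \<partial>lborel) < \<infinity>
           \<longleftrightarrow> f \<in> diff_space \<alpha> \<beta> s) \<and>
        (f \<in> diff_space \<alpha> \<beta> s \<longleftrightarrow>
           (\<exists>u :: nat \<Rightarrow> real. \<exists>F :: nat \<Rightarrow> real \<Rightarrow> complex.
              (\<forall>j\<in>{1..4 * s + 1}. F j \<in> L2) \<and>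
              ae_eq f (\<lambda>x. \<Sum>j=1..4 * s + 1.
                 cm_conv_fun (cm_power (difference_measure \<alpha> \<beta> (u j)) s) (F j) x))) \<and>
        (f \<in> diff_space \<alpha> \<beta> s \<longrightarrow>
           (AE u in (\<Pi>\<^sub>M j\<in>{1..4 * s + 1}. lborel :: real measure).
              \<exists>F :: nat \<Rightarrow> real \<Rightarrow> complex.
                (\<forall>j\<in>{1..4 * s + 1}. F j \<in> L2) \<and>
                ae_eq f (\<lambda>x. \<Sum>j=1..4 * s + 1.
                   cm_conv_fun (cm_power (difference_measure \<alpha> \<beta> (u j)) s) (F j) x))))
     \<and> (\<forall>f\<in>diff_space \<alpha> \<beta> s. \<forall>g\<in>diff_space \<alpha> \<beta> s.
          integrable lborel
            (\<lambda>x. of_real (diff_weight \<alpha> \<beta> s x) * fourier f x * cnj (fourier g x)))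
     \<and> hilbert_space (diff_space \<alpha> \<beta> s) (diff_inner \<alpha> \<beta> s)
     \<and> (\<forall>f\<in>sobolev (2 * s). is_L2_function (diff_op_distr \<alpha> \<beta> s f) (diff_op \<alpha> \<beta> s f))
     \<and> bounded_operator (sobolev (2 * s)) (sobolev_inner (2 * s))
         (diff_space \<alpha> \<beta> s) (diff_inner \<alpha> \<beta> s) (diff_op \<alpha> \<beta> s)
     \<and> onto_operator (sobolev (2 * s)) (diff_space \<alpha> \<beta> s) (diff_op \<alpha> \<beta> s)
     \<and> invertible_operator (sobolev (2 * s)) (sobolev_inner (2 * s))
         (diff_space \<alpha> \<beta> s) (diff_inner \<alpha> \<beta> s) (diff_op \<alpha> \<beta> s)"
proof (intro conjI ballI)
  let ?V = "weighted_L2 (diff_weight \<alpha> \<beta> s)"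
  interpret fourier_weight "diff_weight \<alpha> \<beta> s" by (rule fourier_weight_diff_weight)
  note V = diff_space_eq[OF assms, of \<alpha> \<beta>]
  fix f assume f: "f \<in> L2"
  show "(\<integral>\<^sup>+ x. ennreal ((norm (fourier f x))\<^sup>2 / ((x - \<alpha>) ^ (2 * s) * (x - \<beta>) ^ (2 * s))) \<partial>lborel) < \<infinity>
           \<longleftrightarrow> f \<in> diff_space \<alpha> \<beta> s"
    using f by (simp only: V weighted_L2_diff_weight_iff simp_thms)
  show "f \<in> diff_space \<alpha> \<beta> s \<longleftrightarrow> (\<exists>u :: nat \<Rightarrow> real. \<exists>F :: nat \<Rightarrow> real \<Rightarrow> complex.
              (\<forall>j\<in>{1..4 * s + 1}. F j \<in> L2) \<and>
              ae_eq f (\<lambda>x. \<Sum>j=1..4 * s + 1.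
                 cm_conv_fun (cm_power (difference_measure \<alpha> \<beta> (u j)) s) (F j) x))"
    unfolding difference_sum_def[symmetric]
    using ex_difference_sum[OF assms, of f \<alpha> \<beta>] difference_sum_imp_diff_space[OF f, of \<alpha> \<beta> s] V by blast
  show "f \<in> diff_space \<alpha> \<beta> s \<longrightarrow> (AE u in (\<Pi>\<^sub>M j\<in>{1..4 * s + 1}. lborel :: real measure).
              \<exists>F :: nat \<Rightarrow> real \<Rightarrow> complex.
                (\<forall>j\<in>{1..4 * s + 1}. F j \<in> L2) \<and>
                ae_eq f (\<lambda>x. \<Sum>j=1..4 * s + 1.
                   cm_conv_fun (cm_power (difference_measure \<alpha> \<beta> (u j)) s) (F j) x))"
    unfolding difference_sum_def[symmetric] V using AE_difference_sum[OF assms] by blast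
next
  interpret fourier_weight "diff_weight \<alpha> \<beta> s" by (rule fourier_weight_diff_weight)
  note V = diff_space_eq[OF assms, of \<alpha> \<beta>]
  show "integrable lborel (\<lambda>x. of_real (diff_weight \<alpha> \<beta> s x) * fourier f x * cnj (fourier g x))"
    if "f \<in> diff_space \<alpha> \<beta> s" "g \<in> diff_space \<alpha> \<beta> s" for f g
    using that unfolding V by (rule integrable_inner)
  show "hilbert_space (diff_space \<alpha> \<beta> s) (diff_inner \<alpha> \<beta> s)"
    unfolding V by (rule hilbert_space)
  show "is_L2_function (diff_op_distr \<alpha> \<beta> s f) (diff_op \<alpha> \<beta> s f)" if "f \<in> sobolev (2 * s)" for f
    using that by (rule diff_op_spec(1))
  show "bounded_operator (sobolev (2 * s)) (sobolev_inner (2 * s))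
         (diff_space \<alpha> \<beta> s) (diff_inner \<alpha> \<beta> s) (diff_op \<alpha> \<beta> s)"
    unfolding V by (rule bounded_operator_diff_op)
  show "invertible_operator (sobolev (2 * s)) (sobolev_inner (2 * s))
         (diff_space \<alpha> \<beta> s) (diff_inner \<alpha> \<beta> s) (diff_op \<alpha> \<beta> s)"
    unfolding V by (rule invertible_operator_diff_op)
  then show "onto_operator (sobolev (2 * s)) (diff_space \<alpha> \<beta> s) (diff_op \<alpha> \<beta> s)"
    by (rule invertible_imp_onto)
qed

end
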